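(* Let $R=k[S]_{\mathfrak m_S}$ be the localization of an affine semigroup ring at its maximal monomial ideal (as in the context). Let $\mathfrak a_\bullet$ and $\mathfrak b_\bullet$ be filtrations of $\mathfrak m_S$-primary monomial ideals of $R$, and assume that the Rees algebra $\mathcal R(\mathfrak a_\bullet)=\bigoplus_{p\ge0}\mathfrak a_pT^p$ is Noetherian. Suppose moreover that there exist an $\mathfrak m_S$-primary monomial ideal $\mathfrak q$ and a finite rational polyhedral fan $\Sigma$ supported on $\sigma$ such that: (1) $\mathfrak a_\bullet$ and $\mathfrak b_\bullet$ are linearly bounded with respect to $\mathfrak q$; (2) the functions $u\mapsto v_u(\mathfrak a_\bullet)$ and $u\mapsto v_u(\mathfrak b_\bullet)$, $\sigma^\circ\cap N\to\mathbb R_{\ge0}$, admit continuous extensions to $\sigma$, positively homogeneous of degree $1$ and linear on every cone $\tau\in\Sigma$; denote the values of these extensions at $u\in\sigma$ by $\widetilde v_u(\mathfrak a_\bullet)$ and $\widetilde v_u(\mathfrak b_\bullet)$. Let $\rho_1,\dots,\rho_M$ be the rays of $\Sigma$, with primitive generators $u_1,\dots,u_M\in N$. Then $$\mathcal L_{\mathfrak b_\bullet}(\mathfrak a_\bullet)=\sup_{u\in\sigma^\circ\cap N}\frac{v_u(\mathfrak a_\bullet)}{v_u(\mathfrak b_\bullet)}=\max_{\{j:\ \widetilde v_{u_j}(\mathfrak b_\bullet)>0\}}\frac{\widetilde v_{u_j}(\mathfrak a_\bullet)}{\widetilde v_{u_j}(\mathfrak b_\bullet)}.$$ In particular, $\mathcal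 L_{\mathfrak b_\bullet}(\mathfrak a_\bullet)$ is computed by finitely many toric divisorial valuations.
   Context: Toric setting: $k$ is a field, $N\cong\mathbb Z^n$ a lattice, $M=\operatorname{Hom}_{\mathbb Z}(N,\mathbb Z)$ its dual, and $S\subseteq M$ a finitely generated (not necessarily saturated) subsemigroup such that $\sigma^\vee:=\mathbb R_{\ge0}\cdot S\subseteq M_{\mathbb R}$ is a pointed rational polyhedral cone of full dimension $n$; $\sigma\subseteq N_{\mathbb R}$ is its dual cone, with relative interior $\sigma^\circ$. $k[S]$ has monomials $\chi^m$, $m\in S$, and $\mathfrak m_S=(\chi^m:m\in S\setminus\{0\})$. An ideal of $R$ is monomial if it is generated by monomials. For $u\in\sigma\cap N$, the toric valuation $v_u$ on $R$ is determined by $v_u(\chi^m)=\langle u,m\rangle$ (the value of a sum of monomials being the minimum over its terms). A filtration is a family $\{\mathfrak a_p\}_{p\ge1}$ of proper ideals with $\mathfrak a_p\mathfrak a_{p'}\subseteq\mathfrak a_{p+p'}$ and $\mathfrak a_{p+1}\subseteq\mathfrak a_p$ for all $p,p'\ge1$ (and $\mathfrak a_0=R$). It is linearly bounded with respect to $\mathfrak q$ if there are constants $c,C>0$ with $\overline{\mathfrak q^{\lceil cp\rceil}}\subseteq\overline{\mathfrak a_p}\subseteq\overline{\mathfrak q^{\lfloor Cp\rfloor}}$ for all $p\ge1$, where $\overline I$ is the integral closure of $I$. $v(I):=\min\{v(x):x\in I\}$ and $v(\mathfrak a_\bullet):=\lim_{p\to\infty}\frac{v(\mathfrak a_p)}p=\inf_{p\ge1}\frac{v(\mathfrak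 a_p)}p$. Algebraic Łojasiewicz exponent: $\mathcal L_{\mathfrak b_\bullet}(\mathfrak a_\bullet):=\inf\{\frac qp\in\mathbb Q_{>0}:\ \mathfrak b_{qt}\subseteq\overline{\mathfrak a_{pt}}\text{ for all integers }t\gg1\}$, with $\inf\emptyset=\infty$. *)

theory Defs
  imports
    "HOL-Analysis.Analysis"
    "HOL-Library.Poly_Mapping"
    "HOL-Algebra.Ideal_Product"
    "HOL-Algebra.Ring_Divisibility"
    "HOL-Algebra.UnivPoly"
begin

section \<open>Ideals in commutative rings\<close>

definition radical_ideal :: "('a, 'b) ring_scheme \<Rightarrow> 'a set \<Rightarrow> 'a set" where
  "radical_ideal R I = {x \<in> carrier R. \<exists>n::nat. x [^]\<^bsub>R\<^esub> n \<in> I}"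

definition primary_ideal :: "('a, 'b) ring_scheme \<Rightarrow> 'a set \<Rightarrow> bool" where
  "primary_ideal R I \<longleftrightarrow> ideal I R \<and> I \<noteq> carrier R \<and>
     (\<forall>x\<in>carrier R. \<forall>y\<in>carrier R. x \<otimes>\<^bsub>R\<^esub> y \<in> I \<longrightarrow> x \<in> I \<or> (\<exists>n::nat. y [^]\<^bsub>R\<^esub> n \<in> I))"

definition ideal_power :: "('a, 'b) ring_scheme \<Rightarrow> 'a set \<Rightarrow> nat \<Rightarrow> 'a set" where
  "ideal_power R I n = I [^]\<^bsub>ideals_set R\<^esub> n"

definition integral_closure :: "('a, 'b) ring_scheme \<Rightarrow> 'a set \<Rightarrow> 'a set" where
  "integral_closure R I =
     {x \<in> carrier R. \<exists>n\<ge>1. \<exists>c::nat \<Rightarrow> 'a.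
        (\<forall>i\<in>{1..n}. c i \<in> ideal_power R I i) \<and>
        x [^]\<^bsub>R\<^esub> n \<oplus>\<^bsub>R\<^esub> (\<Oplus>\<^bsub>R\<^esub>i\<in>{1..n}. c i \<otimes>\<^bsub>R\<^esub> x [^]\<^bsub>R\<^esub> (n - i)) = \<zero>\<^bsub>R\<^esub>}"

definition ideal_filtration :: "('a, 'b) ring_scheme \<Rightarrow> (nat \<Rightarrow> 'a set) \<Rightarrow> bool" where
  "ideal_filtration R a \<longleftrightarrow>
     a 0 = carrier R \<and>
     (\<forall>p\<ge>1. ideal (a p) R \<and> a p \<noteq> carrier R) \<and>
     (\<forall>p\<ge>1. \<forall>p'\<ge>1. ideal_prod R (a p) (a p') \<subseteq> a (p + p')) \<and>
     (\<forall>p\<ge>1. a (p + 1) \<subseteq> a p)"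

definition linearly_bounded :: "('a, 'b) ring_scheme \<Rightarrow> 'a set \<Rightarrow> (nat \<Rightarrow> 'a set) \<Rightarrow> bool" where
  "linearly_bounded R q a \<longleftrightarrow>
     (\<exists>c C::real. c > 0 \<and> C > 0 \<and>
        (\<forall>p\<ge>1. integral_closure R (ideal_power R q (nat \<lceil>c * real p\<rceil>)) \<subseteq> integral_closure R (a p) \<and>
                integral_closure R (a p) \<subseteq> integral_closure R (ideal_power R q (nat \<lfloor>C * real p\<rfloor>))))"

text \<open>The Rees algebra as the subring of \<open>R[T]\<close> whose coefficient of \<open>T\<^sup>p\<close> lies in \<open>a p\<close>.\<close>

definition rees_algebra :: "('a, 'b) ring_scheme \<Rightarrow> (nat \<Rightarrow> 'a set) \<Rightarrow> ('a, nat \<Rightarrow> 'a) up_ring" where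
  "rees_algebra R a = (UP R)\<lparr>carrier := {f \<in> carrier (UP R). \<forall>p. f p \<in> a p}\<rparr>"

definition lojasiewicz_exponent ::
  "('a, 'b) ring_scheme \<Rightarrow> (nat \<Rightarrow> 'a set) \<Rightarrow> (nat \<Rightarrow> 'a set) \<Rightarrow> ereal" where
  "lojasiewicz_exponent R b a =
     Inf {ereal (real q / real p) | p q. p \<ge> 1 \<and> q \<ge> 1 \<and>
            (\<forall>\<^sub>F t in sequentially. b (q * t) \<subseteq> integral_closure R (a (p * t)))}"


section \<open>Localization\<close>

definition loc_rel :: "('a, 'b) ring_scheme \<Rightarrow> 'a set \<Rightarrow> (('a \<times> 'a) \<times> ('a \<times> 'a)) set" where
  "loc_rel A T = {((a, s), (b, t)). a \<in> carrier A \<and> b \<in> carrier A \<and> s \<in> T \<and> t \<in> T \<and>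
     (\<exists>w\<in>T. w \<otimes>\<^bsub>A\<^esub> (t \<otimes>\<^bsub>A\<^esub> a \<ominus>\<^bsub>A\<^esub> s \<otimes>\<^bsub>A\<^esub> b) = \<zero>\<^bsub>A\<^esub>)}"

definition loc_frac :: "('a, 'b) ring_scheme \<Rightarrow> 'a set \<Rightarrow> 'a \<Rightarrow> 'a \<Rightarrow> ('a \<times> 'a) set" where
  "loc_frac A T a s = loc_rel A T `` {(a, s)}"

text \<open>The operations take the union over all representatives; all members of that union coincide
  when \<open>T\<close> is a multiplicative subset.\<close>

definition localization :: "('a, 'b) ring_scheme \<Rightarrow> 'a set \<Rightarrow> ('a \<times> 'a) set ring" where
  "localization A T =
     \<lparr>carrier = (carrier A \<times> T) // loc_rel A T,
      mult = (\<lambda>X Y. \<Union>(a, s)\<in>X. \<Union>(b, t)\<in>Y. loc_frac A T (a \<otimes>\<^bsub>A\<^esub> b) (s \<otimes>\<^bsub>A\<^esub> t)),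
      one = loc_frac A T \<one>\<^bsub>A\<^esub> \<one>\<^bsub>A\<^esub>,
      zero = loc_frac A T \<zero>\<^bsub>A\<^esub> \<one>\<^bsub>A\<^esub>,
      add = (\<lambda>X Y. \<Union>(a, s)\<in>X. \<Union>(b, t)\<in>Y.
               loc_frac A T (a \<otimes>\<^bsub>A\<^esub> t \<oplus>\<^bsub>A\<^esub> b \<otimes>\<^bsub>A\<^esub> s) (s \<otimes>\<^bsub>A\<^esub> t))\<rparr>"


section \<open>Lattices, cones and fans\<close>

text \<open>A basis identifies both \<open>N\<close> and \<open>M\<close> with \<open>int ^ 'n\<close>, and \<open>N\<^sub>\<real>\<close> and \<open>M\<^sub>\<real>\<close>
  with \<open>real ^ 'n\<close>; the duality pairing becomes the standard one.\<close>

definition lattice_pairing :: "int ^ 'n \<Rightarrow> int ^ 'n \<Rightarrow> int" where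
  "lattice_pairing u m = (\<Sum>i\<in>UNIV. u $ i * m $ i)"

definition real_vec :: "int ^ 'n \<Rightarrow> real ^ 'n" where
  "real_vec u = (\<chi> i. real_of_int (u $ i))"

text \<open>Subsemigroups of a lattice are understood to contain \<open>0\<close>.\<close>

definition fg_semigroup :: "(int ^ 'n) set \<Rightarrow> bool" where
  "fg_semigroup S \<longleftrightarrow>
     (\<exists>G. finite G \<and> S = (\<lambda>T. 0 \<in> T \<and> (\<forall>x\<in>T. \<forall>y\<in>T. x + y \<in> T)) hull G)"

definition semigroup_cone :: "(int ^ 'n) set \<Rightarrow> (real ^ 'n) set" where
  "semigroup_cone S = convex_cone hull (real_vec ` S)"

definition dual_cone :: "(real ^ 'n) set \<Rightarrow> (real ^ 'n) set" where
  "dual_cone C = {u. \<forall>m\<in>C. u \<bullet> m \<ge> 0}"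

definition pointed_cone :: "(real ^ 'n) set \<Rightarrow> bool" where
  "pointed_cone C \<longleftrightarrow> convex_cone C \<and> (\<forall>x. x \<in> C \<and> - x \<in> C \<longrightarrow> x = 0)"

definition rational_polyhedral_cone :: "(real ^ 'n) set \<Rightarrow> bool" where
  "rational_polyhedral_cone C \<longleftrightarrow> (\<exists>G. finite G \<and> C = convex_cone hull (real_vec ` G))"

text \<open>The library's \<open>face_of\<close> also admits the empty face, which has to be excluded.\<close>

definition rational_fan :: "(real ^ 'n) set set \<Rightarrow> bool" where
  "rational_fan \<Sigma> \<longleftrightarrow>
     finite \<Sigma> \<and>
     (\<forall>\<tau>\<in>\<Sigma>. rational_polyhedral_cone \<tau> \<and> pointed_cone \<tau>) \<and>
     (\<forall>\<tau>\<in>\<Sigma>. \<forall>F. F face_of \<tau> \<and> F \<noteq> {} \<longrightarrow> F \<in> \<Sigma>) \<and>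
     (\<forall>\<tau>\<in>\<Sigma>. \<forall>\<tau>'\<in>\<Sigma>. (\<tau> \<inter> \<tau>') face_of \<tau> \<and> (\<tau> \<inter> \<tau>') face_of \<tau>')"

definition primitive_vec :: "int ^ 'n \<Rightarrow> bool" where
  "primitive_vec u \<longleftrightarrow> Gcd (range (($) u)) = 1"

definition fan_rays :: "(real ^ 'n) set set \<Rightarrow> (real ^ 'n) set set" where
  "fan_rays \<Sigma> = {\<rho> \<in> \<Sigma>. dim \<rho> = 1}"

definition ray_generators :: "(real ^ 'n) set set \<Rightarrow> (int ^ 'n) set" where
  "ray_generators \<Sigma> = {u. primitive_vec u \<and> convex_cone hull {real_vec u} \<in> fan_rays \<Sigma>}"

text \<open>\<open>\<phi>\<close> extends to \<open>\<sigma>\<close> the values of \<open>f\<close> at the lattice points of the relative interior of \<open>\<sigma>\<close>.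
  By density of the rational points, \<open>\<phi>\<close> is uniquely determined on a rational polyhedral cone \<open>\<sigma>\<close>.\<close>

definition fan_linear_extension ::
  "(real ^ 'n) set \<Rightarrow> (real ^ 'n) set set \<Rightarrow> (int ^ 'n \<Rightarrow> ereal) \<Rightarrow> (real ^ 'n \<Rightarrow> real) \<Rightarrow> bool" where
  "fan_linear_extension \<sigma> \<Sigma> f \<phi> \<longleftrightarrow>
     (\<forall>u. real_vec u \<in> rel_interior \<sigma> \<longrightarrow> f u = ereal (\<phi> (real_vec u))) \<and>
     continuous_on \<sigma> \<phi> \<and>
     (\<forall>x\<in>\<sigma>. \<forall>t>0. \<phi> (t *\<^sub>R x) = t * \<phi> x) \<and>
     (\<forall>\<tau>\<in>\<Sigma>. \<exists>l. linear l \<and> (\<forall>x\<in>\<tau>. \<phi> x = l x))"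


section \<open>Localized affine semigroup rings\<close>

text \<open>\<open>k[S]\<close> as a subring of the ring of Laurent polynomials \<open>k[M]\<close>, whose elements are finitely
  supported functions on \<open>M\<close> multiplied by convolution; the monomial \<open>\<chi>\<^sup>m\<close> is
  \<open>Poly_Mapping.single m 1\<close>.\<close>

definition semigroup_ring :: "(int ^ 'n) set \<Rightarrow> ((int ^ 'n) \<Rightarrow>\<^sub>0 'k::field) ring" where
  "semigroup_ring S =
     \<lparr>carrier = {f. Poly_Mapping.keys f \<subseteq> S}, mult = (*), one = 1, zero = 0, add = (+)\<rparr>"

definition semigroup_max_ideal :: "(int ^ 'n) set \<Rightarrow> ((int ^ 'n) \<Rightarrow>\<^sub>0 'k::field) set" where
  "semigroup_max_ideal S =
     genideal (semigroup_ring S) ((\<lambda>m. Poly_Mapping.single m 1) ` (S - {0}))"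

type_synonym ('k, 'n) toric_elem = "(((int ^ 'n) \<Rightarrow>\<^sub>0 'k) \<times> ((int ^ 'n) \<Rightarrow>\<^sub>0 'k)) set"

definition toric_local_ring :: "(int ^ 'n) set \<Rightarrow> ('k::field, 'n) toric_elem ring" where
  "toric_local_ring S =
     localization (semigroup_ring S) (carrier (semigroup_ring S) - semigroup_max_ideal S)"

definition toric_monomial :: "(int ^ 'n) set \<Rightarrow> int ^ 'n \<Rightarrow> ('k::field, 'n) toric_elem" where
  "toric_monomial S m =
     loc_frac (semigroup_ring S) (carrier (semigroup_ring S) - semigroup_max_ideal S)
       (Poly_Mapping.single m 1) 1"

definition toric_max_ideal :: "(int ^ 'n) set \<Rightarrow> ('k::field, 'n) toric_elem set" where
  "toric_max_ideal S = genideal (toric_local_ring S) (toric_monomial S ` (S - {0}))"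

definition monomial_ideal :: "(int ^ 'n) set \<Rightarrow> ('k::field, 'n) toric_elem set \<Rightarrow> bool" where
  "monomial_ideal S I \<longleftrightarrow>
     (\<exists>E\<subseteq>S. I = genideal (toric_local_ring S) (toric_monomial S ` E))"

definition primary_monomial_ideal :: "(int ^ 'n) set \<Rightarrow> ('k::field, 'n) toric_elem set \<Rightarrow> bool" where
  "primary_monomial_ideal S I \<longleftrightarrow>
     monomial_ideal S I \<and> primary_ideal (toric_local_ring S) I \<and>
     radical_ideal (toric_local_ring S) I = toric_max_ideal S"


section \<open>Toric valuations\<close>

text \<open>On a Laurent polynomial; the infimum over the empty support of \<open>0\<close> is \<open>\<infinity>\<close>.\<close>

definition toric_val_poly :: "int ^ 'n \<Rightarrow> ((int ^ 'n) \<Rightarrow>\<^sub>0 'k::field) \<Rightarrow> ereal" where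
  "toric_val_poly u f = (INF m\<in>Poly_Mapping.keys f. ereal (real_of_int (lattice_pairing u m)))"

text \<open>On a fraction \<open>f / g\<close>; the value does not depend on the representative.\<close>

definition toric_val :: "int ^ 'n \<Rightarrow> ('k::field, 'n) toric_elem \<Rightarrow> ereal" where
  "toric_val u x = (case SOME fg. fg \<in> x of (f, g) \<Rightarrow> toric_val_poly u f - toric_val_poly u g)"

text \<open>The infimum is attained for \<open>u \<in> \<sigma> \<inter> N\<close>, where values are nonnegative integers or \<open>\<infinity>\<close>.\<close>

definition toric_val_ideal :: "int ^ 'n \<Rightarrow> ('k::field, 'n) toric_elem set \<Rightarrow> ereal" where
  "toric_val_ideal u I = (INF x\<in>I. toric_val u x)"

definition toric_val_filtration :: "int ^ 'n \<Rightarrow> (nat \<Rightarrow> ('k::field, 'n) toric_elem set) \<Rightarrow> ereal" where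
  "toric_val_filtration u a = lim (\<lambda>p. toric_val_ideal u (a p) / ereal (real p))"

end

theory Submission
  imports Defs
begin

text \<open>
  Monomial ideals of \<open>R\<close> correspond to subsets \<open>E\<close> of \<open>S\<close> with \<open>E + S \<subseteq> E\<close>, and \<open>\<chi>\<^sup>m\<close> is integral over the ideal of \<open>E\<close> if and
  only if a multiple \<open>k m\<close> with \<open>k \<ge> 1\<close> is a sum of \<open>k\<close> elements of \<open>E\<close>. Hence \<open>b\<^bsub>qt\<^esub> \<subseteq> closure a\<^bsub>pt\<^esub>\<close> for large \<open>t\<close> forces
  \<open>p v\<^sub>u(a) \<le> q v\<^sub>u(b)\<close> for all interior \<open>u\<close>.

  Conversely, as the Rees algebra is Noetherian, its exponents \<open>(p, m)\<close> form a finitely generated semigroup, and a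
  Veronese subalgebra of some degree \<open>N\<close> is generated in degree one. By Farkas' lemma, \<open>\<chi>\<^sup>m\<close> is integral over
  \<open>a\<^bsub>Nj\<^esub>\<close> as soon as \<open>N j v\<^sub>u(a) \<le> \<langle>u, m\<rangle>\<close> for all interior \<open>u\<close>. If \<open>q / p\<close> exceeds the supremum of the ratios
  \<open>v\<^sub>u(a) / v\<^sub>u(b)\<close>, there is, for \<open>t\<close> large, a multiple \<open>N j \<ge> p t\<close> for which this holds for all exponents \<open>m\<close> of \<open>b\<^bsub>qt\<^esub>\<close>.

  The supremum is a maximum over rays because both functions are linear on the cones of the fan, which are generated by
  their rays; on rays with \<open>v\<^sub>u(b) = 0\<close> the linear boundedness gives \<open>v\<^sub>u(a) = 0\<close>.
\<close>

section \<open>Farkas' lemma over the integers\<close>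

text \<open>Three obstacles shape the argument. The values are given only at lattice points in the
  interior of \<open>\<sigma>\<close>, while Farkas' lemma produces separating functionals that may
  lie on the boundary. Pointedness supplies a lattice functional \<open>u0\<close> that is positive
  on all nonzero elements of \<open>S\<close>; adding it to a large multiple of a boundary
  functional gives an interior one, and as pairings are integers, a strict inequality survives. The
  same \<open>u0\<close> gives lowest terms, through which denominators are cancelled without
  leaving an exponent set. The values are limits, and a bound on a limit alone gives no membership
  at a fixed level. Finite generation of the exponents of the Rees algebra makes the bound testable
  on finitely many vectors. Rounding a degree up to a multiple of \<open>N\<close> costs a bounded
  amount, which is absorbed by the gap between \<open>q / p\<close> and the supremum; hence the
  comparison with strict inequality there. Finally, integrality of monomials has to be added up to
  integrality of arbitrary elements, which needs a determinant trick over a ring that is only a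
  subset of a type.\<close>

lemma farkas_field:
  fixes A :: "'j \<Rightarrow> 'i::finite \<Rightarrow> 'a::linordered_field" and c :: "'i \<Rightarrow> 'a"
  assumes "finite J"
    and "\<And>x. (\<forall>j\<in>J. 0 \<le> (\<Sum>i\<in>UNIV. A j i * x i)) \<Longrightarrow> 0 \<le> (\<Sum>i\<in>UNIV. c i * x i)"
  shows "\<exists>l. (\<forall>j\<in>J. 0 \<le> l j) \<and> (\<forall>i. c i = (\<Sum>j\<in>J. l j * A j i))"
  using assms
proof (induction J arbitrary: A c rule: finite_induct)
  case empty
  have "c i = 0" for i
  proof -
    have "0 \<le> (\<Sum>i\<in>UNIV. c i * - c i)"
      by (rule empty) simp
    then have "(\<Sum>i\<in>UNIV. c i * c i) \<le> 0"
      by (simp add: sum_negf)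
    moreover have "c i * c i \<le> (\<Sum>i\<in>UNIV. c i * c i)"
      by (rule member_le_sum) auto
    ultimately show ?thesis
      using zero_le_square[of "c i"] by (metis mult_eq_0_iff order_antisym order_trans)
  qed
  then show ?case by simp
next
  case (insert k J)
  define ev where "ev f x = (\<Sum>i\<in>UNIV. f i * x i)" for f x :: "'i \<Rightarrow> 'a"
  have ev_comb: "ev (\<lambda>i. f i - t * g i) x = ev f x - t * ev g x"
    "ev f (\<lambda>i. x i - t * y i) = ev f x - t * ev f y" for f g x y t
    by (simp_all add: ev_def algebra_simps sum_subtractf sum_distrib_left)
  show ?case
  proof (cases "\<forall>x. (\<forall>j\<in>J. 0 \<le> ev (A j) x) \<longrightarrow> 0 \<le> ev c x")
    case True
    then obtain l where l: "\<forall>j\<in>J. 0 \<le> l j" "\<forall>i. c i = (\<Sum>j\<in>J. l j * A j i)"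
      using insert.IH[of A c] unfolding ev_def by blast
    have "(\<Sum>j\<in>J. (l(k := 0)) j * A j i) = (\<Sum>j\<in>J. l j * A j i)" for i
      using insert.hyps by (intro sum.cong) auto
    then show ?thesis
      using l insert.hyps by (intro exI[of _ "l(k := 0)"]) auto
  next
    case False
    then obtain z where z: "\<And>j. j \<in> J \<Longrightarrow> 0 \<le> ev (A j) z" "ev c z < 0"
      by force
    define s where "s = ev (A k) z"
    have "s < 0"
    proof (rule ccontr)
      assume "\<not> s < 0"
      then have "0 \<le> ev c z"
        using insert.prems[of z] z(1) by (auto simp: ev_def s_def)
      with z(2) show False by simp
    qed
    \<comment> \<open>Subtracting a multiple of \<open>A k\<close> makes these functionals vanish at
      \<open>z\<close>. Evaluating them at \<open>x\<close> amounts to evaluating \<open>A j\<close>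
      and \<open>c\<close> at the projection \<open>y\<close> of \<open>x\<close> along
      \<open>z\<close> onto the kernel of \<open>A k\<close>, where constraint \<open>k\<close>
      holds with equality.\<close>
    define A' where "A' j = (\<lambda>i. A j i - (ev (A j) z / s) * A k i)" for j
    define c' where "c' = (\<lambda>i. c i - (ev c z / s) * A k i)"
    have "0 \<le> ev c' x" if "\<forall>j\<in>J. 0 \<le> ev (A' j) x" for x
    proof -
      define y where "y = (\<lambda>i. x i - (ev (A k) x / s) * z i)"
      have "ev (A j) y = ev (A' j) x" for j
        unfolding y_def A'_def ev_comb by simp
      moreover have "ev (A k) y = 0"
        unfolding y_def ev_comb using \<open>s < 0\<close> by (simp flip: s_def)
      ultimately have "0 \<le> ev c y"
        using insert.prems[of y] that by (auto simp: ev_def)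
      also have "ev c y = ev c' x"
        unfolding y_def c'_def ev_comb by simp
      finally show ?thesis .
    qed
    then obtain l where l: "\<forall>j\<in>J. 0 \<le> l j" "\<forall>i. c' i = (\<Sum>j\<in>J. l j * A' j i)"
      using insert.IH[of A' c'] unfolding ev_def by blast
    \<comment> \<open>The coefficient of \<open>A k\<close> that remains when \<open>A'\<close> and
      \<open>c'\<close> are unfolded. It is nonnegative because \<open>ev c z\<close> and
      \<open>s\<close> are negative and each \<open>ev (A j) z\<close> is not.\<close>
    define t where "t = ev c z / s - (\<Sum>j\<in>J. l j * (ev (A j) z / s))"
    have "l j * (ev (A j) z / s) \<le> 0" if "j \<in> J" for j
      using that l(1) z(1) \<open>s < 0\<close> by (simp add: mult_le_0_iff divide_le_0_iff)
    then have "0 \<le> t"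
      using sum_nonpos[of J "\<lambda>j. l j * (ev (A j) z / s)"] divide_neg_neg[OF z(2) \<open>s < 0\<close>]
      by (simp add: t_def)
    have "c i = t * A k i + (\<Sum>j\<in>J. l j * A j i)" for i
    proof -
      have "c i = c' i + (ev c z / s) * A k i"
        by (simp add: c'_def)
      also have "c' i = (\<Sum>j\<in>J. l j * A' j i)"
        using l(2) by blast
      also have "\<dots> = (\<Sum>j\<in>J. l j * A j i) - (\<Sum>j\<in>J. l j * (ev (A j) z / s)) * A k i"
        by (simp add: A'_def algebra_simps sum_subtractf sum_distrib_left)
      finally show ?thesis
        by (simp add: t_def algebra_simps)
    qed
    moreover have "(\<Sum>j\<in>J. (l(k := t)) j * A j i) = (\<Sum>j\<in>J. l j * A j i)" for i
      using insert.hyps by (intro sum.cong) auto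
    ultimately show ?thesis
      using l insert.hyps \<open>0 \<le> t\<close> by (intro exI[of _ "l(k := t)"]) auto
  qed
qed

lemma common_denominator:
  fixes f :: "'i \<Rightarrow> rat"
  assumes "finite I"
  shows "\<exists>D z. 1 \<le> (D::int) \<and> (\<forall>i\<in>I. of_int D * f i = of_int (z i))"
  using assms
proof (induction I rule: finite_induct)
  case empty
  show ?case by (rule exI[of _ 1]) auto
next
  case (insert k I)
  then obtain D z where D: "1 \<le> D" "\<forall>i\<in>I. of_int D * f i = of_int (z i)"
    by blast
  obtain a b where ab: "quotient_of (f k) = (a, b)" by fastforce
  have b: "b > 0" "f k = of_int a / of_int b"
    using quotient_of_denom_pos[OF ab] quotient_of_div[OF ab] by auto
  have "1 \<le> D * b"
    using mult_pos_pos[of D b] D(1) b(1) by linarith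
  moreover have "of_int (D * b) * f i = of_int (if i = k then D * a else b * z i)" if "i \<in> insert k I" for i
    using that D(2) b by (auto simp: field_simps)
  ultimately show ?case
    by (intro exI[of _ "D * b"] exI[of _ "\<lambda>i. if i = k then D * a else b * z i"]) blast
qed

text \<open>Toric valuations can be tested only at integer vectors. Clearing denominators carries
  the hypothesis from integer to rational vectors, and afterwards turns the rational multipliers
  into natural numbers at the price of the factor \<open>L\<close>.\<close>

lemma farkas_int:
  fixes A :: "'j \<Rightarrow> 'i::finite \<Rightarrow> int" and c :: "'i \<Rightarrow> int"
  assumes "finite J"
    and "\<And>x. (\<forall>j\<in>J. 0 \<le> (\<Sum>i\<in>UNIV. A j i * x i)) \<Longrightarrow> 0 \<le> (\<Sum>i\<in>UNIV. c i * x i)"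
  obtains L :: nat and n :: "'j \<Rightarrow> nat"
  where "1 \<le> L" "\<And>i. int L * c i = (\<Sum>j\<in>J. int (n j) * A j i)"
proof -
  have "0 \<le> (\<Sum>i\<in>UNIV. of_int (c i) * x i)"
    if "\<forall>j\<in>J. 0 \<le> (\<Sum>i\<in>UNIV. of_int (A j i) * x i)" for x :: "'i \<Rightarrow> rat"
  proof -
    obtain D z where D: "1 \<le> D" "\<And>i. of_int D * x i = of_int (z i)"
      using common_denominator[of UNIV x] by auto
    have scale: "of_int (\<Sum>i\<in>UNIV. f i * z i) = of_int D * (\<Sum>i\<in>UNIV. of_int (f i) * x i)" for f
      by (simp add: sum_distrib_left D(2)[symmetric] mult.left_commute)
    have "0 \<le> (\<Sum>i\<in>UNIV. A j i * z i)" if "j \<in> J" for j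
    proof -
      have "0 \<le> (of_int (\<Sum>i\<in>UNIV. A j i * z i) :: rat)"
        unfolding scale using D(1) that \<open>\<forall>j\<in>J. _ j\<close> by simp
      then show ?thesis by (simp only: of_int_0_le_iff)
    qed
    then have "0 \<le> (\<Sum>i\<in>UNIV. c i * z i)"
      using assms(2) by blast
    then have "0 \<le> (of_int (\<Sum>i\<in>UNIV. c i * z i) :: rat)"
      by (simp only: of_int_0_le_iff)
    then show ?thesis
      unfolding scale using D(1) by (simp add: zero_le_mult_iff)
  qed
  then obtain l :: "'j \<Rightarrow> rat" where
    l: "\<forall>j\<in>J. 0 \<le> l j" "\<forall>i. of_int (c i) = (\<Sum>j\<in>J. l j * of_int (A j i))"
    using farkas_field[OF assms(1), of "\<lambda>j i. of_int (A j i)" "\<lambda>i. of_int (c i)"] by blast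
  obtain D z where D: "1 \<le> D" "\<forall>j\<in>J. of_int D * l j = of_int (z j)"
    using common_denominator[OF assms(1), of l] by auto
  have z: "0 \<le> z j" if "j \<in> J" for j
  proof -
    have "0 \<le> (of_int (z j) :: rat)"
      using D(1) l(1) that by (simp flip: D(2)[rule_format, OF that])
    then show ?thesis by simp
  qed
  show ?thesis
  proof
    show "1 \<le> nat D" using D(1) by simp
    show "int (nat D) * c i = (\<Sum>j\<in>J. int (nat (z j)) * A j i)" for i
    proof -
      have "(of_int (D * c i) :: rat) = (\<Sum>j\<in>J. of_int D * l j * of_int (A j i))"
        using l(2) by (simp add: sum_distrib_left mult.assoc)
      also have "\<dots> = (\<Sum>j\<in>J. of_int (z j) * of_int (A j i))"
        using D(2) by (intro sum.cong) auto
      also have "\<dots> = of_int (\<Sum>j\<in>J. z j * A j i)"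
        by simp
      finally have "D * c i = (\<Sum>j\<in>J. z j * A j i)"
        by (simp only: of_int_eq_iff)
      then show ?thesis
        using D(1) z by simp
    qed
  qed
qed

section \<open>Integrality over a subring\<close>

text \<open>The possible lower terms of a monic polynomial of degree \<open>d\<close> over
  \<open>G\<close>.\<close>

definition polys_below :: "'a::comm_ring_1 set \<Rightarrow> nat \<Rightarrow> 'a poly set" where
  "polys_below G d = {h. (\<forall>i. poly.coeff h i \<in> G) \<and> (\<forall>i\<ge>d. poly.coeff h i = 0)}"

definition integral_over :: "'a::comm_ring_1 set \<Rightarrow> 'a \<Rightarrow> bool" where
  "integral_over G x \<longleftrightarrow> (\<exists>d\<ge>1. \<exists>h\<in>polys_below G d. x ^ d + poly h x = 0)"

locale subring_of_comm_ring =
  fixes G :: "'a::comm_ring_1 set"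
  assumes zero_mem [simp]: "0 \<in> G" and one_mem [simp]: "1 \<in> G"
    and add_mem: "\<And>x y. x \<in> G \<Longrightarrow> y \<in> G \<Longrightarrow> x + y \<in> G"
    and uminus_mem: "\<And>x. x \<in> G \<Longrightarrow> - x \<in> G"
    and mult_mem: "\<And>x y. x \<in> G \<Longrightarrow> y \<in> G \<Longrightarrow> x * y \<in> G"
begin

lemma sum_mem: "(\<And>i. i \<in> I \<Longrightarrow> f i \<in> G) \<Longrightarrow> sum f I \<in> G"
  by (induction I rule: infinite_finite_induct) (auto intro: add_mem)

lemma diff_mem: "x \<in> G \<Longrightarrow> y \<in> G \<Longrightarrow> x - y \<in> G"
  using add_mem[of x "- y"] uminus_mem[of y] by simp

lemma polys_below_add: "f \<in> polys_below G d \<Longrightarrow> g \<in> polys_below G d \<Longrightarrow> f + g \<in> polys_below G d"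
  by (auto simp: polys_below_def intro: add_mem)

lemma polys_below_diff: "f \<in> polys_below G d \<Longrightarrow> g \<in> polys_below G d \<Longrightarrow> f - g \<in> polys_below G d"
  by (auto simp: polys_below_def intro: diff_mem)

lemma polys_below_mono: "f \<in> polys_below G d \<Longrightarrow> d \<le> e \<Longrightarrow> f \<in> polys_below G e"
  by (auto simp: polys_below_def)

lemma polys_below_mult:
  assumes "f \<in> polys_below G d" "g \<in> polys_below G e"
  shows "f * g \<in> polys_below G (d + e - 1)"
proof -
  have "poly.coeff f i * poly.coeff g (n - i) = 0" if "n \<ge> d + e - 1" "i \<le> n" for n i
  proof (cases "i \<ge> d")
    case False
    then have "n - i \<ge> e" using that by simp
    then show ?thesis using assms by (simp add: polys_below_def)
  qed (use assms in \<open>simp add: polys_below_def\<close>)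
  moreover have "(\<Sum>i\<le>n. poly.coeff f i * poly.coeff g (n - i)) \<in> G" for n
    using assms by (intro sum_mem mult_mem) (auto simp: polys_below_def)
  ultimately show ?thesis
    by (auto simp: polys_below_def coeff_mult)
qed

lemma polys_below_monom_mult:
  "f \<in> polys_below G d \<Longrightarrow> Polynomial.monom 1 e * f \<in> polys_below G (e + d)"
  by (auto simp: polys_below_def coeff_monom_mult)

text \<open>Gaussian elimination without division, replacing Cramer's rule in the determinant trick.\<close>

lemma monic_system_annihilator:
  assumes "finite I" "i0 \<notin> I" "1 \<le> d"
    and "\<And>i. i \<in> insert i0 I \<Longrightarrow> (\<Sum>j\<in>insert i0 I. poly (b i j) x * w j) = 0"
    and "\<And>i. i \<in> insert i0 I \<Longrightarrow> b i i - Polynomial.monom 1 d \<in> polys_below G d"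
    and "\<And>i j. i \<in> insert i0 I \<Longrightarrow> j \<in> insert i0 I \<Longrightarrow> i \<noteq> j \<Longrightarrow> b i j \<in> polys_below G d"
  shows "\<exists>e\<ge>1. \<exists>h\<in>polys_below G e. (x ^ e + poly h x) * w i0 = 0"
  using assms
proof (induction I arbitrary: d b rule: finite_induct)
  case empty
  have "(x ^ d + poly (b i0 i0 - Polynomial.monom 1 d) x) * w i0 = 0"
    using empty.prems(3)[of i0] by (simp add: poly_monom)
  moreover have "b i0 i0 - Polynomial.monom 1 d \<in> polys_below G d"
    by (rule empty.prems(4)) simp
  ultimately show ?case
    using empty.prems(2) by (intro exI[of _ d] conjI bexI)
next
  case (insert k I)
  \<comment> \<open>Cross-multiplication with the pivot row eliminates \<open>w k\<close>. The
    product \<open>b k k * b i i\<close> is monic of degree \<open>2 * d\<close> and all other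
    products have lower degree, so the system keeps its shape with \<open>2 * d\<close> in place of
    \<open>d\<close>.\<close>
  define b' where "b' i j = b k k * b i j - b i k * b k j" for i j
  have sum_eq: "(\<Sum>j\<in>insert i0 I. poly (b i j) x * w j) = - poly (b i k) x * w k"
    if "i \<in> insert i0 (insert k I)" for i
  proof -
    have "(\<Sum>j\<in>insert k (insert i0 I). poly (b i j) x * w j) = 0"
      using insert.prems(3)[OF that] by (simp only: insert_commute[of k i0 I])
    moreover have "k \<notin> insert i0 I" "finite (insert i0 I)"
      using insert.hyps insert.prems(1) by auto
    ultimately have "poly (b i k) x * w k + (\<Sum>j\<in>insert i0 I. poly (b i j) x * w j) = 0"
      by (simp only: sum.insert not_False_eq_True)
    then show ?thesis
      unfolding mult_minus_left by (rule minus_unique[symmetric])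
  qed
  show ?case
  proof (rule insert.IH[of "2 * d" b'])
    show "(\<Sum>j\<in>insert i0 I. poly (b' i j) x * w j) = 0" if "i \<in> insert i0 I" for i
    proof -
      have "(\<Sum>j\<in>insert i0 I. poly (b' i j) x * w j) =
          poly (b k k) x * (\<Sum>j\<in>insert i0 I. poly (b i j) x * w j)
          - poly (b i k) x * (\<Sum>j\<in>insert i0 I. poly (b k j) x * w j)"
        by (simp only: b'_def poly_diff poly_mult left_diff_distrib sum_subtractf sum_distrib_left mult.assoc)
      also have "\<dots> = 0"
      proof -
        have "i \<in> insert i0 (insert k I)" "k \<in> insert i0 (insert k I)"
          using that by auto
        then show ?thesis
          by (simp only: sum_eq) (simp add: mult.left_commute)
      qed
      finally show ?thesis .
    qed
    define X where "X = (Polynomial.monom 1 d :: 'a poly)"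
    have XX: "Polynomial.monom 1 (2 * d) = X * X"
      by (simp add: X_def mult_monom mult_2)
    define f where "f i = b i i - X" for i
    have f: "b i i = X + f i" "f i \<in> polys_below G d" if "i \<in> insert i0 (insert k I)" for i
      using insert.prems(4)[OF that] by (simp_all add: f_def X_def)
    have X: "X * h \<in> polys_below G (2 * d)" if "h \<in> polys_below G d" for h
      using polys_below_monom_mult[OF that, of d] by (simp add: X_def mult_2)
    have mult: "g * h \<in> polys_below G (2 * d)" if "g \<in> polys_below G d" "h \<in> polys_below G d" for g h
      by (rule polys_below_mono[OF polys_below_mult[OF that]]) simp
    show "b' i i - Polynomial.monom 1 (2 * d) \<in> polys_below G (2 * d)" if "i \<in> insert i0 I" for i
    proof -
      have ik: "i \<in> insert i0 (insert k I)" "k \<in> insert i0 (insert k I)" "k \<noteq> i"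
        using that insert.hyps insert.prems(1) by auto
      have "b' i i - Polynomial.monom 1 (2 * d) = X * f k + X * f i + f k * f i - b i k * b k i"
        unfolding XX b'_def f(1)[OF ik(1)] f(1)[OF ik(2)] by (simp add: algebra_simps)
      also have "\<dots> \<in> polys_below G (2 * d)"
        using ik by (intro polys_below_diff polys_below_add X mult f(2) insert.prems(5)) auto
      finally show ?thesis .
    qed
    show "b' i j \<in> polys_below G (2 * d)" if "i \<in> insert i0 I" "j \<in> insert i0 I" "i \<noteq> j" for i j
    proof -
      have ik: "k \<in> insert i0 (insert k I)" "k \<noteq> i" "k \<noteq> j"
        using that insert.hyps insert.prems(1) by auto
      have "b' i j = X * b i j + f k * b i j - b i k * b k j"
        unfolding b'_def f(1)[OF ik(1)] by (simp add: algebra_simps)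
      also have "\<dots> \<in> polys_below G (2 * d)"
        using ik that by (intro polys_below_diff polys_below_add X mult f(2) insert.prems(5)) auto
      finally show ?thesis .
    qed
  qed (use insert.prems(1,2) in auto)
qed

text \<open>A row of the companion matrix: the integral equation enters only for the top power
  \<open>x ^ d\<close>.\<close>

lemma integral_over_power_step:
  assumes "h \<in> polys_below G d" "x ^ d + poly h x = 0" "i < d"
  shows "\<exists>c. (\<forall>j. c j \<in> G) \<and> x ^ Suc i = (\<Sum>j<d. c j * x ^ j)"
proof (cases "Suc i = d")
  case True
  have "degree h < d"
  proof (cases "h = 0")
    case False
    show ?thesis
    proof (rule ccontr)
      assume "\<not> degree h < d"
      then have "poly.coeff h (degree h) = 0"
        using assms(1) by (simp add: polys_below_def)
      with False show False by simp
    qed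
  qed (use assms(3) in simp)
  then have "poly h x = (\<Sum>j<d. poly.coeff h j * x ^ j)"
    unfolding poly_altdef by (intro sum.mono_neutral_left) (auto simp: coeff_eq_0)
  moreover have "x ^ d = - poly h x"
    using assms(2) by (simp only: eq_neg_iff_add_eq_0)
  ultimately have "x ^ Suc i = (\<Sum>j<d. - poly.coeff h j * x ^ j)"
    unfolding True by (simp only: mult_minus_left sum_negf)
  moreover have "\<forall>j. - poly.coeff h j \<in> G"
    using assms(1) by (auto simp: polys_below_def intro: uminus_mem)
  ultimately show ?thesis
    by (intro exI[of _ "\<lambda>j. - poly.coeff h j"] conjI)
next
  case False
  have "(\<Sum>j<d. (if j = Suc i then 1 else 0) * x ^ j) = (\<Sum>j<d. if j = Suc i then x ^ j else 0)"
    by (intro sum.cong) auto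
  also have "\<dots> = x ^ Suc i"
    using False assms(3) by simp
  finally have "x ^ Suc i = (\<Sum>j<d. (if j = Suc i then 1 else 0) * x ^ j)" ..
  moreover have "\<forall>j. (if j = Suc i then 1 else 0) \<in> G" by simp
  ultimately show ?thesis
    by (intro exI[of _ "\<lambda>j. if j = Suc i then 1 else 0"] conjI)
qed

text \<open>The products \<open>x ^ i * y ^ j\<close> with small exponents span a module over
  \<open>G\<close> that is stable under multiplication by \<open>x + y\<close>. The entry
  \<open>w (0, 0)\<close> is \<open>1\<close>, so a monic polynomial value in \<open>x + y\<close>
  that annihilates it is an integral equation.\<close>

lemma integral_over_add:
  assumes "integral_over G x" "integral_over G y"
  shows "integral_over G (x + y)"
proof -
  obtain m f where f: "1 \<le> m" "f \<in> polys_below G m" "x ^ m + poly f x = 0"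
    using assms(1) by (auto simp: integral_over_def)
  obtain n g where g: "1 \<le> n" "g \<in> polys_below G n" "y ^ n + poly g y = 0"
    using assms(2) by (auto simp: integral_over_def)
  have "\<forall>i. \<exists>c. i < m \<longrightarrow> (\<forall>j. c j \<in> G) \<and> x ^ Suc i = (\<Sum>j<m. c j * x ^ j)"
    using integral_over_power_step[OF f(2,3)] by blast
  then obtain \<alpha> where \<alpha>: "\<And>i j. i < m \<Longrightarrow> \<alpha> i j \<in> G"
      "\<And>i. i < m \<Longrightarrow> x ^ Suc i = (\<Sum>j<m. \<alpha> i j * x ^ j)"
    by metis
  have "\<forall>i. \<exists>c. i < n \<longrightarrow> (\<forall>j. c j \<in> G) \<and> y ^ Suc i = (\<Sum>j<n. c j * y ^ j)"
    using integral_over_power_step[OF g(2,3)] by blast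
  then obtain \<beta> where \<beta>: "\<And>i j. i < n \<Longrightarrow> \<beta> i j \<in> G"
      "\<And>i. i < n \<Longrightarrow> y ^ Suc i = (\<Sum>j<n. \<beta> i j * y ^ j)"
    by metis
  define I where "I = {..<m} \<times> {..<n}"
  define w where "w e = x ^ fst e * y ^ snd e" for e :: "nat \<times> nat"
  define a where "a e e' = (if snd e = snd e' then \<alpha> (fst e) (fst e') else 0) +
    (if fst e = fst e' then \<beta> (snd e) (snd e') else 0)" for e e'
  \<comment> \<open>The matrix \<open>X - a\<close> of linear polynomials. At \<open>x + y\<close>
    it annihilates the vector \<open>w\<close>, since \<open>a\<close> describes multiplication by
    \<open>x + y\<close> on the entries of \<open>w\<close>.\<close>
  define b where "b e e' = [:- a e e', if e = e' then 1 else 0:]" for e e'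
  have w_step: "(x + y) * w e = (\<Sum>e'\<in>I. a e e' * w e')" if "e \<in> I" for e
  proof -
    obtain i j where e: "e = (i, j)" "i < m" "j < n"
      using \<open>e \<in> I\<close> unfolding I_def by blast
    have "(\<Sum>e'\<in>I. a e e' * w e') = (\<Sum>i'<m. \<Sum>j'<n. a e (i', j') * w (i', j'))"
      unfolding I_def by (simp only: sum.cartesian_product case_prod_unfold prod.collapse)
    also have "\<dots> = (\<Sum>i'<m. \<Sum>j'<n. (if j = j' then \<alpha> i i' * (x ^ i' * y ^ j') else 0) +
           (if i = i' then \<beta> j j' * (x ^ i' * y ^ j') else 0))"
      by (intro sum.cong refl) (simp add: e(1) a_def w_def algebra_simps)
    also have "\<dots> = (\<Sum>i'<m. \<alpha> i i' * (x ^ i' * y ^ j)) + (\<Sum>j'<n. \<beta> j j' * (x ^ i * y ^ j'))"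
    proof -
      have "(\<Sum>i'<m. \<Sum>j'<n. if i = i' then \<beta> j j' * (x ^ i' * y ^ j') else 0) =
          (\<Sum>j'<n. \<Sum>i'<m. if i = i' then \<beta> j j' * (x ^ i' * y ^ j') else 0)"
        by (rule sum.swap)
      also have "\<dots> = (\<Sum>j'<n. \<beta> j j' * (x ^ i * y ^ j'))"
        using e(2) by (simp add: sum.delta)
      finally show ?thesis
        using e(3) by (simp add: sum.distrib sum.delta)
    qed
    also have "\<dots> = x ^ Suc i * y ^ j + x ^ i * y ^ Suc j"
      unfolding \<alpha>(2)[OF e(2)] \<beta>(2)[OF e(3)] sum_distrib_left sum_distrib_right
      by (simp only: mult_ac)
    also have "\<dots> = (x + y) * w e"
      by (simp add: e(1) w_def algebra_simps)
    finally show ?thesis ..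
  qed
  have I: "insert (0, 0) (I - {(0, 0)}) = I"
    using f(1) g(1) by (auto simp: I_def)
  have a_mem: "- a e e' \<in> G" if "e \<in> I" for e e'
    using that unfolding a_def I_def by (intro uminus_mem add_mem) (auto intro: \<alpha>(1) \<beta>(1))
  have "\<exists>e\<ge>1. \<exists>h\<in>polys_below G e. ((x + y) ^ e + poly h (x + y)) * w (0, 0) = 0"
  proof (rule monic_system_annihilator[of "I - {(0, 0)}" _ 1 b], unfold I)
    show "(\<Sum>e'\<in>I. poly (b e e') (x + y) * w e') = 0" if "e \<in> I" for e
    proof -
      have "(\<Sum>e'\<in>I. poly (b e e') (x + y) * w e') =
          (\<Sum>e'\<in>I. (if e = e' then (x + y) * w e' else 0) - a e e' * w e')"
        by (intro sum.cong refl) (simp add: b_def algebra_simps)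
      also have "\<dots> = (\<Sum>e'\<in>I. if e = e' then (x + y) * w e' else 0) - (x + y) * w e"
        by (simp only: sum_subtractf w_step[OF that])
      also have "(\<Sum>e'\<in>I. if e = e' then (x + y) * w e' else 0) = (x + y) * w e"
        using that by (subst sum.delta') (simp_all add: I_def)
      finally show ?thesis by simp
    qed
    show "b e e - Polynomial.monom 1 1 \<in> polys_below G 1" if "e \<in> I" for e
      using a_mem[OF that] by (auto simp: b_def polys_below_def coeff_pCons split: nat.splits)
    show "b e e' \<in> polys_below G 1" if "e \<in> I" "e' \<in> I" "e \<noteq> e'" for e e'
      using a_mem[OF that(1)] that(3)
      by (auto simp: b_def polys_below_def coeff_pCons split: nat.splits)
  qed (auto simp: I_def)
  then show ?thesis
    by (simp add: w_def integral_over_def)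
qed

lemma integral_over_zero: "integral_over G 0"
  unfolding integral_over_def polys_below_def by (intro exI[of _ 1] conjI bexI[of _ 0]) auto

lemma integral_over_sum:
  "(\<And>i. i \<in> I \<Longrightarrow> integral_over G (f i)) \<Longrightarrow> integral_over G (sum f I)"
  by (induction I rule: infinite_finite_induct) (auto intro: integral_over_add integral_over_zero)

end

section \<open>Subadditive sequences\<close>

text \<open>Fekete's lemma, shortened by monotonicity: rounding \<open>n\<close> up to a multiple of
  \<open>P\<close> costs a single additional \<open>x P\<close>, so no remainders have to be
  estimated.\<close>

lemma increasing_subadditive_tendsto:
  fixes x :: "nat \<Rightarrow> real"
  assumes nonneg: "\<And>n. 1 \<le> n \<Longrightarrow> 0 \<le> x n"
    and sub: "\<And>m n. 1 \<le> m \<Longrightarrow> 1 \<le> n \<Longrightarrow> x (m + n) \<le> x m + x n"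
    and inc: "\<And>m n. 1 \<le> m \<Longrightarrow> m \<le> n \<Longrightarrow> x m \<le> x n"
  obtains l where "(\<lambda>n. x n / n) \<longlonglongrightarrow> l" "\<And>n. 1 \<le> n \<Longrightarrow> l \<le> x n / n"
proof -
  define I where "I = Inf ((\<lambda>n. x n / n) ` {1..})"
  have bdd: "bdd_below ((\<lambda>n. x n / n) ` {1..})"
    using nonneg by (intro bdd_belowI[of _ 0]) auto
  have I_le: "I \<le> x n / n" if "1 \<le> n" for n
    unfolding I_def using bdd that by (intro cINF_lower) auto
  have multiple: "x (k * P) \<le> k * x P" if "1 \<le> P" "1 \<le> k" for k P
    using that(2)
  proof (induction k rule: dec_induct)
    case base
    then show ?case by simp
  next
    case (step k)
    have "x (Suc k * P) \<le> x P + x (k * P)"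
      using sub[of P "k * P"] that step.hyps by simp
    then show ?case
      using step.IH by (simp add: algebra_simps)
  qed
  have upper: "x n / n \<le> x P / P + x P / n" if "1 \<le> P" "1 \<le> n" for n P
  proof -
    have "n \<le> (n div P + 1) * P"
      using that dividend_less_div_times[of P n] by simp
    then have "x n \<le> x ((n div P + 1) * P)"
      using inc that by blast
    also have "\<dots> \<le> real (n div P + 1) * x P"
      using multiple[of P "n div P + 1"] that by simp
    also have "\<dots> \<le> (real n / P + 1) * x P"
    proof (rule mult_right_mono)
      have "real (n div P) * P \<le> n"
        by (simp flip: of_nat_mult)
      then show "real (n div P + 1) \<le> real n / P + 1"
        using that by (simp add: le_divide_eq)
    qed (use nonneg that in auto)
    finally have "x n / n \<le> (real n / P + 1) * x P / n"
      by (simp add: divide_right_mono)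
    also have "\<dots> = x P / P + x P / n"
      using that by (simp add: field_simps)
    finally show ?thesis .
  qed
  have "(\<lambda>n. x n / n) \<longlonglongrightarrow> I"
  proof (rule LIMSEQ_I)
    fix e :: real assume "0 < e"
    then have "\<exists>y\<in>(\<lambda>n. x n / n) ` {1..}. y < I + e / 2"
      unfolding I_def by (intro cInf_lessD) auto
    then obtain P where P: "1 \<le> P" "x P / P < I + e / 2" by auto
    have "(\<lambda>n. x P / real n) \<longlonglongrightarrow> 0"
      by (rule lim_const_over_n)
    then obtain N where N: "\<And>n. n \<ge> N \<Longrightarrow> \<bar>x P / real n\<bar> < e / 2"
      using LIMSEQ_D[of _ 0 "e/2"] \<open>0 < e\<close> by fastforce
    have "norm (x n / n - I) < e" if "n \<ge> max 1 N" for n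
    proof -
      have "\<bar>x P / n\<bar> < e / 2" "x n / n \<le> x P / P + x P / n" "I \<le> x n / n"
        using N[of n] upper[OF P(1), of n] I_le[of n] that by auto
      then show ?thesis
        using P(2) by (simp only: real_norm_def)
    qed
    then show "\<exists>no. \<forall>n\<ge>no. norm (x n / n - I) < e" by blast
  qed
  with I_le show ?thesis by (rule that[rotated])
qed

section \<open>Exponent sets\<close>

lemma lookup_mult_group:
  fixes f g :: "'a::ab_group_add \<Rightarrow>\<^sub>0 'b::semiring_0"
  shows "Poly_Mapping.lookup (f * g) k = (\<Sum>l\<in>Poly_Mapping.keys f. Poly_Mapping.lookup f l * Poly_Mapping.lookup g (k - l))"
proof -
  have "Sum_any (\<lambda>q. Poly_Mapping.lookup g q when k = l + q) = Poly_Mapping.lookup g (k - l)" for l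
  proof -
    have "Sum_any (\<lambda>q. Poly_Mapping.lookup g q when k = l + q) = Sum_any (\<lambda>q. Poly_Mapping.lookup g q when q = k - l)"
      by (intro arg_cong[of _ _ Sum_any] ext) (auto simp: when_def algebra_simps)
    then show ?thesis by simp
  qed
  then have "Poly_Mapping.lookup (f * g) k = Sum_any (\<lambda>l. Poly_Mapping.lookup f l * Poly_Mapping.lookup g (k - l))"
    by (simp add: lookup_mult)
  also have "\<dots> = (\<Sum>l\<in>Poly_Mapping.keys f. Poly_Mapping.lookup f l * Poly_Mapping.lookup g (k - l))"
    by (rule Sum_any.expand_superset) (auto simp: in_keys_iff)
  finally show ?thesis .
qed

lemma poly_mapping_eq_sum_single:
  "f = (\<Sum>m\<in>Poly_Mapping.keys f. Poly_Mapping.single m (Poly_Mapping.lookup f m))"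
proof (rule poly_mapping_eqI)
  fix k
  have "Poly_Mapping.lookup (\<Sum>m\<in>Poly_Mapping.keys f. Poly_Mapping.single m (Poly_Mapping.lookup f m)) k =
      (\<Sum>m\<in>Poly_Mapping.keys f. if m = k then Poly_Mapping.lookup f m else 0)"
    by (simp add: lookup_sum lookup_single when_def)
  also have "\<dots> = Poly_Mapping.lookup f k"
    by (simp add: in_keys_iff)
  finally show "Poly_Mapping.lookup f k = Poly_Mapping.lookup (\<Sum>m\<in>Poly_Mapping.keys f. Poly_Mapping.single m (Poly_Mapping.lookup f m)) k" ..
qed

lemma lattice_pairing_add: "lattice_pairing u (x + y) = lattice_pairing u x + lattice_pairing u y"
  by (simp add: lattice_pairing_def algebra_simps sum.distrib)

lemma lattice_pairing_diff: "lattice_pairing u (x - y) = lattice_pairing u x - lattice_pairing u y"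
  by (simp add: lattice_pairing_def algebra_simps sum_subtractf)

lemma lattice_pairing_smult: "lattice_pairing u (c *s x) = c * lattice_pairing u x"
  by (simp add: lattice_pairing_def sum_distrib_left mult.left_commute)

lemma lattice_pairing_zero [simp]: "lattice_pairing u 0 = 0"
  by (simp add: lattice_pairing_def)

lemma smult_Suc_vec: "int (Suc n) *s (x :: int ^ 'n) = int n *s x + x"
  by (simp add: vec_eq_iff algebra_simps)

lemma smult_add_vec: "int (m + n) *s (x :: int ^ 'n) = int m *s x + int n *s x"
  by (simp add: vec_eq_iff algebra_simps)

lemma (in ring) ideal_criterion:
  assumes sub: "I \<subseteq> carrier R" and zero: "\<zero> \<in> I"
    and add: "\<And>x y. x \<in> I \<Longrightarrow> y \<in> I \<Longrightarrow> x \<oplus> y \<in> I"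
    and l: "\<And>a x. a \<in> I \<Longrightarrow> x \<in> carrier R \<Longrightarrow> x \<otimes> a \<in> I"
    and r: "\<And>a x. a \<in> I \<Longrightarrow> x \<in> carrier R \<Longrightarrow> a \<otimes> x \<in> I"
  shows "ideal I R"
proof (rule idealI)
  show "subgroup I (add_monoid R)"
  proof (rule subgroup.intro)
    fix x assume "x \<in> I"
    then have "\<ominus> \<one> \<otimes> x \<in> I" "x \<in> carrier R"
      using l sub by auto
    then have "\<ominus> x \<in> I" by (simp add: l_minus)
    then show "inv\<^bsub>add_monoid R\<^esub> x \<in> I" by (simp add: a_inv_def)
  qed (use sub zero add in auto)
qed (use l r ring_axioms in auto)

text \<open>\<open>u0\<close> grades \<open>k[S]\<close> by nonnegative degrees with only the
  constants in degree \<open>0\<close>. This makes terms of lowest degree available, and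
  \<open>u0\<close> later serves to push lattice functionals into the interior of the dual
  cone.\<close>

locale pointed_semigroup =
  fixes S :: "(int ^ 'n) set" and u0 :: "int ^ 'n"
  assumes zero_mem: "0 \<in> S"
    and add_mem: "\<And>x y. x \<in> S \<Longrightarrow> y \<in> S \<Longrightarrow> x + y \<in> S"
    and pairing_pos: "\<And>s. s \<in> S \<Longrightarrow> s \<noteq> 0 \<Longrightarrow> 0 < lattice_pairing u0 s"
begin

definition upset :: "(int ^ 'n) set \<Rightarrow> bool" where
  "upset E \<longleftrightarrow> E \<subseteq> S \<and> (\<forall>e\<in>E. \<forall>s\<in>S. e + s \<in> E)"

text \<open>If \<open>E\<close> is the exponent set of a monomial ideal, then \<open>sumpow E k\<close> is the one of its \<open>k\<close>-th power; hence the
  value \<open>S\<close> for \<open>k = 0\<close>.\<close>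

primrec sumpow :: "(int ^ 'n) set \<Rightarrow> nat \<Rightarrow> (int ^ 'n) set" where
  "sumpow E 0 = S"
| "sumpow E (Suc k) = {x + y | x y. x \<in> sumpow E k \<and> y \<in> E}"

lemma smult_mem: "x \<in> S \<Longrightarrow> int n *s x \<in> S"
proof (induction n)
  case (Suc n)
  then show ?case
    unfolding smult_Suc_vec by (intro add_mem)
qed (auto simp: zero_mem)

lemma upset_S: "upset S"
  by (simp add: upset_def add_mem)

lemma upset_empty: "upset {}"
  by (simp add: upset_def)

lemma upset_setsum:
  assumes "upset E" "upset F"
  shows "upset {x + y | x y. x \<in> E \<and> y \<in> F}"
  using assms unfolding upset_def by (fastforce intro: add_mem simp: add.assoc)

lemma upset_sumpow: "upset E \<Longrightarrow> upset (sumpow E k)"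
  by (induction k) (auto simp: upset_S intro: upset_setsum)

lemma sumpow_subset_S: "upset E \<Longrightarrow> x \<in> sumpow E k \<Longrightarrow> x \<in> S"
  using upset_sumpow[of E k] by (auto simp: upset_def)

lemma sumpow_1: "upset E \<Longrightarrow> sumpow E 1 = E"
proof -
  assume E: "upset E"
  have "x + y \<in> E" if "x \<in> S" "y \<in> E" for x y
    using E that unfolding upset_def by (metis add.commute)
  moreover have "\<exists>x y. e = x + y \<and> x \<in> S \<and> y \<in> E" if "e \<in> E" for e
    using that zero_mem by (intro exI[of _ 0] exI[of _ e]) simp
  ultimately show ?thesis by auto
qed

lemma sumpow_add:
  assumes "upset E" "x \<in> sumpow E j" "y \<in> sumpow E k"
  shows "x + y \<in> sumpow E (j + k)"
  using assms(3)
proof (induction k arbitrary: y)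
  case 0
  then show ?case
    using upset_sumpow[OF assms(1), of j] assms(2) by (auto simp: upset_def)
next
  case (Suc k)
  then obtain v e where "y = v + e" "v \<in> sumpow E k" "e \<in> E" by auto
  with Suc.IH[of v] show ?case
    by (auto simp flip: add.assoc)
qed

lemma sumpow_split:
  assumes "x \<in> sumpow E (j + k)"
  obtains y z where "x = y + z" "y \<in> sumpow E j" "z \<in> sumpow E k"
  using assms
proof (induction k arbitrary: x thesis)
  case 0
  then show ?case using zero_mem by (metis add.right_neutral sumpow.simps(1))
next
  case (Suc k)
  then obtain v e where v: "x = v + e" "v \<in> sumpow E (j + k)" "e \<in> E" by auto
  obtain y z where "v = y + z" "y \<in> sumpow E j" "z \<in> sumpow E k"
    using Suc.IH v(2) by blast
  with v show ?case
    using Suc.prems(1)[of y "z + e"] by (auto simp: add.assoc)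
qed

lemma sumpow_sumpow: "x \<in> sumpow E (j * k) \<Longrightarrow> x \<in> sumpow (sumpow E j) k"
proof (induction k arbitrary: x)
  case (Suc k)
  then have "x \<in> sumpow E (j * k + j)" by (simp add: add.commute)
  then obtain y z where "x = y + z" "y \<in> sumpow E (j * k)" "z \<in> sumpow E j"
    by (rule sumpow_split)
  with Suc.IH show ?case by auto
qed simp

lemma sumpow_mono: "E \<subseteq> F \<Longrightarrow> sumpow E k \<subseteq> sumpow F k"
  by (induction k) auto

lemma smult_mem_sumpow: "e \<in> E \<Longrightarrow> int n *s e \<in> sumpow E n"
proof (induction n)
  case (Suc n)
  then show ?case
    unfolding smult_Suc_vec by auto
qed (simp add: zero_mem)

lemma smult_sumpow: "upset E \<Longrightarrow> x \<in> sumpow E p \<Longrightarrow> int n *s x \<in> sumpow E (n * p)"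
proof (induction n)
  case (Suc n)
  then show ?case
    unfolding smult_Suc_vec using sumpow_add[of E "int n *s x" "n * p" x p] by (simp add: add.commute)
qed (simp add: zero_mem)

lemma sum_mem_sumpow:
  assumes "upset E" "finite I" "\<And>i. i \<in> I \<Longrightarrow> f i \<in> sumpow E (k i)"
  shows "(\<Sum>i\<in>I. f i) \<in> sumpow E (\<Sum>i\<in>I. k i)"
  using assms(2,3)
proof (induction I rule: finite_induct)
  case (insert i I)
  then show ?case
    using sumpow_add[OF assms(1), of "f i" "k i"] by simp
qed (simp add: zero_mem)

lemma pairing_sumpow_ge:
  assumes "\<And>s. s \<in> S \<Longrightarrow> 0 \<le> lattice_pairing u s"
    and "\<And>e. e \<in> E \<Longrightarrow> c \<le> real_of_int (lattice_pairing u e)" "x \<in> sumpow E k"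
  shows "real k * c \<le> real_of_int (lattice_pairing u x)"
  using assms(3)
proof (induction k arbitrary: x)
  case 0
  then show ?case using assms(1) by simp
next
  case (Suc k)
  then obtain v e where "x = v + e" "v \<in> sumpow E k" "e \<in> E" by auto
  with Suc.IH[of v] assms(2)[of e] show ?case
    by (simp add: lattice_pairing_add algebra_simps)
qed

text \<open>Since \<open>w\<close> has a nonzero constant term, the terms of \<open>f\<close> outside \<open>E\<close> that are lowest with respect to \<open>u0\<close>
  survive in \<open>w * f\<close>.\<close>

lemma keys_subset_upset_cancel:
  fixes w f :: "(int ^ 'n) \<Rightarrow>\<^sub>0 'k::field"
  assumes "Poly_Mapping.keys w \<subseteq> S" "Poly_Mapping.lookup w 0 \<noteq> 0" "upset E" "Poly_Mapping.keys (w * f) \<subseteq> E"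
  shows "Poly_Mapping.keys f \<subseteq> E"
proof (rule ccontr)
  assume "\<not> Poly_Mapping.keys f \<subseteq> E"
  then have "Poly_Mapping.keys f - E \<noteq> {}" by blast
  then obtain m where m: "m \<in> Poly_Mapping.keys f - E"
    and min: "\<And>m'. m' \<in> Poly_Mapping.keys f - E \<Longrightarrow> lattice_pairing u0 m \<le> lattice_pairing u0 m'"
    using arg_min_if_finite(1)[of "Poly_Mapping.keys f - E" "lattice_pairing u0"]
      arg_min_least[of "Poly_Mapping.keys f - E" _ "lattice_pairing u0"] by (metis finite_Diff finite_keys)
  have "Poly_Mapping.lookup f (m - l) = 0" if "l \<in> Poly_Mapping.keys w - {0}" for l
  proof (rule ccontr)
    assume "Poly_Mapping.lookup f (m - l) \<noteq> 0"
    then have key: "m - l \<in> Poly_Mapping.keys f" by (simp add: in_keys_iff)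
    have l: "l \<in> S" "l \<noteq> 0" using that assms(1) by auto
    show False
    proof (cases "m - l \<in> E")
      case True
      then have "m - l + l \<in> E" using assms(3) l(1) unfolding upset_def by blast
      then show False using m by simp
    next
      case False
      then show False
        using min[of "m - l"] key pairing_pos[OF l] by (simp add: lattice_pairing_diff)
    qed
  qed
  then have "(\<Sum>l\<in>Poly_Mapping.keys w - {0}. Poly_Mapping.lookup w l * Poly_Mapping.lookup f (m - l)) = 0"
    by (intro sum.neutral) auto
  then have "Poly_Mapping.lookup (w * f) m = Poly_Mapping.lookup w 0 * Poly_Mapping.lookup f m"
    unfolding lookup_mult_group using assms(2)
    by (subst sum.remove[of _ 0]) (auto simp: in_keys_iff)
  then have "m \<in> Poly_Mapping.keys (w * f)"
    using m assms(2) by (auto simp: in_keys_iff)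
  with m assms(4) show False by blast
qed

text \<open>Two nonconstant terms never multiply to a constant, since \<open>l\<close> and
  \<open>- l\<close> cannot both pair positively with \<open>u0\<close>. Hence elements with nonzero
  constant term are closed under products.\<close>

lemma lookup_mult_zero:
  fixes f g :: "(int ^ 'n) \<Rightarrow>\<^sub>0 'k::field"
  assumes "Poly_Mapping.keys f \<subseteq> S" "Poly_Mapping.keys g \<subseteq> S"
  shows "Poly_Mapping.lookup (f * g) 0 = Poly_Mapping.lookup f 0 * Poly_Mapping.lookup g 0"
proof -
  have "Poly_Mapping.lookup f l * Poly_Mapping.lookup g (0 - l) = 0" if "l \<in> Poly_Mapping.keys f - {0}" for l
  proof (rule ccontr)
    assume "Poly_Mapping.lookup f l * Poly_Mapping.lookup g (0 - l) \<noteq> 0"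
    then have "- l \<in> Poly_Mapping.keys g" by (auto simp: in_keys_iff)
    then have "0 < lattice_pairing u0 l" "0 < lattice_pairing u0 (- l)"
      using that assms pairing_pos[of l] pairing_pos[of "- l"] by auto
    then show False
      using lattice_pairing_add[of u0 l "- l"] by simp
  qed
  then have "(\<Sum>l\<in>Poly_Mapping.keys f - {0}. Poly_Mapping.lookup f l * Poly_Mapping.lookup g (0 - l)) = 0"
    by (intro sum.neutral) auto
  then show ?thesis
    unfolding lookup_mult_group
    by (cases "0 \<in> Poly_Mapping.keys f") (auto simp: sum.remove[of _ 0] in_keys_iff)
qed

lemma keys_mult_subset:
  assumes "Poly_Mapping.keys f \<subseteq> E" "Poly_Mapping.keys g \<subseteq> F"
  shows "Poly_Mapping.keys (f * g) \<subseteq> {x + y | x y. x \<in> E \<and> y \<in> F}"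
  using assms keys_mult[of f g] by blast

lemma keys_mult_S: "Poly_Mapping.keys f \<subseteq> S \<Longrightarrow> Poly_Mapping.keys g \<subseteq> S \<Longrightarrow> Poly_Mapping.keys (f * g) \<subseteq> S"
  using keys_mult[of f g] add_mem by blast

lemma keys_mult_upset:
  "upset E \<Longrightarrow> Poly_Mapping.keys f \<subseteq> S \<Longrightarrow> Poly_Mapping.keys g \<subseteq> E \<Longrightarrow> Poly_Mapping.keys (f * g) \<subseteq> E"
  using keys_mult[of f g] unfolding upset_def by (smt (verit) add.commute mem_Collect_eq subset_iff)

lemma keys_mult_upset2:
  "upset E \<Longrightarrow> Poly_Mapping.keys f \<subseteq> E \<Longrightarrow> Poly_Mapping.keys g \<subseteq> S \<Longrightarrow>
     Poly_Mapping.keys (f * g :: (int ^ 'n) \<Rightarrow>\<^sub>0 'k::field) \<subseteq> E"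
  using keys_mult_upset[of E g f] by (simp add: mult.commute)

lemma keys_add_subset: "Poly_Mapping.keys f \<subseteq> E \<Longrightarrow> Poly_Mapping.keys g \<subseteq> E \<Longrightarrow> Poly_Mapping.keys (f + g) \<subseteq> E"
  using keys_add[of f g] by blast

section \<open>The semigroup ring and the complement of its maximal monomial ideal\<close>

definition denominators :: "((int ^ 'n) \<Rightarrow>\<^sub>0 'k::field) set" where
  "denominators = {f. Poly_Mapping.keys f \<subseteq> S \<and> Poly_Mapping.lookup f 0 \<noteq> 0}"

lemma semigroup_ring_simps:
  "carrier (semigroup_ring S) = {f. Poly_Mapping.keys f \<subseteq> S}"
  "f \<otimes>\<^bsub>semigroup_ring S\<^esub> g = f * g" "f \<oplus>\<^bsub>semigroup_ring S\<^esub> g = f + g"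
  "\<one>\<^bsub>semigroup_ring S\<^esub> = 1" "\<zero>\<^bsub>semigroup_ring S\<^esub> = 0"
  by (simp_all add: semigroup_ring_def)

lemma cring_semigroup_ring: "cring (semigroup_ring S :: ((int ^ 'n) \<Rightarrow>\<^sub>0 'k::field) ring)"
proof (rule cringI)
  show "abelian_group (semigroup_ring S :: ((int ^ 'n) \<Rightarrow>\<^sub>0 'k::field) ring)"
  proof (rule abelian_groupI, unfold semigroup_ring_simps)
    fix f :: "(int ^ 'n) \<Rightarrow>\<^sub>0 'k" assume "f \<in> {f. Poly_Mapping.keys f \<subseteq> S}"
    then show "\<exists>y\<in>{f. Poly_Mapping.keys f \<subseteq> S}. y + f = 0"
      by (intro bexI[of _ "- f"]) auto
  qed (auto simp: add_ac keys_add_subset)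
  show "comm_monoid (semigroup_ring S :: ((int ^ 'n) \<Rightarrow>\<^sub>0 'k::field) ring)"
    by (rule comm_monoidI, unfold semigroup_ring_simps)
      (auto simp: mult_ac zero_mem keys_mult_S)
qed (auto simp: semigroup_ring_simps algebra_simps)

lemma semigroup_ring_minus:
  fixes f g :: "(int ^ 'n) \<Rightarrow>\<^sub>0 'k::field"
  assumes "Poly_Mapping.keys f \<subseteq> S" "Poly_Mapping.keys g \<subseteq> S"
  shows "f \<ominus>\<^bsub>semigroup_ring S\<^esub> g = f - g"
proof -
  interpret cring "semigroup_ring S :: ((int ^ 'n) \<Rightarrow>\<^sub>0 'k::field) ring"
    by (rule cring_semigroup_ring)
  have "\<ominus>\<^bsub>semigroup_ring S\<^esub> g = - g"
    by (rule minus_equality) (use assms in \<open>auto simp: semigroup_ring_simps\<close>)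
  then show ?thesis
    by (simp add: a_minus_def semigroup_ring_simps)
qed

lemma semigroup_max_ideal_eq:
  "(semigroup_max_ideal S :: ((int ^ 'n) \<Rightarrow>\<^sub>0 'k::field) set) = {f. Poly_Mapping.keys f \<subseteq> S \<and> Poly_Mapping.lookup f 0 = 0}"
    (is "?I = ?K")
proof
  interpret B: cring "semigroup_ring S :: ((int ^ 'n) \<Rightarrow>\<^sub>0 'k::field) ring"
    by (rule cring_semigroup_ring)
  have "ideal ?K (semigroup_ring S)"
    by (rule B.ideal_criterion)
      (auto simp: semigroup_ring_simps lookup_mult_zero lookup_add keys_mult_S keys_add_subset)
  moreover have "(\<lambda>m. Poly_Mapping.single m 1) ` (S - {0}) \<subseteq> ?K"
    by (auto simp: lookup_single when_def)
  ultimately show "?I \<subseteq> ?K"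
    unfolding semigroup_max_ideal_def genideal_def by blast
  show "?K \<subseteq> ?I"
  proof
    fix f :: "(int ^ 'n) \<Rightarrow>\<^sub>0 'k" assume f: "f \<in> ?K"
    have sub: "(\<lambda>m. Poly_Mapping.single m 1) ` (S - {0}) \<subseteq>
        carrier (semigroup_ring S :: ((int ^ 'n) \<Rightarrow>\<^sub>0 'k::field) ring)"
      by (auto simp: semigroup_ring_simps)
    interpret I: ideal ?I "semigroup_ring S :: ((int ^ 'n) \<Rightarrow>\<^sub>0 'k::field) ring"
      unfolding semigroup_max_ideal_def by (rule B.genideal_ideal[OF sub])
    have single: "Poly_Mapping.single m c \<in> ?I" if "m \<in> S - {0}" for m and c :: 'k
    proof -
      have "Poly_Mapping.single m 1 \<in> ?I"
        using B.genideal_self[OF sub] that unfolding semigroup_max_ideal_def by blast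
      then have "Poly_Mapping.single 0 c \<otimes>\<^bsub>semigroup_ring S\<^esub> Poly_Mapping.single m 1 \<in> ?I"
        by (rule I.I_l_closed) (auto simp: semigroup_ring_simps zero_mem)
      then show ?thesis
        by (simp add: semigroup_ring_simps mult_single)
    qed
    have "(\<Sum>m\<in>K. Poly_Mapping.single m (Poly_Mapping.lookup f m)) \<in> ?I" if "finite K" "K \<subseteq> S - {0}" for K
      using that
    proof (induction K rule: finite_induct)
      case empty
      then show ?case using I.zero_closed by (simp add: semigroup_ring_simps)
    next
      case (insert m K)
      then show ?case
        using I.a_closed[OF single[of m "Poly_Mapping.lookup f m"]] by (simp add: semigroup_ring_simps)
    qed
    moreover have "Poly_Mapping.keys f \<subseteq> S - {0}"
      using f by (auto simp: in_keys_iff)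
    ultimately have "(\<Sum>m\<in>Poly_Mapping.keys f. Poly_Mapping.single m (Poly_Mapping.lookup f m)) \<in> ?I"
      by simp
    then show "f \<in> ?I"
      by (simp only: poly_mapping_eq_sum_single[symmetric])
  qed
qed

lemma carrier_minus_max_ideal:
  "carrier (semigroup_ring S) - semigroup_max_ideal S = denominators"
  by (auto simp: semigroup_ring_simps semigroup_max_ideal_eq denominators_def)

end

section \<open>Monomial ideals of the localization\<close>

locale toric_ring = pointed_semigroup S u0 + ring L
  for S :: "(int ^ 'n) set" and u0 :: "int ^ 'n" and L :: "('k::field, 'n) toric_elem ring" (structure) +
  assumes L_eq: "L = toric_local_ring S"
begin

abbreviation Den :: "((int ^ 'n) \<Rightarrow>\<^sub>0 'k) set" where
  "Den \<equiv> denominators"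

definition quo :: "((int ^ 'n) \<Rightarrow>\<^sub>0 'k) \<Rightarrow> ((int ^ 'n) \<Rightarrow>\<^sub>0 'k) \<Rightarrow> ('k, 'n) toric_elem" where
  "quo f g = loc_frac (semigroup_ring S) Den f g"

definition chi :: "int ^ 'n \<Rightarrow> ('k, 'n) toric_elem" where
  "chi m = quo (Poly_Mapping.single m 1) 1"

text \<open>For an upset \<open>E\<close>, the localization of the monomial ideal with exponent set
  \<open>E\<close>.\<close>

definition J :: "(int ^ 'n) set \<Rightarrow> ('k, 'n) toric_elem set" where
  "J E = {quo f g | f g. Poly_Mapping.keys f \<subseteq> E \<and> g \<in> Den}"

lemma Den_S: "g \<in> Den \<Longrightarrow> Poly_Mapping.keys g \<subseteq> S"
  by (simp add: denominators_def)

lemma Den_mult [simp]: "f \<in> Den \<Longrightarrow> g \<in> Den \<Longrightarrow> f * g \<in> Den"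
  by (simp add: denominators_def keys_mult_S lookup_mult_zero)

lemma Den_one [simp]: "1 \<in> Den"
  by (simp add: denominators_def zero_mem lookup_one)

lemma Den_power [simp]: "g \<in> Den \<Longrightarrow> g ^ n \<in> Den"
  by (induction n) auto

lemma keys_power_S: "Poly_Mapping.keys f \<subseteq> S \<Longrightarrow> Poly_Mapping.keys (f ^ n) \<subseteq> S"
  by (induction n) (auto simp: keys_mult_S zero_mem)

text \<open>The cancellation of denominators from upsets, for \<open>E = {}\<close>. As no
  denominator is a zero divisor, fractions are compared by plain cross-multiplication.\<close>

lemma Den_cancel:
  assumes "w \<in> Den" "w * h = 0"
  shows "h = 0"
  using keys_subset_upset_cancel[of w "{}" h] assms by (simp add: denominators_def upset_empty)

lemma loc_rel_iff:
  "((f, g), (f', g')) \<in> loc_rel (semigroup_ring S) Den \<longleftrightarrow>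
     Poly_Mapping.keys f \<subseteq> S \<and> Poly_Mapping.keys f' \<subseteq> S \<and> g \<in> Den \<and> g' \<in> Den \<and> g' * f = g * f'"
proof -
  have "(\<exists>w\<in>Den. w \<otimes>\<^bsub>semigroup_ring S\<^esub> (g' \<otimes>\<^bsub>semigroup_ring S\<^esub> f \<ominus>\<^bsub>semigroup_ring S\<^esub>
      g \<otimes>\<^bsub>semigroup_ring S\<^esub> f') = \<zero>\<^bsub>semigroup_ring S\<^esub>) \<longleftrightarrow> g' * f = g * f'"
    if "Poly_Mapping.keys f \<subseteq> S" "Poly_Mapping.keys f' \<subseteq> S" "g \<in> Den" "g' \<in> Den"
  proof -
    have "g' \<otimes>\<^bsub>semigroup_ring S\<^esub> f \<ominus>\<^bsub>semigroup_ring S\<^esub> g \<otimes>\<^bsub>semigroup_ring S\<^esub> f' = g' * f - g * f'"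
      using that Den_S by (simp add: semigroup_ring_simps semigroup_ring_minus keys_mult_S)
    then show ?thesis
      using Den_cancel[of _ "g' * f - g * f'"] by (auto simp: semigroup_ring_simps intro!: bexI[of _ 1])
  qed
  then show ?thesis
    by (auto simp: loc_rel_def semigroup_ring_simps)
qed

lemma mem_quo_iff:
  "(f', g') \<in> quo f g \<longleftrightarrow>
     Poly_Mapping.keys f \<subseteq> S \<and> Poly_Mapping.keys f' \<subseteq> S \<and> g \<in> Den \<and> g' \<in> Den \<and> g' * f = g * f'"
  by (auto simp: quo_def loc_frac_def loc_rel_iff)

lemma quo_self: "Poly_Mapping.keys f \<subseteq> S \<Longrightarrow> g \<in> Den \<Longrightarrow> (f, g) \<in> quo f g"
  by (simp add: mem_quo_iff)

lemma cross_mult_trans: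
  assumes "g' \<in> Den" "g' * f = g * f'" "g'' * f' = g' * f''"
  shows "g'' * f = g * f''"
proof -
  have "g' * (g'' * f - g * f'') = g'' * (g' * f) - g * (g' * f'')"
    by (simp add: algebra_simps)
  also have "\<dots> = g'' * (g * f') - g * (g'' * f')"
    by (simp only: assms(2) assms(3))
  also have "\<dots> = 0"
    by (simp add: algebra_simps)
  finally have "g'' * f - g * f'' = 0"
    by (rule Den_cancel[OF assms(1)])
  then show ?thesis by simp
qed

lemma quo_eq_iff:
  assumes "Poly_Mapping.keys f \<subseteq> S" "g \<in> Den" "Poly_Mapping.keys f' \<subseteq> S" "g' \<in> Den"
  shows "quo f g = quo f' g' \<longleftrightarrow> g' * f = g * f'"
proof
  assume "quo f g = quo f' g'"
  then have "(f', g') \<in> quo f g"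
    using quo_self assms by simp
  then show "g' * f = g * f'" by (simp add: mem_quo_iff)
next
  assume eq: "g' * f = g * f'"
  have "h * f = g * k \<longleftrightarrow> h * f' = g' * k" if "h \<in> Den" for h k
    using cross_mult_trans[OF assms(2), of f' g' f h k] cross_mult_trans[OF assms(4) eq, of h k] eq by metis
  then show "quo f g = quo f' g'"
    using assms by (auto simp: mem_quo_iff)
qed

text \<open>The operations of \<open>localization\<close> are unions over all representatives; once
  the members agree, the union is the member at the given representatives.\<close>

lemma UN_quo:
  assumes "Poly_Mapping.keys f \<subseteq> S" "g \<in> Den" "Poly_Mapping.keys f' \<subseteq> S" "g' \<in> Den"
    and "\<And>h k h' k'. (h, k) \<in> quo f g \<Longrightarrow> (h', k') \<in> quo f' g' \<Longrightarrow> F h k h' k' = F f g f' g'"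
  shows "(\<Union>(h, k)\<in>quo f g. \<Union>(h', k')\<in>quo f' g'. F h k h' k') = F f g f' g'"
proof -
  have "(\<Union>(h, k)\<in>quo f g. \<Union>(h', k')\<in>quo f' g'. F h k h' k') =
      (\<Union>p\<in>quo f g. \<Union>p'\<in>quo f' g'. F f g f' g')"
    by (intro SUP_cong refl) (auto simp: assms(5) split: prod.splits)
  also have "\<dots> = F f g f' g'"
    using quo_self[OF assms(1,2)] quo_self[OF assms(3,4)] by auto
  finally show ?thesis .
qed

lemma toric_ring_simps:
  "carrier L = {quo f g | f g. Poly_Mapping.keys f \<subseteq> S \<and> g \<in> Den}"
  "\<one> = quo 1 1" "\<zero> = quo 0 1"
  "x \<otimes> y = (\<Union>(h, k)\<in>x. \<Union>(h', k')\<in>y. quo (h * h') (k * k'))"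
  "x \<oplus> y = (\<Union>(h, k)\<in>x. \<Union>(h', k')\<in>y. quo (h * k' + h' * k) (k * k'))"
  unfolding L_eq toric_local_ring_def carrier_minus_max_ideal localization_def
  by (simp_all add: quo_def[abs_def] loc_frac_def[abs_def] semigroup_ring_simps quotient_def) blast

lemma mult_quo:
  assumes "Poly_Mapping.keys f \<subseteq> S" "g \<in> Den" "Poly_Mapping.keys f' \<subseteq> S" "g' \<in> Den"
  shows "quo f g \<otimes> quo f' g' = quo (f * f') (g * g')"
  unfolding toric_ring_simps
proof (rule UN_quo[OF assms])
  fix h k h' k' assume "(h, k) \<in> quo f g" "(h', k') \<in> quo f' g'"
  then have *: "Poly_Mapping.keys h \<subseteq> S" "k \<in> Den" "Poly_Mapping.keys h' \<subseteq> S" "k' \<in> Den" "k * f = g * h" "k' * f' = g' * h'"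
    by (simp_all add: mem_quo_iff)
  have "g * g' * (h * h') = (g * h) * (g' * h')" by (simp add: mult_ac)
  also have "\<dots> = (k * f) * (k' * f')" by (simp only: *)
  finally show "quo (h * h') (k * k') = quo (f * f') (g * g')"
    using assms * by (subst quo_eq_iff) (auto simp: keys_mult_S mult_ac)
qed

lemma add_quo:
  assumes "Poly_Mapping.keys f \<subseteq> S" "g \<in> Den" "Poly_Mapping.keys f' \<subseteq> S" "g' \<in> Den"
  shows "quo f g \<oplus> quo f' g' = quo (f * g' + f' * g) (g * g')"
  unfolding toric_ring_simps
proof (rule UN_quo[OF assms])
  fix h k h' k' assume "(h, k) \<in> quo f g" "(h', k') \<in> quo f' g'"
  then have *: "Poly_Mapping.keys h \<subseteq> S" "k \<in> Den" "Poly_Mapping.keys h' \<subseteq> S" "k' \<in> Den" "k * f = g * h" "k' * f' = g' * h'"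
    by (simp_all add: mem_quo_iff)
  have "g * g' * (h * k' + h' * k) = (g * h) * (g' * k') + (g' * h') * (g * k)"
    by (simp add: algebra_simps)
  also have "\<dots> = (k * f) * (g' * k') + (k' * f') * (g * k)" by (simp only: *)
  also have "\<dots> = k * k' * (f * g' + f' * g)" by (simp add: algebra_simps)
  finally show "quo (h * k' + h' * k) (k * k') = quo (f * g' + f' * g) (g * g')"
    using assms * Den_S by (subst quo_eq_iff) (auto simp: keys_mult_S keys_add_subset)
qed

lemma add_quo_same:
  assumes "Poly_Mapping.keys f \<subseteq> S" "Poly_Mapping.keys f' \<subseteq> S" "g \<in> Den"
  shows "quo f g \<oplus> quo f' g = quo (f + f') g"
  using assms Den_S
  by (subst add_quo) (auto simp: quo_eq_iff keys_mult_S keys_add_subset algebra_simps)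

lemma quo_carrier [simp]: "Poly_Mapping.keys f \<subseteq> S \<Longrightarrow> g \<in> Den \<Longrightarrow> quo f g \<in> carrier L"
  by (auto simp: toric_ring_simps)

lemma zero_eq_quo: "g \<in> Den \<Longrightarrow> \<zero> = quo 0 g"
  by (simp add: toric_ring_simps quo_eq_iff)

lemma pow_quo:
  assumes "Poly_Mapping.keys f \<subseteq> S" "g \<in> Den"
  shows "quo f g [^] (n::nat) = quo (f ^ n) (g ^ n)"
  by (induction n) (simp_all add: toric_ring_simps(2) mult_quo assms keys_power_S mult.commute)

lemma single_S [simp]: "m \<in> S \<Longrightarrow> Poly_Mapping.keys (Poly_Mapping.single m c) \<subseteq> S"
  by auto

lemma chi_carrier [simp]: "m \<in> S \<Longrightarrow> chi m \<in> carrier L"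
  by (simp add: chi_def del: keys_single)

lemma toric_monomial_eq: "toric_monomial S m = chi m"
  by (simp add: toric_monomial_def chi_def quo_def carrier_minus_max_ideal)

lemma chi_mult: "m \<in> S \<Longrightarrow> m' \<in> S \<Longrightarrow> chi m \<otimes> chi m' = chi (m + m')"
  unfolding chi_def by (subst mult_quo) (simp_all add: mult_single del: keys_single)

lemma chi_zero: "chi 0 = \<one>"
  by (simp add: chi_def toric_ring_simps)

lemma chi_pow: "m \<in> S \<Longrightarrow> chi m [^] n = chi (int n *s m)"
  by (induction n) (simp_all add: chi_zero chi_mult smult_mem smult_Suc_vec del: of_nat_Suc)

text \<open>Membership can be read off from any numerator, because a denominator can be cancelled
  without leaving an upset.\<close>

lemma quo_mem_J_iff:
  assumes "upset E" "Poly_Mapping.keys f \<subseteq> S" "g \<in> Den"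
  shows "quo f g \<in> J E \<longleftrightarrow> Poly_Mapping.keys f \<subseteq> E"
proof
  assume "quo f g \<in> J E"
  then obtain f' g' where *: "quo f g = quo f' g'" "Poly_Mapping.keys f' \<subseteq> E" "g' \<in> Den"
    by (auto simp: J_def)
  then have "g' * f = g * f'"
    using assms quo_eq_iff by (metis upset_def subset_trans)
  then have "Poly_Mapping.keys (g' * f) \<subseteq> E"
    using keys_mult_upset[OF assms(1) Den_S *(2), OF assms(3)] by simp
  then show "Poly_Mapping.keys f \<subseteq> E"
    using keys_subset_upset_cancel[of g' E f] *(3) assms(1) by (simp add: denominators_def)
qed (use assms in \<open>auto simp: J_def\<close>)

lemma chi_mem_J_iff: "upset E \<Longrightarrow> m \<in> S \<Longrightarrow> chi m \<in> J E \<longleftrightarrow> m \<in> E"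
  unfolding chi_def by (subst quo_mem_J_iff) auto

lemma J_memE:
  assumes "upset E" "x \<in> J E"
  obtains f g where "x = quo f g" "Poly_Mapping.keys f \<subseteq> E" "Poly_Mapping.keys f \<subseteq> S" "g \<in> Den"
  using assms by (auto simp: J_def upset_def)

lemma ideal_J:
  assumes E: "upset E"
  shows "ideal (J E) L"
proof (rule ideal_criterion)
  have ES: "Poly_Mapping.keys f \<subseteq> E \<Longrightarrow> Poly_Mapping.keys f \<subseteq> S" for f
    using E by (auto simp: upset_def)
  show "J E \<subseteq> carrier L"
    by (auto simp: J_def ES)
  show "\<zero> \<in> J E"
    by (simp add: toric_ring_simps quo_mem_J_iff E)
  fix x y assume "x \<in> J E" "y \<in> J E"
  then show "x \<oplus> y \<in> J E"
    by (elim J_memE[OF E])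
      (simp add: add_quo quo_mem_J_iff E Den_S keys_mult_S keys_add_subset keys_mult_upset2)
next
  fix a x assume "a \<in> J E" "x \<in> carrier L"
  moreover obtain f g where "a = quo f g" "Poly_Mapping.keys f \<subseteq> E" "Poly_Mapping.keys f \<subseteq> S" "g \<in> Den"
    using \<open>a \<in> J E\<close> by (rule J_memE[OF E])
  moreover obtain f' g' where "x = quo f' g'" "Poly_Mapping.keys f' \<subseteq> S" "g' \<in> Den"
    using \<open>x \<in> carrier L\<close> unfolding toric_ring_simps(1) by blast
  ultimately
  show "x \<otimes> a \<in> J E" "a \<otimes> x \<in> J E"
    by (simp_all add: mult_quo quo_mem_J_iff E keys_mult_S keys_mult_upset keys_mult_upset2)
qed

lemma J_mono: "E \<subseteq> F \<Longrightarrow> J E \<subseteq> J F"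
  by (auto simp: J_def)

lemma J_S: "J S = carrier L"
  by (auto simp: J_def toric_ring_simps)

lemma J_subset_ideal:
  assumes E: "E \<subseteq> S" and I: "ideal I L" and chi: "\<And>m. m \<in> E \<Longrightarrow> chi m \<in> I"
  shows "J E \<subseteq> I"
proof
  interpret I: ideal I L by (rule I)
  fix x assume "x \<in> J E"
  then obtain f g where x: "x = quo f g" "Poly_Mapping.keys f \<subseteq> E" "g \<in> Den"
    by (auto simp: J_def)
  have "quo (\<Sum>m\<in>K. Poly_Mapping.single m (Poly_Mapping.lookup f m)) 1 \<in> I
      \<and> Poly_Mapping.keys (\<Sum>m\<in>K. Poly_Mapping.single m (Poly_Mapping.lookup f m)) \<subseteq> S" if "finite K" "K \<subseteq> E" for K
    using that
  proof (induction K rule: finite_induct)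
    case empty
    then show ?case using I.zero_closed by (simp add: toric_ring_simps)
  next
    case (insert m K)
    have m: "m \<in> S" using insert E by auto
    have "quo (Poly_Mapping.single 0 (Poly_Mapping.lookup f m)) 1 \<otimes> chi m \<in> I"
      using insert chi by (intro I.I_l_closed) (auto simp: zero_mem)
    also have "quo (Poly_Mapping.single 0 (Poly_Mapping.lookup f m)) 1 \<otimes> chi m = quo (Poly_Mapping.single m (Poly_Mapping.lookup f m)) 1"
      using m unfolding chi_def by (subst mult_quo) (auto simp: zero_mem mult_single)
    finally have "quo (Poly_Mapping.single m (Poly_Mapping.lookup f m)) 1
        \<oplus> quo (\<Sum>m\<in>K. Poly_Mapping.single m (Poly_Mapping.lookup f m)) 1 \<in> I"
      using insert by (intro I.a_closed) auto
    moreover have "Poly_Mapping.keys (Poly_Mapping.single m (Poly_Mapping.lookup f m)) \<subseteq> S"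
      using m by auto
    ultimately show ?case
      using insert by (simp add: add_quo_same keys_add_subset del: keys_single)
  qed
  from this[of "Poly_Mapping.keys f"] have "quo f 1 \<in> I"
    using x(2) by (simp flip: poly_mapping_eq_sum_single)
  moreover have "Poly_Mapping.keys f \<subseteq> S" using x(2) E by blast
  moreover have "Poly_Mapping.keys (1 :: (int ^ 'n) \<Rightarrow>\<^sub>0 'k) \<subseteq> S" by (simp add: zero_mem)
  ultimately have "quo 1 g \<otimes> quo f 1 \<in> I"
    using x(3) by (intro I.I_l_closed) auto
  then show "x \<in> I"
    using x \<open>Poly_Mapping.keys f \<subseteq> S\<close> \<open>Poly_Mapping.keys 1 \<subseteq> S\<close> by (simp add: mult_quo del: keys_one)
qed

lemma upset_generated:
  assumes "E \<subseteq> S"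
  shows "upset {e + s | e s. e \<in> E \<and> s \<in> S}"
proof -
  have "\<exists>e' s'. e + s + t = e' + s' \<and> e' \<in> E \<and> s' \<in> S" if "e \<in> E" "s \<in> S" "t \<in> S" for e s t
    using that by (intro exI[of _ e] exI[of _ "s + t"]) (simp add: add.assoc add_mem)
  moreover have "e + s \<in> S" if "e \<in> E" "s \<in> S" for e s
    using that assms by (auto intro: add_mem)
  ultimately show ?thesis
    unfolding upset_def by blast
qed

lemma genideal_chi:
  assumes "E \<subseteq> S"
  shows "Idl (chi ` E) = J {e + s | e s. e \<in> E \<and> s \<in> S}" and "upset {e + s | e s. e \<in> E \<and> s \<in> S}"
proof -
  let ?F = "{e + s | e s. e \<in> E \<and> s \<in> S}"
  show F: "upset ?F"
    by (rule upset_generated[OF assms])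
  have sub: "chi ` E \<subseteq> carrier L" using assms by auto
  have "e \<in> ?F" if "e \<in> E" for e
    using that zero_mem by (intro CollectI exI[of _ e] exI[of _ 0]) simp
  then have "chi ` E \<subseteq> J ?F"
    using assms F chi_mem_J_iff by blast
  then have "Idl (chi ` E) \<subseteq> J ?F"
    by (rule genideal_minimal[OF ideal_J[OF F]])
  moreover have "J ?F \<subseteq> Idl (chi ` E)"
  proof (rule J_subset_ideal[OF _ genideal_ideal[OF sub]])
    interpret I: ideal "Idl (chi ` E)" L by (rule genideal_ideal[OF sub])
    fix m assume "m \<in> ?F"
    then obtain e s where m: "m = e + s" "e \<in> E" "s \<in> S" by auto
    have "chi e \<otimes> chi s \<in> Idl (chi ` E)"
      using genideal_self[OF sub] m by (intro I.I_r_closed) auto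
    then show "chi m \<in> Idl (chi ` E)"
      using m assms by (auto simp: chi_mult)
  qed (use F in \<open>simp add: upset_def\<close>)
  ultimately show "Idl (chi ` E) = J ?F" by blast
qed

section \<open>Monomial ideals as exponent sets, their products and integral closures\<close>

definition exps :: "('k, 'n) toric_elem set \<Rightarrow> (int ^ 'n) set" where
  "exps I = {m \<in> S. chi m \<in> I}"

lemma exps_J: "upset E \<Longrightarrow> exps (J E) = E"
  using chi_mem_J_iff by (auto simp: exps_def upset_def)

lemma monomial_ideal_exps:
  assumes "monomial_ideal S I"
  shows "upset (exps I)" "J (exps I) = I"
proof -
  obtain E where E: "E \<subseteq> S" "I = genideal L (chi ` E)"
    using assms by (auto simp: monomial_ideal_def toric_monomial_eq simp flip: L_eq)
  note G = genideal_chi[OF E(1)]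
  show "upset (exps I)" "J (exps I) = I"
    using G by (simp_all add: E(2) exps_J)
qed

lemma ideal_prod_J:
  assumes E: "upset E" and F: "upset F"
  shows "ideal_prod L (J E) (J F) = J {x + y | x y. x \<in> E \<and> y \<in> F}" (is "_ = J ?G")
proof
  have G: "upset ?G" by (rule upset_setsum[OF E F])
  interpret G: ideal "J ?G" L by (rule ideal_J[OF G])
  show "ideal_prod L (J E) (J F) \<subseteq> J ?G"
  proof
    fix x assume "x \<in> ideal_prod L (J E) (J F)"
    then show "x \<in> J ?G"
    proof induction
      case (prod i j)
      then show ?case
        by (elim J_memE[OF E] J_memE[OF F])
          (simp add: mult_quo quo_mem_J_iff[OF G] keys_mult_S keys_mult_subset)
    qed (rule G.a_closed)
  qed
  show "J ?G \<subseteq> ideal_prod L (J E) (J F)"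
  proof (rule J_subset_ideal)
    fix m assume "m \<in> ?G"
    then obtain x y where m: "m = x + y" "x \<in> E" "y \<in> F" by auto
    then have "x \<in> S" "y \<in> S" using E F by (auto simp: upset_def)
    then show "chi m \<in> ideal_prod L (J E) (J F)"
      using m ideal_prod.prod[of "chi x" "J E" "chi y" "J F" L]
      by (simp add: chi_mem_J_iff[OF E] chi_mem_J_iff[OF F] chi_mult)
  qed (use G E F in \<open>auto simp: upset_def intro!: ideal_prod_is_ideal ideal_J\<close>)
qed

lemma ideal_power_J:
  assumes "upset E"
  shows "ideal_power L (J E) k = J (sumpow E k)"
proof (induction k)
  case 0
  then show ?case by (simp add: ideal_power_def ideals_set_def J_S)
next
  case (Suc k)
  have "ideal_power L (J E) (Suc k) = ideal_prod L (ideal_power L (J E) k) (J E)"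
    by (simp add: ideal_power_def ideals_set_def)
  then show ?case
    unfolding Suc using ideal_prod_J[OF upset_sumpow[OF assms] assms] by simp
qed

lemma finsum_mem_ideal:
  assumes "ideal I L" "\<And>i. i \<in> A \<Longrightarrow> f i \<in> I"
  shows "finsum L f A \<in> I"
proof -
  interpret I: ideal I L by fact
  show ?thesis
    using assms(2)
  proof (induction A rule: infinite_finite_induct)
    case (insert i A)
    then have "f \<in> insert i A \<rightarrow> carrier L"
      using I.Icarr by blast
    then show ?case
      using insert by (subst finsum_insert) (auto intro: I.a_closed)
  qed (simp_all add: finsum_infinite)
qed

text \<open>In an integral equation the exponent \<open>n m\<close> of the leading term must occur
  among the exponents allowed for some term \<open>c i \<otimes> chi m [^] (n - i)\<close>.
  Cancelling \<open>(n - i) m\<close> leaves \<open>i m\<close> in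
  \<open>sumpow E i\<close>.\<close>

lemma chi_integral_imp:
  assumes E: "upset E" and m: "m \<in> S" "chi m \<in> integral_closure L (J E)"
  obtains k where "1 \<le> k" "int k *s m \<in> sumpow E k"
proof -
  obtain n c where n: "n \<ge> 1" "\<And>i. i \<in> {1..n} \<Longrightarrow> c i \<in> J (sumpow E i)"
    and eq: "chi m [^] n \<oplus> (\<Oplus>i\<in>{1..n}. c i \<otimes> chi m [^] (n - i)) = \<zero>"
    using m(2) unfolding integral_closure_def ideal_power_J[OF E] by blast
  \<comment> \<open>\<open>V i\<close> is the exponent set of the principal ideal of
    \<open>chi m [^] (n - i)\<close>. A union of upsets is an upset, so \<open>F\<close> belongs to
    an ideal containing all lower terms of the equation, and membership of a monomial in it means
    membership in one of the pieces.\<close>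
  define V where "V i = {e + s | e s. e \<in> {int (n - i) *s m} \<and> s \<in> S}" for i
  define F where "F = (\<Union>i\<in>{1..n}. {x + y | x y. x \<in> sumpow E i \<and> y \<in> V i})"
  have V: "upset (V i)" for i
    unfolding V_def by (rule upset_generated) (simp add: smult_mem m)
  have F: "upset F"
    unfolding F_def using upset_setsum[OF upset_sumpow[OF E] V] unfolding upset_def by blast
  interpret F: ideal "J F" L by (rule ideal_J[OF F])
  have "c i \<otimes> chi m [^] (n - i) \<in> J F" if "i \<in> {1..n}" for i
  proof -
    have "int (n - i) *s m \<in> V i"
      unfolding V_def using zero_mem by (intro CollectI exI[of _ "int (n - i) *s m"] exI[of _ 0]) simp
    then have "chi m [^] (n - i) \<in> J (V i)"
      using m V by (simp add: chi_pow chi_mem_J_iff smult_mem)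
    then have "c i \<otimes> chi m [^] (n - i) \<in> ideal_prod L (J (sumpow E i)) (J (V i))"
      using n(2)[OF that] by (rule ideal_prod.prod[rotated])
    then have "c i \<otimes> chi m [^] (n - i) \<in> J {x + y | x y. x \<in> sumpow E i \<and> y \<in> V i}"
      by (simp only: ideal_prod_J[OF upset_sumpow[OF E] V])
    moreover have "{x + y | x y. x \<in> sumpow E i \<and> y \<in> V i} \<subseteq> F"
      unfolding F_def using that by (rule UN_upper)
    ultimately show ?thesis
      using J_mono by blast
  qed
  then have "(\<Oplus>i\<in>{1..n}. c i \<otimes> chi m [^] (n - i)) \<in> J F"
    by (rule finsum_mem_ideal[OF F.is_ideal])
  moreover have "chi m [^] n = \<ominus> (\<Oplus>i\<in>{1..n}. c i \<otimes> chi m [^] (n - i))"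
    using eq m(1) F.Icarr[OF calculation] by (intro minus_equality[symmetric] nat_pow_closed chi_carrier)
  ultimately have "chi (int n *s m) \<in> J F"
    using m F.a_inv_closed by (simp add: chi_pow)
  then have "int n *s m \<in> F"
    using F m by (simp add: chi_mem_J_iff smult_mem)
  then obtain i x s where i: "i \<in> {1..n}" "int n *s m = x + (int (n - i) *s m + s)" "x \<in> sumpow E i" "s \<in> S"
    unfolding F_def V_def by auto
  have "int n *s m = int i *s m + int (n - i) *s m"
    using i(1) smult_add_vec[of i "n - i" m] by simp
  then have "int i *s m = x + s"
    using i(2) by (simp add: add_ac)
  then have "int i *s m \<in> sumpow E i"
    using i(3,4) upset_sumpow[OF E] by (auto simp: upset_def)
  then show ?thesis
    using that i(1) by auto
qed

text \<open>The subring \<open>G\<close> of \<open>k[M][T]\<close> below is the Rees algebra of the ideal with exponents \<open>E\<close>; it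
  reduces integrality over an ideal to integrality over a ring, applied to \<open>f T\<close>.\<close>

lemma polynomial_integral_equation:
  fixes f :: "(int ^ 'n) \<Rightarrow>\<^sub>0 'k"
  assumes E: "upset E" and f: "\<And>m. m \<in> Poly_Mapping.keys f \<Longrightarrow> \<exists>k\<ge>1. int k *s m \<in> sumpow E k"
  obtains n d where "n \<ge> 1" "\<And>i. Poly_Mapping.keys (d i) \<subseteq> sumpow E i" "f ^ n + (\<Sum>i=1..n. d i * f ^ (n - i)) = 0"
proof -
  define G where "G = {h :: ((int ^ 'n) \<Rightarrow>\<^sub>0 'k) poly. \<forall>i. Poly_Mapping.keys (poly.coeff h i) \<subseteq> sumpow E i}"
  interpret G: subring_of_comm_ring G
  proof
    show "1 \<in> G"
      by (auto simp: G_def coeff_1 zero_mem split: if_splits)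
    fix x y assume xy: "x \<in> G" "y \<in> G"
    show "x + y \<in> G"
      using xy by (auto simp: G_def keys_add_subset)
    have "Poly_Mapping.keys (poly.coeff x i * poly.coeff y (n - i)) \<subseteq> sumpow E n" if "i \<le> n" for i n
    proof -
      have "k + l \<in> sumpow E n" if "k \<in> sumpow E i" "l \<in> sumpow E (n - i)" for k l
        using sumpow_add[OF E that] \<open>i \<le> n\<close> by simp
      then show ?thesis
        using keys_mult_subset[of "poly.coeff x i" "sumpow E i" "poly.coeff y (n - i)" "sumpow E (n - i)"] xy
        unfolding G_def by blast
    qed
    then have "Poly_Mapping.keys (\<Sum>i\<le>n. poly.coeff x i * poly.coeff y (n - i)) \<subseteq> sumpow E n" for n
      using keys_sum[of "\<lambda>i. poly.coeff x i * poly.coeff y (n - i)" "{..n}"] by blast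
    then show "x * y \<in> G"
      by (simp add: G_def coeff_mult)
  qed (auto simp: G_def)
  have "integral_over G (Polynomial.monom (Poly_Mapping.single m (Poly_Mapping.lookup f m)) 1)" if "m \<in> Poly_Mapping.keys f" for m
  proof -
    obtain k where k: "k \<ge> 1" "int k *s m \<in> sumpow E k" using f \<open>m \<in> Poly_Mapping.keys f\<close> by blast
    have pow: "Poly_Mapping.single m c ^ k = Poly_Mapping.single (int k *s m) (c ^ k)" for c :: 'k
      by (induction k) (simp_all add: mult_single smult_Suc_vec add.commute del: of_nat_Suc)
    \<comment> \<open>The \<open>k\<close>-th power of the monomial already lies in
      \<open>G\<close>, so its integral equation has the form \<open>X ^ k - c = 0\<close> with
      \<open>c\<close> in \<open>G\<close>.\<close>
    have "[:- Polynomial.monom (Poly_Mapping.single (int k *s m) (Poly_Mapping.lookup f m ^ k)) k:] \<in> polys_below G k"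
      using k zero_mem by (auto simp: polys_below_def coeff_pCons G_def split: nat.splits)
    then show ?thesis
      using k(1) unfolding integral_over_def
      by (intro exI[of _ k]) (auto simp: monom_power pow intro!: bexI)
  qed
  then have "integral_over G (\<Sum>m\<in>Poly_Mapping.keys f. Polynomial.monom (Poly_Mapping.single m (Poly_Mapping.lookup f m)) 1)"
    by (rule G.integral_over_sum)
  also have "(\<Sum>m\<in>Poly_Mapping.keys f. Polynomial.monom (Poly_Mapping.single m (Poly_Mapping.lookup f m)) 1) =
      Polynomial.monom (\<Sum>m\<in>Poly_Mapping.keys f. Poly_Mapping.single m (Poly_Mapping.lookup f m)) 1"
    by (rule monom_sum[symmetric])
  also have "(\<Sum>m\<in>Poly_Mapping.keys f. Poly_Mapping.single m (Poly_Mapping.lookup f m)) = f"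
    by (rule poly_mapping_eq_sum_single[symmetric])
  finally obtain n h where n: "n \<ge> 1" "h \<in> polys_below G n"
      "Polynomial.monom f 1 ^ n + poly h (Polynomial.monom f 1) = 0"
    by (auto simp: integral_over_def)
  show ?thesis
  proof
    show "n \<ge> 1" by (rule n(1))
    \<comment> \<open>Taking the coefficient of \<open>T ^ n\<close> in the equation for
      \<open>f T\<close> selects from the coefficient of \<open>X ^ (n - i)\<close> its part in
      \<open>T ^ i\<close>, whose exponents lie in \<open>sumpow E i\<close> by the choice of
      \<open>G\<close>.\<close>
    show "Poly_Mapping.keys (poly.coeff (poly.coeff h (n - i)) i) \<subseteq> sumpow E i" for i
      using n(2) by (auto simp: polys_below_def G_def)
    have "poly h (Polynomial.monom f 1) = (\<Sum>j<n. poly.coeff h j * Polynomial.monom f 1 ^ j)"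
    proof -
      have "degree h < n"
        using n(1,2) by (intro degree_lessI) (auto simp: polys_below_def)
      then show ?thesis
        unfolding poly_altdef by (intro sum.mono_neutral_left) (auto simp: coeff_eq_0)
    qed
    moreover have "poly.coeff (poly.coeff h j * Polynomial.monom f 1 ^ j) n = poly.coeff (poly.coeff h j) (n - j) * f ^ j"
      if "j < n" for j
      using that coeff_monom_mult[of "f ^ j" j "poly.coeff h j" n] by (simp add: monom_power mult.commute)
    ultimately have "poly.coeff (Polynomial.monom f 1 ^ n + poly h (Polynomial.monom f 1)) n =
        f ^ n + (\<Sum>j<n. poly.coeff (poly.coeff h j) (n - j) * f ^ j)"
      by (simp add: monom_power coeff_sum)
    also have "(\<Sum>j<n. poly.coeff (poly.coeff h j) (n - j) * f ^ j) =
        (\<Sum>i=1..n. poly.coeff (poly.coeff h (n - i)) i * f ^ (n - i))"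
      by (rule sum.reindex_bij_witness[of _ "\<lambda>i. n - i" "\<lambda>j. n - j"]) auto
    finally show "f ^ n + (\<Sum>i=1..n. poly.coeff (poly.coeff h (n - i)) i * f ^ (n - i)) = 0"
      unfolding n(3) coeff_0 by (rule sym)
  qed
qed

lemma finsum_quo:
  assumes "\<And>i. i \<in> A \<Longrightarrow> Poly_Mapping.keys (d i) \<subseteq> S" "g \<in> Den"
  shows "(\<Oplus>i\<in>A. quo (d i) g) = quo (\<Sum>i\<in>A. d i) g"
  using assms(1)
proof (induction A rule: infinite_finite_induct)
  case (insert i A)
  have "Poly_Mapping.keys (\<Sum>i\<in>A. d i) \<subseteq> S"
    using keys_sum[of d A] insert by blast
  then show ?case
    using insert assms(2) by (subst finsum_insert) (auto simp: add_quo_same)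
qed (simp_all add: finsum_infinite zero_eq_quo[OF assms(2)])

text \<open>Converse to \<open>chi_integral_imp\<close>, for all elements and not only monomials: an
  equation for the numerator \<open>f\<close>, divided by \<open>g ^ n\<close>, is one for
  \<open>f / g\<close> with the coefficients \<open>d i / g ^ i\<close>.\<close>

lemma J_subset_integral_closure:
  assumes E: "upset E" and B: "upset B" and k: "\<And>m. m \<in> B \<Longrightarrow> \<exists>k\<ge>1. int k *s m \<in> sumpow E k"
  shows "J B \<subseteq> integral_closure L (J E)"
proof
  fix x assume "x \<in> J B"
  then obtain f g where x: "x = quo f g" "Poly_Mapping.keys f \<subseteq> B" "Poly_Mapping.keys f \<subseteq> S" "g \<in> Den"
    by (rule J_memE[OF B])
  obtain n d where n: "n \<ge> 1" "\<And>i. Poly_Mapping.keys (d i) \<subseteq> sumpow E i"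
      "f ^ n + (\<Sum>i=1..n. d i * f ^ (n - i)) = 0"
    using polynomial_integral_equation[OF E, of f] k x(2) by blast
  have dS: "Poly_Mapping.keys (d i) \<subseteq> S" for i
    using n(2)[of i] sumpow_subset_S[OF E] by blast
  have "quo (d i) (g ^ i) \<otimes> x [^] (n - i) = quo (d i * f ^ (n - i)) (g ^ n)" if "i \<in> {1..n}" for i
    using that x dS by (simp add: pow_quo mult_quo keys_power_S flip: power_add)
  then have "(\<Oplus>i\<in>{1..n}. quo (d i) (g ^ i) \<otimes> x [^] (n - i)) =
      (\<Oplus>i\<in>{1..n}. quo (d i * f ^ (n - i)) (g ^ n))"
    using x dS by (intro finsum_cong') (auto simp: keys_mult_S keys_power_S)
  also have "\<dots> = quo (\<Sum>i=1..n. d i * f ^ (n - i)) (g ^ n)"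
    using x dS by (intro finsum_quo) (auto simp: keys_mult_S keys_power_S)
  finally have sum_eq: "(\<Oplus>i\<in>{1..n}. quo (d i) (g ^ i) \<otimes> x [^] (n - i)) =
      quo (\<Sum>i=1..n. d i * f ^ (n - i)) (g ^ n)" .
  have "x [^] n \<oplus> (\<Oplus>i\<in>{1..n}. quo (d i) (g ^ i) \<otimes> x [^] (n - i)) =
      quo (f ^ n + (\<Sum>i=1..n. d i * f ^ (n - i))) (g ^ n)"
  proof -
    have "Poly_Mapping.keys (\<Sum>i=1..n. d i * f ^ (n - i)) \<subseteq> S"
      using keys_sum[of "\<lambda>i. d i * f ^ (n - i)" "{1..n}"] keys_mult_S[OF dS keys_power_S[OF x(3)]] by blast
    then show ?thesis
      unfolding sum_eq unfolding x(1) pow_quo[OF x(3,4)]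
      by (intro add_quo_same keys_power_S x(3) Den_power x(4))
  qed
  also have "\<dots> = \<zero>"
    using x n(3) by (simp flip: zero_eq_quo)
  finally show "x \<in> integral_closure L (J E)"
    using n(1,2) x dS unfolding integral_closure_def ideal_power_J[OF E]
    by (intro CollectI conjI exI[of _ n] exI[of _ "\<lambda>i. quo (d i) (g ^ i)"])
      (auto simp: quo_mem_J_iff upset_sumpow[OF E])
qed

end

section \<open>Toric valuations of filtrations\<close>

context toric_ring
begin

text \<open>The lattice points in the relative interior of \<open>\<sigma>\<close>, see
  \<open>rel_interior_dual_cone_iff\<close>, described without topology.\<close>

definition pos_on_S :: "int ^ 'n \<Rightarrow> bool" where
  "pos_on_S u \<longleftrightarrow> (\<forall>s\<in>S. s \<noteq> 0 \<longrightarrow> 0 < lattice_pairing u s)"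

definition min_pairing :: "int ^ 'n \<Rightarrow> (int ^ 'n) set \<Rightarrow> real" where
  "min_pairing u E = (INF m\<in>E. real_of_int (lattice_pairing u m))"

lemma pairing_nonneg: "pos_on_S u \<Longrightarrow> s \<in> S \<Longrightarrow> 0 \<le> lattice_pairing u s"
  unfolding pos_on_S_def by (cases "s = 0") (auto intro: less_imp_le)

lemma pos_on_S_u0: "pos_on_S u0"
  using pairing_pos by (simp add: pos_on_S_def)

lemma min_pairing_le:
  assumes "pos_on_S u" "E \<subseteq> S" "m \<in> E"
  shows "min_pairing u E \<le> real_of_int (lattice_pairing u m)"
proof -
  have "0 \<le> lattice_pairing u m'" if "m' \<in> E" for m'
    using pairing_nonneg[OF assms(1)] assms(2) that by blast
  then show ?thesis
    unfolding min_pairing_def using assms(3) by (intro cINF_lower bdd_belowI[of _ 0]) auto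
qed

lemma min_pairing_attained:
  assumes "pos_on_S u" "E \<subseteq> S" "E \<noteq> {}"
  obtains m where "m \<in> E" "min_pairing u E = real_of_int (lattice_pairing u m)"
proof -
  obtain m where m: "m \<in> E" "\<And>m'. m' \<in> E \<Longrightarrow> nat (lattice_pairing u m) \<le> nat (lattice_pairing u m')"
    using assms(3) ex_has_least_nat[of "\<lambda>m. m \<in> E" _ "\<lambda>m. nat (lattice_pairing u m)"] by blast
  have "lattice_pairing u m \<le> lattice_pairing u m'" if "m' \<in> E" for m'
    using m(2)[OF that] pairing_nonneg[OF assms(1)] assms(2) m(1) that by (simp add: nat_le_eq_zle subset_iff)
  then have "min_pairing u E = real_of_int (lattice_pairing u m)"
    using m(1) min_pairing_le[OF assms(1,2) m(1)] unfolding min_pairing_def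
    by (intro antisym cINF_greatest) auto
  with m(1) show ?thesis by (rule that)
qed

lemma min_pairing_nonneg: "pos_on_S u \<Longrightarrow> E \<subseteq> S \<Longrightarrow> E \<noteq> {} \<Longrightarrow> 0 \<le> min_pairing u E"
  by (metis min_pairing_attained pairing_nonneg of_int_0_le_iff subsetD)

text \<open>Integral closure does not lower toric values: \<open>k m\<close> is a sum of
  \<open>k\<close> elements of \<open>E\<close> up to an element of \<open>S\<close>, and the
  pairing is additive.\<close>

lemma min_pairing_le_of_sumpow:
  assumes u: "pos_on_S u" and E: "upset E" and k: "1 \<le> k" "int k *s m \<in> sumpow E k"
  shows "min_pairing u E \<le> real_of_int (lattice_pairing u m)"
proof -
  have "real k * min_pairing u E \<le> real_of_int (lattice_pairing u (int k *s m))"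
    using E k(2) by (intro pairing_sumpow_ge[of u E _ _ k] min_pairing_le u pairing_nonneg) (auto simp: upset_def)
  then show ?thesis
    using k(1) by (simp add: lattice_pairing_smult)
qed

text \<open>\<open>toric_val\<close> evaluates an unspecified representative. Its denominator
  contributes \<open>0\<close>, since it has a constant term and all pairings on \<open>S\<close>
  are nonnegative.\<close>

lemma toric_val_quo:
  assumes u: "pos_on_S u" and "Poly_Mapping.keys f \<subseteq> S" "g \<in> Den"
  obtains f' g' where "(f', g') \<in> quo f g" "toric_val u (quo f g) = toric_val_poly u f'"
proof -
  have "\<exists>fg. fg \<in> quo f g"
    using quo_self assms(2,3) by blast
  then have "(SOME fg. fg \<in> quo f g) \<in> quo f g"
    by (rule someI_ex)
  then obtain f' g' where fg: "(SOME fg. fg \<in> quo f g) = (f', g')" "(f', g') \<in> quo f g"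
    by (cases "SOME fg. fg \<in> quo f g") simp
  then have g': "g' \<in> Den" by (simp add: mem_quo_iff)
  then have "0 \<in> Poly_Mapping.keys g'" by (simp add: denominators_def in_keys_iff)
  then have "toric_val_poly u g' \<le> ereal (real_of_int (lattice_pairing u 0))"
    unfolding toric_val_poly_def by (rule INF_lower)
  moreover have "0 \<le> toric_val_poly u g'"
    unfolding toric_val_poly_def using pairing_nonneg[OF u] Den_S[OF g']
    by (intro INF_greatest) auto
  ultimately have "toric_val_poly u g' = 0" by (simp add: zero_ereal_def)
  then have "toric_val u (quo f g) = toric_val_poly u f'"
    unfolding toric_val_def fg(1) by simp
  with fg(2) show ?thesis by (rule that)
qed

lemma toric_val_ideal_J:
  assumes u: "pos_on_S u" and E: "upset E" "E \<noteq> {}"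
  shows "toric_val_ideal u (J E) = ereal (min_pairing u E)"
proof (rule antisym)
  have ES: "E \<subseteq> S" using E(1) by (simp add: upset_def)
  obtain m where m: "m \<in> E" "min_pairing u E = real_of_int (lattice_pairing u m)"
    by (rule min_pairing_attained[OF u ES E(2)])
  have mS: "m \<in> S" using m(1) ES by blast
  obtain f g where fg: "(f, g) \<in> quo (Poly_Mapping.single m 1) 1"
      "toric_val u (quo (Poly_Mapping.single m 1) 1) = toric_val_poly u f"
    by (rule toric_val_quo[OF u single_S[OF mS] Den_one])
  then have "f = Poly_Mapping.single m 1 * g" "Poly_Mapping.lookup g 0 \<noteq> 0"
    by (auto simp: mem_quo_iff denominators_def mult.commute)
  then have "m \<in> Poly_Mapping.keys f"
    by (simp add: in_keys_iff lookup_mult_group)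
  have "toric_val_ideal u (J E) \<le> toric_val u (chi m)"
    unfolding toric_val_ideal_def using m(1) mS E(1) by (intro INF_lower) (simp add: chi_mem_J_iff)
  also have "\<dots> \<le> ereal (real_of_int (lattice_pairing u m))"
    unfolding chi_def fg(2) toric_val_poly_def using \<open>m \<in> Poly_Mapping.keys f\<close> by (rule INF_lower)
  finally show "toric_val_ideal u (J E) \<le> ereal (min_pairing u E)"
    by (simp add: m(2))
  show "ereal (min_pairing u E) \<le> toric_val_ideal u (J E)"
    unfolding toric_val_ideal_def
  proof (rule INF_greatest)
    fix x assume x: "x \<in> J E"
    then obtain f g where fg: "x = quo f g" "Poly_Mapping.keys f \<subseteq> S" "g \<in> Den"
      using J_memE[OF E(1)] by metis
    obtain f' g' where fg': "(f', g') \<in> quo f g" "toric_val u (quo f g) = toric_val_poly u f'"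
      by (rule toric_val_quo[OF u fg(2,3)])
    then have S': "Poly_Mapping.keys f' \<subseteq> S" "g' \<in> Den" and "quo f g = quo f' g'"
      using fg by (auto simp: mem_quo_iff quo_eq_iff)
    then have "Poly_Mapping.keys f' \<subseteq> E"
      using x fg(1) quo_mem_J_iff[OF E(1) S'] by simp
    then show "ereal (min_pairing u E) \<le> toric_val u x"
      unfolding fg(1) fg'(2) toric_val_poly_def
      using min_pairing_le[OF u ES] by (intro INF_greatest) auto
  qed
qed

lemma subset_integral_closure: "upset E \<Longrightarrow> J E \<subseteq> integral_closure L (J E)"
  by (rule J_subset_integral_closure) (auto intro!: exI[of _ 1] simp: sumpow_1[unfolded One_nat_def] simp del: sumpow.simps)

text \<open>The radical gives nonemptiness, as it contains a nonconstant monomial, of which some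
  power lies in \<open>I\<close>; properness of \<open>I\<close> excludes the exponent
  \<open>0\<close>.\<close>

lemma primary_monomial_ideal_exps:
  assumes "primary_monomial_ideal S I" "S \<noteq> {0}"
  shows "upset (exps I)" "J (exps I) = I" "exps I \<noteq> {}" "0 \<notin> exps I"
proof -
  have mono: "monomial_ideal S I" and I: "ideal I L" "I \<noteq> carrier L"
    and rad: "radical_ideal L I = toric_max_ideal S"
    using assms(1) unfolding primary_monomial_ideal_def primary_ideal_def L_eq by auto
  show "upset (exps I)" "J (exps I) = I"
    using monomial_ideal_exps[OF mono] by auto
  obtain s where s: "s \<in> S" "s \<noteq> 0" using assms(2) zero_mem by blast
  have "chi ` (S - {0}) \<subseteq> toric_max_ideal S"
    unfolding toric_max_ideal_def toric_monomial_eq[abs_def] L_eq[symmetric]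
    by (rule genideal_self) auto
  then have "chi s \<in> radical_ideal L I"
    using s rad by auto
  then obtain n :: nat where "chi s [^] n \<in> I"
    by (auto simp: radical_ideal_def)
  then have "int n *s s \<in> exps I"
    using s by (simp add: exps_def chi_pow smult_mem)
  then show "exps I \<noteq> {}" by blast
  show "0 \<notin> exps I"
    using ideal.one_imp_carrier[OF I(1)] I(2) by (auto simp: exps_def chi_zero)
qed

end

section \<open>Monomial filtrations, their exponent sets and their values\<close>

locale toric_filtration = toric_ring S u0 L
  for S :: "(int ^ 'n) set" and u0 :: "int ^ 'n" and L :: "('k::field, 'n) toric_elem ring" (structure) +
  fixes a :: "nat \<Rightarrow> ('k, 'n) toric_elem set"
  assumes filtration: "ideal_filtration L a"
    and primary: "\<And>p. 1 \<le> p \<Longrightarrow> primary_monomial_ideal S (a p)"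
    and nontrivial: "S \<noteq> {0}"
begin

definition A :: "nat \<Rightarrow> (int ^ 'n) set" where
  "A p = exps (a p)"

lemma A_0: "A 0 = S"
  using filtration by (auto simp: A_def exps_def ideal_filtration_def)

lemma A_nonempty: "A p \<noteq> {}"
  using primary_monomial_ideal_exps(3)[OF primary nontrivial, of p] A_0 zero_mem
  by (cases "p = 0") (auto simp: A_def)

lemma upset_A: "upset (A p)"
  using primary_monomial_ideal_exps(1)[OF primary nontrivial, of p] A_0 upset_S
  by (cases "p = 0") (auto simp: A_def)

lemma J_A: "J (A p) = a p"
proof (cases "p = 0")
  case True
  then show ?thesis using filtration A_0 J_S by (simp add: ideal_filtration_def)
next
  case False
  then show ?thesis
    using primary_monomial_ideal_exps(2)[OF primary nontrivial, of p] by (simp add: A_def)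
qed

lemma A_subset_S: "A p \<subseteq> S"
  using upset_A by (simp add: upset_def)

lemma A_add:
  assumes "x \<in> A p" "y \<in> A p'"
  shows "x + y \<in> A (p + p')"
proof -
  have zero: "z + s \<in> A r" if "z \<in> A r" "s \<in> A 0" for z s r
    using that upset_A[of r] unfolding upset_def A_0 by blast
  consider "p = 0" | "p' = 0" | "1 \<le> p" "1 \<le> p'" by linarith
  then show ?thesis
  proof cases
    case 1
    then show ?thesis using zero[OF assms(2)] assms(1) by (simp add: add.commute)
  next
    case 2
    then show ?thesis using zero[OF assms(1)] assms(2) by simp
  next
    case 3
    then have "ideal_prod L (a p) (a p') \<subseteq> a (p + p')"
      using filtration by (auto simp: ideal_filtration_def)
    moreover have "x \<in> S" "y \<in> S" "chi x \<in> a p" "chi y \<in> a p'"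
      using assms by (auto simp: A_def exps_def)
    ultimately have "chi (x + y) \<in> a (p + p')"
      using ideal_prod.prod[of "chi x" "a p" "chi y" "a p'" L] by (auto simp: chi_mult)
    then show ?thesis
      using \<open>x \<in> S\<close> \<open>y \<in> S\<close> by (simp add: A_def exps_def add_mem)
  qed
qed

lemma A_antimono:
  assumes "1 \<le> p" "p \<le> p'"
  shows "A p' \<subseteq> A p"
  using assms(2)
proof (induction p' rule: dec_induct)
  case (step p')
  then have "a (p' + 1) \<subseteq> a p'"
    using filtration assms(1) by (simp add: ideal_filtration_def)
  then have "A (Suc p') \<subseteq> A p'"
    by (auto simp: A_def exps_def)
  with step.IH show ?case by blast
qed simp

lemma A_smult: "m \<in> A p \<Longrightarrow> int k *s m \<in> A (k * p)"
proof (induction k)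
  case (Suc k)
  then show ?case
    unfolding smult_Suc_vec using A_add[of "int k *s m" "k * p" m p] by (simp add: add.commute)
qed (simp add: A_0 zero_mem)

lemma sumpow_A_subset: "sumpow (A p) k \<subseteq> A (k * p)"
proof (induction k)
  case (Suc k)
  then show ?case
    using A_add[of _ "k * p" _ p] by (fastforce simp: add.commute)
qed (simp add: A_0)

lemma min_pairing_A_add:
  assumes "pos_on_S u"
  shows "min_pairing u (A (p + p')) \<le> min_pairing u (A p) + min_pairing u (A p')"
proof -
  obtain m where m: "m \<in> A p" "min_pairing u (A p) = real_of_int (lattice_pairing u m)"
    by (rule min_pairing_attained[OF assms A_subset_S A_nonempty])
  obtain m' where m': "m' \<in> A p'" "min_pairing u (A p') = real_of_int (lattice_pairing u m')"
    by (rule min_pairing_attained[OF assms A_subset_S A_nonempty])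
  show ?thesis
    using min_pairing_le[OF assms A_subset_S A_add[OF m(1) m'(1)]] by (simp add: m m' lattice_pairing_add)
qed

lemma min_pairing_A_mono:
  assumes "pos_on_S u" "1 \<le> p" "p \<le> p'"
  shows "min_pairing u (A p) \<le> min_pairing u (A p')"
proof -
  obtain m where m: "m \<in> A p'" "min_pairing u (A p') = real_of_int (lattice_pairing u m)"
    by (rule min_pairing_attained[OF assms(1) A_subset_S A_nonempty])
  then show ?thesis
    using min_pairing_le[OF assms(1) A_subset_S, of m p] A_antimono[OF assms(2,3)] by auto
qed

definition val :: "int ^ 'n \<Rightarrow> real" where
  "val u = real_of_ereal (toric_val_filtration u a)"

lemma val_props:
  assumes u: "pos_on_S u"
  shows "toric_val_filtration u a = ereal (val u)"
    and "(\<lambda>p. min_pairing u (A p) / real p) \<longlonglongrightarrow> val u"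
    and "real p * val u \<le> min_pairing u (A p)"
proof -
  obtain l where l: "(\<lambda>p. min_pairing u (A p) / real p) \<longlonglongrightarrow> l"
      "\<And>p. 1 \<le> p \<Longrightarrow> l \<le> min_pairing u (A p) / real p"
    using increasing_subadditive_tendsto[of "\<lambda>p. min_pairing u (A p)",
      OF min_pairing_nonneg[OF u A_subset_S A_nonempty] min_pairing_A_add[OF u] min_pairing_A_mono[OF u]] by blast
  have "toric_val_ideal u (a p) / ereal (real p) = ereal (min_pairing u (A p) / real p)" if "1 \<le> p" for p
    using that toric_val_ideal_J[OF u upset_A A_nonempty, of p] by (simp add: J_A)
  then have "(\<lambda>p. toric_val_ideal u (a p) / ereal (real p)) \<longlonglongrightarrow> ereal l"
    using tendsto_ereal[OF l(1)]
    by (subst tendsto_cong[of _ "\<lambda>p. ereal (min_pairing u (A p) / real p)"]) (auto intro: eventually_sequentiallyI[of 1])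
  then have "toric_val_filtration u a = ereal l"
    unfolding toric_val_filtration_def by (rule limI)
  moreover from this have "val u = l" by (simp add: val_def)
  ultimately show "toric_val_filtration u a = ereal (val u)"
    and "(\<lambda>p. min_pairing u (A p) / real p) \<longlonglongrightarrow> val u" using l by auto
  show "real p * val u \<le> min_pairing u (A p)"
    using l(2)[of p] min_pairing_nonneg[OF u A_subset_S A_nonempty, of p] \<open>val u = l\<close>
    by (cases "p = 0") (auto simp: field_simps)
qed

text \<open>A bounded error \<open>d\<close> disappears in the limit. It absorbs the rounding of
  \<open>C * p\<close> in the linear bounds.\<close>

lemma val_ge:
  assumes u: "pos_on_S u" and ge: "\<And>p m. 1 \<le> p \<Longrightarrow> m \<in> A p \<Longrightarrow> real p * c - d \<le> real_of_int (lattice_pairing u m)"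
  shows "c \<le> val u"
proof (rule LIMSEQ_le[OF _ val_props(2)[OF u]])
  have "(\<lambda>p. c - d / real p) \<longlonglongrightarrow> c - 0"
    by (intro tendsto_intros lim_const_over_n)
  then show "(\<lambda>p. c - d / real p) \<longlonglongrightarrow> c" by simp
  have "c - d / real p \<le> min_pairing u (A p) / real p" if "1 \<le> p" for p
  proof -
    obtain m where m: "m \<in> A p" "min_pairing u (A p) = real_of_int (lattice_pairing u m)"
      by (rule min_pairing_attained[OF u A_subset_S A_nonempty])
    have "c - d / real p = (real p * c - d) / real p"
      using that by (simp add: diff_divide_distrib)
    also have "\<dots> \<le> min_pairing u (A p) / real p"
      using ge[OF that m(1)] m(2) by (intro divide_right_mono) simp_all
    finally show ?thesis .
  qed
  then show "\<exists>N. \<forall>p\<ge>N. c - d / real p \<le> min_pairing u (A p) / real p" by blast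
qed

text \<open>Values respect integrality, so the containments become inequalities that compare
  \<open>val\<close> with the value of the fixed ideal \<open>q\<close>. This yields positivity in
  the interior and a bound for the ratio of two such filtrations.\<close>

lemma linearly_bounded_val:
  assumes q: "primary_monomial_ideal S q" and lin: "linearly_bounded L q a"
  shows "\<exists>c C :: real. 0 < C \<and>
    (\<forall>u. pos_on_S u \<longrightarrow> val u \<le> c * min_pairing u (exps q) \<and> C * min_pairing u (exps q) \<le> val u)"
proof -
  let ?Q = "exps q"
  have Q: "upset ?Q" "J ?Q = q" "?Q \<noteq> {}" "?Q \<subseteq> S"
    using primary_monomial_ideal_exps[OF q nontrivial] by (auto simp: exps_def)
  obtain c C where c: "0 < C"
    and sub: "\<And>p. 1 \<le> p \<Longrightarrow> integral_closure L (J (sumpow ?Q (nat \<lceil>c * real p\<rceil>))) \<subseteq> integral_closure L (J (A p))"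
      "\<And>p. 1 \<le> p \<Longrightarrow> integral_closure L (J (A p)) \<subseteq> integral_closure L (J (sumpow ?Q (nat \<lfloor>C * real p\<rfloor>)))"
    using lin unfolding linearly_bounded_def J_A ideal_power_J[OF Q(1), symmetric] Q(2) by blast
  \<comment> \<open>\<open>val u\<close> is at most the value of \<open>A 1\<close>, so the upper
    bound is the case \<open>p = 1\<close> of the first containment, with the rounded exponent as
    constant.\<close>
  define k where "k = nat \<lceil>c * real 1\<rceil>"
  show ?thesis
  proof (rule exI[of _ "real k"], rule exI[of _ C], intro conjI c allI impI)
    fix u assume u: "pos_on_S u"
    obtain m where m: "m \<in> ?Q" "min_pairing u ?Q = real_of_int (lattice_pairing u m)"
      by (rule min_pairing_attained[OF u Q(4,3)])
    have mS: "m \<in> S" using m(1) Q(4) by blast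
    have "chi (int k *s m) \<in> J (sumpow ?Q k)"
      using smult_mem_sumpow[OF m(1)] mS upset_sumpow[OF Q(1)] by (simp add: chi_mem_J_iff smult_mem)
    then have "chi (int k *s m) \<in> integral_closure L (J (A 1))"
      using subset_integral_closure[OF upset_sumpow[OF Q(1)], of k] sub(1)[of 1] unfolding k_def by blast
    then obtain i where "1 \<le> i" "int i *s (int k *s m) \<in> sumpow (A 1) i"
      using chi_integral_imp[OF upset_A smult_mem[OF mS]] by blast
    then have "min_pairing u (A 1) \<le> real k * min_pairing u ?Q"
      using min_pairing_le_of_sumpow[OF u upset_A] by (fastforce simp: lattice_pairing_smult m(2))
    then show "val u \<le> real k * min_pairing u ?Q"
      using val_props(3)[OF u, of 1] by simp
  next
    fix u assume u: "pos_on_S u"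
    let ?\<mu> = "min_pairing u ?Q"
    have \<mu>: "0 \<le> ?\<mu>" by (rule min_pairing_nonneg[OF u Q(4,3)])
    show "C * ?\<mu> \<le> val u"
    proof (rule val_ge[OF u])
      fix p m assume p: "1 \<le> p" and m: "m \<in> A p"
      define k where "k = nat \<lfloor>C * real p\<rfloor>"
      have mS: "m \<in> S" using m A_subset_S by blast
      then have "chi m \<in> J (A p)" using m upset_A by (simp add: chi_mem_J_iff)
      then have "chi m \<in> integral_closure L (J (sumpow ?Q k))"
        using subset_integral_closure[OF upset_A, of p] sub(2)[OF p] unfolding k_def by blast
      then obtain i where i: "1 \<le> i" "int i *s m \<in> sumpow (sumpow ?Q k) i"
        using chi_integral_imp[OF upset_sumpow[OF Q(1)] mS] by blast
      have ge: "real k * ?\<mu> \<le> real_of_int (lattice_pairing u e)" if "e \<in> sumpow ?Q k" for e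
        using that by (rule pairing_sumpow_ge[rotated 2]) (auto intro: pairing_nonneg u min_pairing_le[OF u Q(4)])
      have "real i * (real k * ?\<mu>) \<le> real_of_int (lattice_pairing u (int i *s m))"
        by (rule pairing_sumpow_ge[OF _ ge i(2)]) (auto intro: pairing_nonneg u)
      then have "real k * ?\<mu> \<le> real_of_int (lattice_pairing u m)"
        using i(1) by (simp add: lattice_pairing_smult)
      moreover have "(C * real p - 1) * ?\<mu> \<le> real k * ?\<mu>"
        using \<mu> c by (intro mult_right_mono) (auto simp: k_def intro: less_imp_le real_of_int_floor_gt_diff_one)
      ultimately show "real p * (C * ?\<mu>) - ?\<mu> \<le> real_of_int (lattice_pairing u m)"
        by (simp add: algebra_simps)
    qed
  qed
qed

section \<open>Exponents of the Rees algebra\<close>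

lemma carrier_rees: "f \<in> carrier (rees_algebra L a) \<longleftrightarrow> f \<in> up L \<and> (\<forall>p. f p \<in> a p)"
  by (simp add: rees_algebra_def UP_def)

text \<open>Graded ideals of the Rees algebra prescribed by exponents. They are needed for the part
  of positive degree and for the exponents from which a generator splits off.\<close>

lemma rees_ideal:
  assumes ring: "ring (rees_algebra L a)" and W: "\<And>p. upset (W p)"
    and shift: "\<And>i j x y. x \<in> A i \<Longrightarrow> y \<in> W j \<Longrightarrow> x + y \<in> W (i + j)"
  shows "ideal {f \<in> carrier (rees_algebra L a). \<forall>p. f p \<in> J (W p)} (rees_algebra L a)"
    (is "ideal ?K ?R")
proof (rule ring.ideal_criterion[OF ring])
  interpret R: ring ?R by (rule ring)
  have prod_mem: "x \<otimes> y \<in> J (W (i + j))" "y \<otimes> x \<in> J (W (i + j))" if "x \<in> J (A i)" "y \<in> J (W j)" for x y i j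
  proof -
    have xy: "x \<otimes> y \<in> J {k + l | k l. k \<in> A i \<and> l \<in> W j}" "y \<otimes> x \<in> J {k + l | k l. k \<in> W j \<and> l \<in> A i}"
      unfolding ideal_prod_J[OF upset_A W, symmetric] ideal_prod_J[OF W upset_A, symmetric]
      using that by (auto intro: ideal_prod.prod)
    have "{k + l | k l. k \<in> A i \<and> l \<in> W j} \<subseteq> W (i + j)" "{k + l | k l. k \<in> W j \<and> l \<in> A i} \<subseteq> W (i + j)"
      using shift by (auto, metis add.commute)
    from this[THEN J_mono] show "x \<otimes> y \<in> J (W (i + j))" "y \<otimes> x \<in> J (W (i + j))"
      using xy by blast+
  qed
  show "?K \<subseteq> carrier ?R" by blast
  have "\<zero>\<^bsub>?R\<^esub> p = \<zero>" for p by (simp add: rees_algebra_def UP_def)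
  then show "\<zero>\<^bsub>?R\<^esub> \<in> ?K"
    using additive_subgroup.zero_closed[OF ideal.axioms(1)[OF ideal_J[OF W]]] by auto
  fix f g assume f: "f \<in> ?K"
  {
    assume g: "g \<in> ?K"
    have "(f \<oplus>\<^bsub>?R\<^esub> g) p = f p \<oplus> g p" for p
      using f g by (simp add: rees_algebra_def UP_def)
    then show "f \<oplus>\<^bsub>?R\<^esub> g \<in> ?K"
      using f g additive_subgroup.a_closed[OF ideal.axioms(1)[OF ideal_J[OF W]]] by auto
  next
    assume g: "g \<in> carrier ?R"
    have "(g \<otimes>\<^bsub>?R\<^esub> f) p = (\<Oplus>i\<in>{..p}. g i \<otimes> f (p - i))" "(f \<otimes>\<^bsub>?R\<^esub> g) p = (\<Oplus>i\<in>{..p}. f i \<otimes> g (p - i))" for p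
      using f g by (simp_all add: rees_algebra_def UP_def)
    moreover have "g i \<otimes> f (p - i) \<in> J (W p)" "f i \<otimes> g (p - i) \<in> J (W p)" if "i \<in> {..p}" for i p
      using prod_mem[of "g i" i "f (p - i)" "p - i"] prod_mem[of "g (p - i)" "p - i" "f i" i] f g that
      by (auto simp: carrier_rees J_A)
    ultimately have "(g \<otimes>\<^bsub>?R\<^esub> f) p \<in> J (W p)" "(f \<otimes>\<^bsub>?R\<^esub> g) p \<in> J (W p)" for p
      by (simp_all only: finsum_mem_ideal[OF ideal_J[OF W]])
    then show "g \<otimes>\<^bsub>?R\<^esub> f \<in> ?K" "f \<otimes>\<^bsub>?R\<^esub> g \<in> ?K"
      using f g by auto
  }
qed

text \<open>The ideal \<open>K W0\<close> of elements without part in degree \<open>0\<close> is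
  finitely generated; \<open>G\<close> consists of the exponents in the numerators of its
  generators, with their degrees. Splitting off members of \<open>G\<close> repeatedly shows that
  the semigroup of all \<open>(p, m)\<close> is generated by \<open>G\<close> together with
  \<open>S\<close> in degree \<open>0\<close>.\<close>

lemma noetherian_rees_generators:
  assumes "noetherian_ring (rees_algebra L a)"
  obtains G where "finite G" "\<And>p m. (p, m) \<in> G \<Longrightarrow> 1 \<le> p \<and> m \<in> A p"
    "\<And>p m. 1 \<le> p \<Longrightarrow> m \<in> A p \<Longrightarrow> \<exists>(p', m')\<in>G. p' \<le> p \<and> m - m' \<in> A (p - p')"
proof -
  interpret R: noetherian_ring "rees_algebra L a" by fact
  let ?R = "rees_algebra L a"
  define K where "K W = {f \<in> carrier ?R. \<forall>p. f p \<in> J (W p)}" for W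
  define W0 where "W0 p = (if p = 0 then {} else A p)" for p
  have W0: "upset (W0 p)" for p
    by (simp add: W0_def upset_empty upset_A)
  have "ideal (K W0) ?R"
    unfolding K_def using W0 by (rule rees_ideal[OF R.ring_axioms]) (auto simp: W0_def A_add split: if_splits)
  then obtain F where F: "F \<subseteq> carrier ?R" "finite F" "K W0 = genideal ?R F"
    using R.finetely_gen by blast
  then have FK: "F \<subseteq> K W0"
    using R.genideal_self by simp
  have ex_D: "\<exists>D. finite D \<and> D \<subseteq> W0 p \<and> f p \<in> J {d + s | d s. d \<in> D \<and> s \<in> S}" if "f \<in> F" for f p
  proof -
    have "f p \<in> J (W0 p)" using that FK by (auto simp: K_def)
    then obtain h g where hg: "f p = quo h g" "Poly_Mapping.keys h \<subseteq> W0 p" "Poly_Mapping.keys h \<subseteq> S" "g \<in> Den"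
      by (rule J_memE[OF W0])
    have "Poly_Mapping.keys h \<subseteq> {d + s | d s. d \<in> Poly_Mapping.keys h \<and> s \<in> S}"
    proof
      fix x assume "x \<in> Poly_Mapping.keys h"
      then show "x \<in> {d + s | d s. d \<in> Poly_Mapping.keys h \<and> s \<in> S}"
        using zero_mem by (intro CollectI exI[of _ x] exI[of _ 0]) simp
    qed
    then have "f p \<in> J {d + s | d s. d \<in> Poly_Mapping.keys h \<and> s \<in> S}"
      using hg by (auto simp: J_def)
    with hg(2) show ?thesis by (intro exI[of _ "Poly_Mapping.keys h"]) auto
  qed
  define D where "D f p = (SOME D. finite D \<and> D \<subseteq> W0 p \<and> f p \<in> J {d + s | d s. d \<in> D \<and> s \<in> S})" for f p
  have D: "finite (D f p)" "D f p \<subseteq> W0 p" "f p \<in> J {d + s | d s. d \<in> D f p \<and> s \<in> S}" if "f \<in> F" for f p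
    using someI_ex[OF ex_D[OF that, of p], folded D_def] by blast+
  define n where "n f = (SOME n. \<forall>p>n. f p = \<zero>)" for f :: "nat \<Rightarrow> ('k, 'n) toric_elem"
  have n: "f p = \<zero>" if "f \<in> F" "n f < p" for f p
  proof -
    have "\<exists>n. \<forall>p>n. f p = \<zero>"
      using F(1) that(1) by (auto simp: carrier_rees up_def bound_def)
    from someI_ex[OF this, folded n_def] show ?thesis
      using that(2) by blast
  qed
  define G where "G = (\<Union>f\<in>F. \<Union>p\<in>{..n f}. Pair p ` D f p)"
  have G_A: "1 \<le> p \<and> m \<in> A p" if "(p, m) \<in> G" for p m
  proof -
    have "m \<in> W0 p" using that D(2) by (auto simp: G_def)
    then show ?thesis by (auto simp: W0_def split: if_splits)
  qed
  \<comment> \<open>The exponents in degree \<open>p\<close> from which a member of \<open>G\<close>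
    can be split off. The ideal \<open>K W\<close> contains the generators \<open>F\<close>, hence
    all of \<open>K W0\<close>, and it remains to test it on single monomials.\<close>
  define W where "W p = {m. \<exists>(p', m')\<in>G. p' \<le> p \<and> m - m' \<in> A (p - p')}" for p
  have shift: "x + y \<in> W (i + j)" if "x \<in> A i" "y \<in> W j" for x y i j
  proof -
    obtain p' m' where *: "(p', m') \<in> G" "p' \<le> j" "y - m' \<in> A (j - p')"
      using \<open>y \<in> W j\<close> by (auto simp: W_def)
    have "x + (y - m') \<in> A (i + (j - p'))" by (rule A_add[OF that(1) *(3)])
    then have "x + y - m' \<in> A (i + j - p')" using *(2) by (simp add: algebra_simps)
    then show ?thesis using * by (auto simp: W_def intro!: bexI[of _ "(p', m')"])
  qed
  have "W p \<subseteq> S" for p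
  proof
    fix m assume "m \<in> W p"
    then obtain p' m' where *: "(p', m') \<in> G" "m - m' \<in> A (p - p')"
      by (auto simp: W_def)
    then have "m' \<in> S" "m - m' \<in> S" using G_A A_subset_S by blast+
    then show "m \<in> S" using add_mem by fastforce
  qed
  moreover have "e + s \<in> W p" if "e \<in> W p" "s \<in> S" for e s p
    using shift[of s 0 e p] that A_0 by (simp add: add.commute)
  ultimately have W: "upset (W p)" for p
    by (auto simp: upset_def)
  have "ideal (K W) ?R"
    unfolding K_def using W shift by (rule rees_ideal[OF R.ring_axioms])
  moreover have "F \<subseteq> K W"
  proof
    fix f assume f: "f \<in> F"
    have "f p \<in> J (W p)" for p
    proof (cases "p \<le> n f")
      case True
      have "d + s \<in> W p" if "d \<in> D f p" "s \<in> S" for d s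
      proof -
        have "(p, d) \<in> G" using f True that(1) by (auto simp: G_def)
        then show ?thesis using that(2) by (auto simp: W_def A_0 intro!: bexI[of _ "(p, d)"])
      qed
      then have "{d + s | d s. d \<in> D f p \<and> s \<in> S} \<subseteq> W p" by blast
      then show ?thesis using D(3)[OF f, of p] J_mono by blast
    next
      case False
      then show ?thesis
        using n[OF f] additive_subgroup.zero_closed[OF ideal.axioms(1)[OF ideal_J[OF W]]] by simp
    qed
    then show "f \<in> K W" using f F(1) by (auto simp: K_def)
  qed
  ultimately have K: "K W0 \<subseteq> K W"
    unfolding F(3) by (rule R.genideal_minimal)
  show ?thesis
  proof (rule that)
    show "finite G" unfolding G_def using F(2) D(1) by auto
    show "1 \<le> p \<and> m \<in> A p" if "(p, m) \<in> G" for p m by (rule G_A[OF that])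
    show "\<exists>(p', m')\<in>G. p' \<le> p \<and> m - m' \<in> A (p - p')" if "1 \<le> p" "m \<in> A p" for p m
    proof -
      \<comment> \<open>The element \<open>chi m\<close> times \<open>T ^ p\<close> of the Rees
        algebra.\<close>
      define e where "e i = (if i = p then chi m else \<zero>)" for i
      have mS: "m \<in> S" using that A_subset_S by blast
      have zero: "\<zero> \<in> J (W0 i)" "\<zero> \<in> J (A i)" for i
        by (rule additive_subgroup.zero_closed[OF ideal.axioms(1)[OF ideal_J]], simp add: W0 upset_A)+
      have chi: "chi m \<in> J (W0 p)" "chi m \<in> J (A p)"
        using that mS W0 upset_A by (auto simp: chi_mem_J_iff W0_def)
      have "e \<in> up L"
        using mS by (intro mem_upI) (auto simp: e_def bound_def intro!: exI[of _ p])
      then have "e \<in> K W0"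
        using zero chi by (auto simp: K_def carrier_rees e_def J_A[symmetric])
      then have "e p \<in> J (W p)"
        using K by (auto simp: K_def)
      then show ?thesis
        using W mS by (simp add: e_def chi_mem_J_iff W_def)
    qed
  qed
qed

text \<open>Splitting off a generator of degree \<open>p' \<ge> 1\<close> lowers the degree, so a
  linear bound on \<open>G\<close> propagates to all exponents; in degree \<open>0\<close> it is
  nonnegativity on \<open>S\<close>.\<close>

lemma pairing_ge_of_generators:
  assumes gen: "\<And>p m. 1 \<le> p \<Longrightarrow> m \<in> A p \<Longrightarrow> \<exists>(p', m')\<in>G. p' \<le> p \<and> m - m' \<in> A (p - p')"
    and G: "\<And>p m. (p, m) \<in> G \<Longrightarrow> 1 \<le> p"
    and u: "\<And>s. s \<in> S \<Longrightarrow> 0 \<le> lattice_pairing u s"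
    and c: "\<And>p m. (p, m) \<in> G \<Longrightarrow> int p * c \<le> lattice_pairing u m"
  shows "m \<in> A p \<Longrightarrow> int p * c \<le> lattice_pairing u m"
proof (induction p arbitrary: m rule: less_induct)
  case (less p)
  show ?case
  proof (cases "p = 0")
    case True
    then show ?thesis using less.prems A_0 u by simp
  next
    case False
    then obtain p' m' where *: "(p', m') \<in> G" "p' \<le> p" "m - m' \<in> A (p - p')"
      using gen[of p m] less.prems by auto
    have "int (p - p') * c \<le> lattice_pairing u (m - m')"
      using * G[OF *(1)] by (intro less.IH) auto
    then show ?thesis
      using c[OF *(1)] *(2) by (simp add: lattice_pairing_diff of_nat_diff algebra_simps)
  qed
qed

text \<open>By Farkas' lemma on \<open>M \<times> \<int>\<close>, the inequalities put a multiple of \<open>(m, P)\<close> into the semigroup generated by the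
  exponents of generators of the Rees algebra. Adding \<open>u0\<close> moves the separating functional
  into the interior.\<close>

lemma multiple_in_generated_semigroup:
  assumes gen: "\<And>p m. 1 \<le> p \<Longrightarrow> m \<in> A p \<Longrightarrow> \<exists>(p', m')\<in>G. p' \<le> p \<and> m - m' \<in> A (p - p')"
    and G: "finite G" "\<And>p m. (p, m) \<in> G \<Longrightarrow> 1 \<le> p \<and> m \<in> A p"
    and H: "finite H" "\<And>u. (\<And>h. h \<in> H \<Longrightarrow> 0 \<le> lattice_pairing u h) \<Longrightarrow> \<forall>s\<in>S. 0 \<le> lattice_pairing u s"
    and m: "m \<in> S" "\<And>u. pos_on_S u \<Longrightarrow> real P * val u \<le> real_of_int (lattice_pairing u m)"
  obtains l n where "1 \<le> l" "int l *s m = (\<Sum>(p, g)\<in>G \<union> {0} \<times> H. int (n (p, g)) *s g)"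
    "l * P = (\<Sum>(p, g)\<in>G \<union> {0} \<times> H. n (p, g) * p)"
proof -
  \<comment> \<open>Coordinates on \<open>M \<times> \<int>\<close>: \<open>None\<close> carries the
    degree and \<open>Some j\<close> the lattice. The elements of \<open>H\<close> enter in degree
    \<open>0\<close>, where the exponents are all of \<open>S\<close>.\<close>
  define vec where "vec = (\<lambda>(p, g) i. case i of None \<Rightarrow> int p | Some j \<Rightarrow> (g :: int ^ 'n) $ j)"
  have pair: "(\<Sum>i\<in>UNIV. vec (p, g) i * x i) = int p * x None + lattice_pairing (\<chi> j. x (Some j)) g" for p g x
    unfolding UNIV_option_conv vec_def lattice_pairing_def
    by (subst sum.insert) (auto simp: sum.reindex mult.commute)
  have "0 \<le> (\<Sum>i\<in>UNIV. vec (P, m) i * x i)"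
    if x: "\<forall>j\<in>G \<union> {0} \<times> H. 0 \<le> (\<Sum>i\<in>UNIV. vec j i * x i)" for x
  proof (rule ccontr)
    define c u where "c = x None" and "u = (\<chi> j. x (Some j))"
    assume "\<not> 0 \<le> (\<Sum>i\<in>UNIV. vec (P, m) i * x i)"
    then have neg: "int P * c + lattice_pairing u m < 0"
      by (simp add: pair c_def u_def)
    have G_ge: "0 \<le> int p * c + lattice_pairing u g" if "(p, g) \<in> G" for p g
      using bspec[OF x, of "(p, g)"] that unfolding pair c_def u_def by simp
    have "0 \<le> lattice_pairing u h" if "h \<in> H" for h
      using bspec[OF x, of "(0, h)"] that unfolding pair c_def u_def by simp
    then have S_ge: "0 \<le> lattice_pairing u s" if "s \<in> S" for s
      using H(2) that by blast
    define k where "k = lattice_pairing u0 m + 1"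
    have k: "1 \<le> k" using pairing_nonneg[OF pos_on_S_u0 m(1)] by (simp add: k_def)
    define w where "w = k *s u + u0"
    have w: "lattice_pairing w s = k * lattice_pairing u s + lattice_pairing u0 s" for s
      by (simp add: w_def lattice_pairing_def algebra_simps sum.distrib sum_distrib_left)
    have w_pos: "pos_on_S w"
      unfolding pos_on_S_def w using S_ge k pairing_pos by (auto intro: add_nonneg_pos)
    have G_le: "int p * (- (k * c)) \<le> lattice_pairing w g" if "(p, g) \<in> G" for p g
    proof -
      have "0 \<le> k * (int p * c + lattice_pairing u g)"
        using G_ge[OF that] k by simp
      moreover have "0 \<le> lattice_pairing u0 g"
        using G(2)[OF that] A_subset_S pairing_nonneg[OF pos_on_S_u0] by blast
      ultimately show ?thesis unfolding w by (simp add: algebra_simps)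
    qed
    have "int p * (- (k * c)) \<le> lattice_pairing w g" if "g \<in> A p" for p g
      by (rule pairing_ge_of_generators[OF gen _ _ G_le that])
        (use G(2) pairing_nonneg[OF w_pos] in auto)
    then have "real p * real_of_int (- (k * c)) - 0 \<le> real_of_int (lattice_pairing w g)" if "g \<in> A p" for p g
      using that by (metis diff_zero of_int_le_iff of_int_mult of_int_of_nat_eq)
    then have "real_of_int (- (k * c)) \<le> val w"
      by (intro val_ge[OF w_pos, where d = 0])
    then have "real P * real_of_int (- (k * c)) \<le> real P * val w"
      by (intro mult_left_mono) auto
    also have "\<dots> \<le> real_of_int (lattice_pairing w m)"
      by (rule m(2)[OF w_pos])
    finally have "real_of_int (int P * (- (k * c))) \<le> real_of_int (lattice_pairing w m)"
      by simp
    then have "int P * (- (k * c)) \<le> k * lattice_pairing u m + lattice_pairing u0 m"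
      unfolding w by (simp only: of_int_le_iff)
    then have "0 \<le> k * (int P * c + lattice_pairing u m) + lattice_pairing u0 m"
      by (simp add: algebra_simps)
    also have "\<dots> \<le> k * (- 1) + lattice_pairing u0 m"
      using neg k by (intro add_right_mono mult_left_mono) auto
    finally show False by (simp add: k_def)
  qed
  then obtain l n where l: "1 \<le> l" "\<And>i. int l * vec (P, m) i = (\<Sum>j\<in>G \<union> {0} \<times> H. int (n j) * vec j i)"
    using farkas_int[of "G \<union> {0} \<times> H" vec "vec (P, m)"] G(1) H(1) by auto
  show ?thesis
  proof (rule that[OF l(1)])
    show "int l *s m = (\<Sum>(p, g)\<in>G \<union> {0} \<times> H. int (n (p, g)) *s g)"
      unfolding vec_eq_iff
    proof
      fix i
      show "(int l *s m) $ i = (\<Sum>(p, g)\<in>G \<union> {0} \<times> H. int (n (p, g)) *s g) $ i"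
        using l(2)[of "Some i"] by (simp add: vec_def case_prod_unfold sum_component)
    qed
    have "int (l * P) = int (\<Sum>(p, g)\<in>G \<union> {0} \<times> H. n (p, g) * p)"
      using l(2)[of None] by (simp add: vec_def case_prod_unfold)
    then show "l * P = (\<Sum>(p, g)\<in>G \<union> {0} \<times> H. n (p, g) * p)"
      by (simp only: of_nat_eq_iff)
  qed
qed

text \<open>The constant \<open>N\<close> is the degree of a Veronese subalgebra of the Rees algebra that is generated in
  degree one.\<close>

lemma veronese_integral:
  assumes noeth: "noetherian_ring (rees_algebra L a)"
    and H: "finite H" "H \<subseteq> S" "\<And>u. (\<And>h. h \<in> H \<Longrightarrow> 0 \<le> lattice_pairing u h) \<Longrightarrow> \<forall>s\<in>S. 0 \<le> lattice_pairing u s"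
  obtains N where "1 \<le> N"
    "\<And>j m. m \<in> S \<Longrightarrow> (\<And>u. pos_on_S u \<Longrightarrow> real (N * j) * val u \<le> real_of_int (lattice_pairing u m)) \<Longrightarrow>
       \<exists>k\<ge>1. int k *s m \<in> sumpow (A (N * j)) k"
proof -
  obtain G where G: "finite G" "\<And>p m. (p, m) \<in> G \<Longrightarrow> 1 \<le> p \<and> m \<in> A p"
    "\<And>p m. 1 \<le> p \<Longrightarrow> m \<in> A p \<Longrightarrow> \<exists>(p', m')\<in>G. p' \<le> p \<and> m - m' \<in> A (p - p')"
    using noetherian_rees_generators[OF noeth] by blast
  \<comment> \<open>Divisible by the degree \<open>p\<close> of every generator \<open>g\<close>.
    Then \<open>N g\<close> is the sum of \<open>p\<close> copies of \<open>(N / p) g\<close>, an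
    element of \<open>A N\<close>, so scaling by \<open>N\<close> turns degree \<open>p\<close> into
    a \<open>p\<close>-fold sum from \<open>A N\<close>.\<close>
  define N where "N = (\<Prod>g\<in>G. fst g)"
  have N: "1 \<le> N"
    unfolding N_def using G(2) by (intro prod_ge_1) auto
  have scaled: "int N *s g \<in> sumpow (A N) p" if "(p, g) \<in> G \<union> {0} \<times> H" for p g
  proof (cases "(p, g) \<in> G")
    case True
    then have "p dvd N" unfolding N_def using G(1) by (metis dvd_prodI fst_conv)
    then obtain r where r: "N = r * p" by (metis dvd_def mult.commute)
    have "int r *s g \<in> A N"
      using A_smult[of g p r] G(2)[OF True] r by simp
    then have "int p *s (int r *s g) \<in> sumpow (A N) p"
      by (rule smult_mem_sumpow)
    then show ?thesis by (simp add: r mult.commute vector_smult_assoc)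
  next
    case False
    then show ?thesis using that H(2) smult_mem by auto
  qed
  show ?thesis
  proof (rule that[OF N])
    fix j m assume m: "m \<in> S" "\<And>u. pos_on_S u \<Longrightarrow> real (N * j) * val u \<le> real_of_int (lattice_pairing u m)"
    obtain l n where l: "1 \<le> l" "int l *s m = (\<Sum>(p, g)\<in>G \<union> {0} \<times> H. int (n (p, g)) *s g)"
        "l * (N * j) = (\<Sum>(p, g)\<in>G \<union> {0} \<times> H. n (p, g) * p)"
      by (rule multiple_in_generated_semigroup[OF G(3,1,2) H(1,3) m])
    have "int (N * l) *s m = int N *s (int l *s m)"
      by (simp add: vector_smult_assoc)
    also have "\<dots> = (\<Sum>i\<in>G \<union> {0} \<times> H. int (n i) *s (int N *s snd i))"
      unfolding l(2) by (simp add: vec_eq_iff sum_component sum_distrib_left case_prod_unfold mult_ac)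
    also have "\<dots> \<in> sumpow (A N) (\<Sum>i\<in>G \<union> {0} \<times> H. n i * fst i)"
      using G(1) H(1) scaled by (intro sum_mem_sumpow upset_A smult_sumpow) (auto simp del: sumpow.simps)
    \<comment> \<open>The factor \<open>N * l\<close> in front of \<open>m\<close> is also the
      number of blocks of \<open>j\<close> summands from \<open>A N\<close>, each of which lies in
      \<open>A (N * j)\<close>. This is the form that integrality requires.\<close>
    also have "(\<Sum>i\<in>G \<union> {0} \<times> H. n i * fst i) = j * (N * l)"
      using l(3) by (simp add: case_prod_unfold mult_ac)
    finally have "int (N * l) *s m \<in> sumpow (sumpow (A N) j) (N * l)"
      by (rule sumpow_sumpow)
    then have "int (N * l) *s m \<in> sumpow (A (N * j)) (N * l)"
      using sumpow_mono[OF sumpow_A_subset[of N j]] by (auto simp: mult.commute)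
    moreover have "1 \<le> N * l" using N l(1) by simp
    ultimately show "\<exists>k\<ge>1. int k *s m \<in> sumpow (A (N * j)) k" by blast
  qed
qed

end

section \<open>Containment in integral closures versus comparison of values\<close>

context toric_ring
begin

text \<open>The values in degrees \<open>p * t\<close> and \<open>q * t\<close> are compared. On the
  left \<open>val\<close> is a lower bound at every finite level; on the right the limit along the
  multiples of \<open>q\<close> is taken.\<close>

lemma val_ratio_le_of_containment:
  assumes "toric_filtration S u0 L a" "toric_filtration S u0 L b" and u: "pos_on_S u" and "1 \<le> q"
    and sub: "\<forall>\<^sub>F t in sequentially. b (q * t) \<subseteq> integral_closure L (a (p * t))"
  shows "real p * toric_filtration.val a u \<le> real q * toric_filtration.val b u"
proof -
  interpret a: toric_filtration S u0 L a by fact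
  interpret b: toric_filtration S u0 L b by fact
  have "filterlim (\<lambda>t. q * t) at_top sequentially"
    using \<open>1 \<le> q\<close> by (intro filterlim_subseq) (auto simp: strict_mono_def)
  then have "(\<lambda>t. min_pairing u (b.A (q * t)) / real (q * t)) \<longlonglongrightarrow> b.val u"
    by (rule filterlim_compose[OF b.val_props(2)[OF u]])
  then have "(\<lambda>t. real q * (min_pairing u (b.A (q * t)) / real (q * t))) \<longlonglongrightarrow> real q * b.val u"
    by (intro tendsto_intros)
  moreover have "\<forall>\<^sub>F t in sequentially. real p * a.val u \<le> real q * (min_pairing u (b.A (q * t)) / real (q * t))"
    using sub eventually_ge_at_top[of 1]
  proof eventually_elim
    fix t :: nat assume t: "b (q * t) \<subseteq> integral_closure L (a (p * t))" "1 \<le> t"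
    obtain m where m: "m \<in> b.A (q * t)" "min_pairing u (b.A (q * t)) = real_of_int (lattice_pairing u m)"
      by (rule min_pairing_attained[OF u b.A_subset_S b.A_nonempty])
    have mS: "m \<in> S" using m(1) b.A_subset_S by blast
    have "chi m \<in> J (b.A (q * t))"
      using m(1) mS b.upset_A by (simp add: chi_mem_J_iff)
    then have "chi m \<in> integral_closure L (J (a.A (p * t)))"
      using t(1) by (auto simp: a.J_A b.J_A)
    then obtain k where "1 \<le> k" "int k *s m \<in> sumpow (a.A (p * t)) k"
      by (rule chi_integral_imp[OF a.upset_A mS])
    then have "min_pairing u (a.A (p * t)) \<le> min_pairing u (b.A (q * t))"
      unfolding m(2) by (rule min_pairing_le_of_sumpow[OF u a.upset_A])
    then have "real (p * t) * a.val u \<le> min_pairing u (b.A (q * t))"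
      using a.val_props(3)[OF u, of "p * t"] by simp
    then show "real p * a.val u \<le> real q * (min_pairing u (b.A (q * t)) / real (q * t))"
      using t(2) \<open>1 \<le> q\<close> by (simp add: field_simps)
  qed
  ultimately show ?thesis
    by (rule tendsto_lowerbound) simp
qed

text \<open>Integrality is available only in degrees divisible by \<open>N\<close>. For large
  \<open>t\<close> the gap between \<open>z * p\<close> and \<open>q\<close> leaves room to replace
  \<open>p * t\<close> by the next larger multiple of \<open>N\<close>.\<close>

lemma containment_of_val_ratio_less:
  fixes z :: real
  assumes "toric_filtration S u0 L a" "toric_filtration S u0 L b"
    and noeth: "noetherian_ring (rees_algebra L a)"
    and H: "finite H" "H \<subseteq> S" "\<And>u. (\<And>h. h \<in> H \<Longrightarrow> 0 \<le> lattice_pairing u h) \<Longrightarrow> \<forall>s\<in>S. 0 \<le> lattice_pairing u s"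
    and z: "0 \<le> z" "\<And>u. pos_on_S u \<Longrightarrow> toric_filtration.val a u \<le> z * toric_filtration.val b u"
    and b_nonneg: "\<And>u. pos_on_S u \<Longrightarrow> 0 \<le> toric_filtration.val b u"
    and pq: "1 \<le> p" "z * real p < real q"
  shows "\<forall>\<^sub>F t in sequentially. b (q * t) \<subseteq> integral_closure L (a (p * t))"
proof -
  interpret a: toric_filtration S u0 L a by fact
  interpret b: toric_filtration S u0 L b by fact
  obtain N where N: "1 \<le> N"
    "\<And>j m. m \<in> S \<Longrightarrow> (\<And>u. pos_on_S u \<Longrightarrow> real (N * j) * a.val u \<le> real_of_int (lattice_pairing u m)) \<Longrightarrow>
       \<exists>k\<ge>1. int k *s m \<in> sumpow (a.A (N * j)) k"
    using a.veronese_integral[OF noeth H] by blast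
  define d where "d = real q - z * real p"
  have "0 < d" using pq by (simp add: d_def)
  show ?thesis
  proof (rule eventually_sequentiallyI)
    \<comment> \<open>Rounding up adds at most \<open>N\<close> to the degree, hence at most
      \<open>N * z\<close> after scaling by \<open>z\<close>, whereas the gap grows like
      \<open>t * d\<close>. The \<open>1\<close> ensures a positive degree \<open>p * t\<close>,
      from which on the filtration is decreasing.\<close>
    fix t assume t: "max 1 (nat \<lceil>real N * z / d\<rceil>) \<le> t"
    then have "real N * z / d \<le> real t" by linarith
    then have slack: "real N * z \<le> real t * d"
      using \<open>0 < d\<close> by (simp add: pos_divide_le_eq)
    define j where "j = (p * t) div N + 1"
    have "p * t < N * j"
      unfolding j_def using N(1) dividend_less_times_div[of N "p * t"] by simp
    have "N * j \<le> p * t + N"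
      unfolding j_def by simp
    then have "real (N * j) * z \<le> real (p * t + N) * z"
      using z(1) by (intro mult_right_mono) (simp_all only: of_nat_le_iff)
    also have "\<dots> \<le> real (q * t)"
      using slack by (simp add: d_def algebra_simps)
    finally have Nj: "real (N * j) * z \<le> real (q * t)" .
    have "\<exists>k\<ge>1. int k *s m \<in> sumpow (a.A (p * t)) k" if m: "m \<in> b.A (q * t)" for m
    proof -
      have mS: "m \<in> S" using m b.A_subset_S by blast
      have "real (N * j) * a.val u \<le> real_of_int (lattice_pairing u m)" if u: "pos_on_S u" for u
      proof -
        have "real (N * j) * a.val u \<le> real (N * j) * (z * b.val u)"
          by (intro mult_left_mono z(2) u) simp
        also have "\<dots> \<le> real (q * t) * b.val u"
          using mult_right_mono[OF Nj b_nonneg[OF u]] by (simp add: mult_ac)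
        also have "\<dots> \<le> min_pairing u (b.A (q * t))"
          by (rule b.val_props(3)[OF u])
        also have "\<dots> \<le> real_of_int (lattice_pairing u m)"
          by (rule min_pairing_le[OF u b.A_subset_S m])
        finally show ?thesis .
      qed
      then obtain k where "k \<ge> 1" "int k *s m \<in> sumpow (a.A (N * j)) k"
        using N(2)[OF mS] by blast
      moreover have "a.A (N * j) \<subseteq> a.A (p * t)"
        using \<open>p * t < N * j\<close> pq t by (intro a.A_antimono) auto
      ultimately show ?thesis
        using sumpow_mono by blast
    qed
    then have "J (b.A (q * t)) \<subseteq> integral_closure L (J (a.A (p * t)))"
      by (rule J_subset_integral_closure[OF a.upset_A b.upset_A])
    then show "b (q * t) \<subseteq> integral_closure L (a (p * t))"
      by (simp add: a.J_A b.J_A)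
  qed
qed

end

section \<open>The dual cone and its fan\<close>

lemma real_vec_add: "real_vec (x + y) = real_vec x + real_vec y"
  by (simp add: real_vec_def vec_eq_iff)

lemma real_vec_smult: "real_vec (c *s x) = real_of_int c *\<^sub>R real_vec x"
  by (simp add: real_vec_def vec_eq_iff)

lemma real_vec_zero [simp]: "real_vec 0 = 0"
  by (simp add: real_vec_def vec_eq_iff)

lemma real_vec_uminus: "real_vec (- x) = - real_vec x"
  by (simp add: real_vec_def vec_eq_iff)

lemma real_vec_eq_iff: "real_vec x = real_vec y \<longleftrightarrow> x = y"
  by (simp add: real_vec_def vec_eq_iff)

lemma inner_real_vec: "real_vec u \<bullet> real_vec m = real_of_int (lattice_pairing u m)"
  by (simp add: real_vec_def lattice_pairing_def inner_vec_def)

lemma lattice_pairing_sum_left: "lattice_pairing (\<Sum>i\<in>I. f i) m = (\<Sum>i\<in>I. lattice_pairing (f i) m)"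
  unfolding lattice_pairing_def sum_component sum_distrib_right by (rule sum.swap)

lemma fg_semigroupE:
  assumes "fg_semigroup S"
  obtains H where "finite H" "H \<subseteq> S" "0 \<in> S" "\<And>x y. x \<in> S \<Longrightarrow> y \<in> S \<Longrightarrow> x + y \<in> S"
    "\<And>P s. P 0 \<Longrightarrow> (\<And>h. h \<in> H \<Longrightarrow> P h) \<Longrightarrow> (\<And>x y. P x \<Longrightarrow> P y \<Longrightarrow> P (x + y)) \<Longrightarrow> s \<in> S \<Longrightarrow> P s"
proof -
  obtain H where H: "finite H" "S = (\<lambda>T. 0 \<in> T \<and> (\<forall>x\<in>T. \<forall>y\<in>T. x + y \<in> T)) hull H"
    using assms by (auto simp: fg_semigroup_def)
  show ?thesis
  proof (rule that[OF H(1)])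
    show "H \<subseteq> S" unfolding H(2) by (rule hull_subset)
    show "0 \<in> S" "\<And>x y. x \<in> S \<Longrightarrow> y \<in> S \<Longrightarrow> x + y \<in> S"
      unfolding H(2) hull_def by blast+
    fix P s assume "P 0" "\<And>h. h \<in> H \<Longrightarrow> P h" "\<And>x y. P x \<Longrightarrow> P y \<Longrightarrow> P (x + y)" "s \<in> S"
    moreover from this(1-3) have "S \<subseteq> Collect P"
      unfolding H(2) by (intro hull_minimal) auto
    ultimately show "P s" by blast
  qed
qed

lemma real_vec_mem_cone: "s \<in> S \<Longrightarrow> real_vec s \<in> semigroup_cone S"
  unfolding semigroup_cone_def by (rule hull_inc) simp

text \<open>For each nonzero generator \<open>h\<close> some functional is nonnegative on
  \<open>H\<close> and positive at \<open>h\<close>: otherwise Farkas' lemma writes a negative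
  multiple of \<open>h\<close> as a combination of generators, and the cone contains a line. The sum
  of these functionals is \<open>u0\<close>.\<close>

lemma pointed_cone_positive_functional:
  assumes fg: "fg_semigroup S" and pointed: "pointed_cone (semigroup_cone S)"
  obtains u0 where "\<And>s. s \<in> S \<Longrightarrow> s \<noteq> 0 \<Longrightarrow> 0 < lattice_pairing u0 s"
proof -
  obtain H where H: "finite H" "H \<subseteq> S" "0 \<in> S" "\<And>x y. x \<in> S \<Longrightarrow> y \<in> S \<Longrightarrow> x + y \<in> S"
    and ind: "\<And>P s. P 0 \<Longrightarrow> (\<And>h. h \<in> H \<Longrightarrow> P h) \<Longrightarrow> (\<And>x y. P x \<Longrightarrow> P y \<Longrightarrow> P (x + y)) \<Longrightarrow> s \<in> S \<Longrightarrow> P s"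
    using fg_semigroupE[OF fg] by blast
  have "\<exists>u. (\<forall>h'\<in>H. 0 \<le> lattice_pairing u h') \<and> 0 < lattice_pairing u h" if h: "h \<in> H - {0}" for h
  proof (rule ccontr)
    assume *: "\<not> ?thesis"
    have "0 \<le> (\<Sum>i\<in>UNIV. (- h) $ i * x i)" if "\<forall>j\<in>H. 0 \<le> (\<Sum>i\<in>UNIV. j $ i * x i)" for x
    proof -
      have "(\<Sum>i\<in>UNIV. j $ i * x i) = lattice_pairing (\<chi> i. x i) j" for j
        by (simp add: lattice_pairing_def mult.commute)
      then show ?thesis
        using * that by (auto simp: sum_negf not_less)
    qed
    then obtain l n where l: "1 \<le> l" "\<And>i. int l * (- h) $ i = (\<Sum>j\<in>H. int (n j) * j $ i)"
      using farkas_int[OF H(1), of "\<lambda>j. ($) j" "($) (- h)"] by blast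
    have smult: "int k *s x \<in> S" if "x \<in> S" for k x
    proof (induction k)
      case (Suc k)
      then show ?case unfolding smult_Suc_vec using H(4) that by blast
    qed (simp add: H(3))
    have "(\<Sum>j\<in>K. int (n j) *s j) \<in> S" if "finite K" "K \<subseteq> H" for K
      using that by (induction K rule: finite_induct) (auto intro: H(3,4) smult subsetD[OF H(2)])
    moreover have "- (int l *s h) = (\<Sum>j\<in>H. int (n j) *s j)"
      using l(2) by (simp add: vec_eq_iff sum_component)
    ultimately have "- (int l *s h) \<in> S" using H(1) by simp
    then have "- real_vec (int l *s h) \<in> semigroup_cone S"
      using real_vec_mem_cone by (metis real_vec_uminus)
    moreover have "real_vec (int l *s h) \<in> semigroup_cone S"
      using h H(2) smult by (intro real_vec_mem_cone) auto
    ultimately have "real_vec (int l *s h) = 0"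
      using pointed unfolding pointed_cone_def by blast
    then show False
      using l(1) h by (simp add: real_vec_smult) (metis real_vec_eq_iff real_vec_zero)
  qed
  then obtain w where w: "\<And>h h'. h \<in> H - {0} \<Longrightarrow> h' \<in> H \<Longrightarrow> 0 \<le> lattice_pairing (w h) h'"
      "\<And>h. h \<in> H - {0} \<Longrightarrow> 0 < lattice_pairing (w h) h"
    by metis
  define u0 where "u0 = (\<Sum>h\<in>H - {0}. w h)"
  have pos: "0 < lattice_pairing u0 h" if "h \<in> H - {0}" for h
    unfolding u0_def lattice_pairing_sum_left
    using that H(1) w by (intro sum_pos2[of _ h]) auto
  have "s = 0 \<or> 0 < lattice_pairing u0 s" if "s \<in> S" for s
    using that pos by (intro ind[of "\<lambda>s. s = 0 \<or> 0 < lattice_pairing u0 s" s]) (auto simp: lattice_pairing_add)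
  then show ?thesis using that by blast
qed

lemma dual_semigroup_cone: "dual_cone (semigroup_cone S) = {u. \<forall>s\<in>S. 0 \<le> u \<bullet> real_vec s}"
proof -
  have "semigroup_cone S \<subseteq> {m. 0 \<le> u \<bullet> m}" if "\<forall>s\<in>S. 0 \<le> u \<bullet> real_vec s" for u
    unfolding semigroup_cone_def using that convex_cone_halfspace_ge by (intro hull_minimal) auto
  then show ?thesis
    unfolding dual_cone_def using real_vec_mem_cone by blast
qed

text \<open>Positivity on the finitely many nonzero generators is an open condition and implies
  membership in the dual cone. Conversely, from an interior point a small step along
  \<open>- u0\<close> stays in the dual cone, which bounds the pairing with \<open>s\<close> below
  by a positive multiple of the one with \<open>u0\<close>.\<close>

lemma rel_interior_dual_cone_iff:
  assumes fg: "fg_semigroup S" and u0: "\<And>s. s \<in> S \<Longrightarrow> s \<noteq> 0 \<Longrightarrow> 0 < lattice_pairing u0 s"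
  shows "real_vec u \<in> rel_interior (dual_cone (semigroup_cone S)) \<longleftrightarrow>
    (\<forall>s\<in>S. s \<noteq> 0 \<longrightarrow> 0 < lattice_pairing u s)"
proof -
  let ?\<sigma> = "dual_cone (semigroup_cone S)"
  obtain H where H: "finite H" "H \<subseteq> S" "0 \<in> S" "\<And>x y. x \<in> S \<Longrightarrow> y \<in> S \<Longrightarrow> x + y \<in> S"
    and ind: "\<And>P s. P 0 \<Longrightarrow> (\<And>h. h \<in> H \<Longrightarrow> P h) \<Longrightarrow> (\<And>x y. P x \<Longrightarrow> P y \<Longrightarrow> P (x + y)) \<Longrightarrow> s \<in> S \<Longrightarrow> P s"
    using fg_semigroupE[OF fg] by blast
  have pos_interior: "real_vec u \<in> interior ?\<sigma>" if "\<forall>s\<in>S. s \<noteq> 0 \<longrightarrow> 0 < lattice_pairing u s" for u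
  proof (rule interiorI)
    let ?O = "\<Inter>h\<in>H - {0}. {x. 0 < x \<bullet> real_vec h}"
    show "open ?O"
      using H(1) by (intro open_INT ballI open_Collect_less continuous_intros) auto
    show "real_vec u \<in> ?O"
      using that H(2) by (auto simp: inner_real_vec)
    show "?O \<subseteq> ?\<sigma>"
    proof
      fix x assume x: "x \<in> ?O"
      have "0 \<le> x \<bullet> real_vec s" if "s \<in> S" for s
        using that
      proof (rule ind[of "\<lambda>s. 0 \<le> x \<bullet> real_vec s", rotated 3])
        show "0 \<le> x \<bullet> real_vec h" if "h \<in> H" for h
          using x that by (cases "h = 0") (auto intro: less_imp_le)
      qed (auto simp: real_vec_add inner_add_right)
      then show "x \<in> ?\<sigma>" by (simp add: dual_semigroup_cone)
    qed
  qed
  then have "interior ?\<sigma> \<noteq> {}" using u0 by blast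
  then have rel: "rel_interior ?\<sigma> = interior ?\<sigma>" by (rule rel_interior_nonempty_interior)
  have "0 < lattice_pairing u s" if u: "real_vec u \<in> interior ?\<sigma>" and s: "s \<in> S" "s \<noteq> 0" for s
  proof -
    obtain e where e: "0 < e" "cball (real_vec u) e \<subseteq> ?\<sigma>"
      using u mem_interior_cball by blast
    define t where "t = e / (norm (real_vec u0) + 1)"
    have n: "0 < norm (real_vec u0) + 1"
      using norm_ge_zero[of "real_vec u0"] by linarith
    then have t: "0 < t" unfolding t_def using e(1) by (rule divide_pos_pos[rotated])
    have "e * norm (real_vec u0) \<le> e * (norm (real_vec u0) + 1)"
      using e(1) by simp
    then have "t * norm (real_vec u0) \<le> e"
      using n by (simp add: t_def pos_divide_le_eq)
    then have "real_vec u - t *\<^sub>R real_vec u0 \<in> cball (real_vec u) e"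
      using t by (simp add: dist_norm)
    then have "real_vec u - t *\<^sub>R real_vec u0 \<in> ?\<sigma>"
      using e(2) by blast
    then have "0 \<le> (real_vec u - t *\<^sub>R real_vec u0) \<bullet> real_vec s"
      unfolding dual_semigroup_cone using s(1) by blast
    then have "t * real_of_int (lattice_pairing u0 s) \<le> real_of_int (lattice_pairing u s)"
      by (simp add: inner_diff_left inner_real_vec)
    moreover have "0 < t * real_of_int (lattice_pairing u0 s)"
      using t u0[OF s] by simp
    ultimately show ?thesis by linarith
  qed
  then show ?thesis
    unfolding rel using pos_interior[of u] by (intro iffI ballI impI)
qed

section \<open>Finitely generated cones and their rays\<close>

lemma convex_cone_hull_finite_sum:
  assumes "finite G" "x \<in> convex_cone hull G"
  obtains c where "\<And>g. g \<in> G \<Longrightarrow> 0 \<le> c g" "x = (\<Sum>g\<in>G. c g *\<^sub>R g)"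
proof -
  let ?C = "{\<Sum>g\<in>G. c g *\<^sub>R g | c. \<forall>g\<in>G. 0 \<le> c g}"
  have "convex_cone hull G \<subseteq> ?C"
  proof (rule hull_minimal)
    show "G \<subseteq> ?C"
    proof
      fix g assume g: "g \<in> G"
      have "(\<Sum>h\<in>G. (if h = g then 1 else 0) *\<^sub>R h) = (\<Sum>h\<in>G. if h = g then h else 0)"
        by (intro sum.cong) auto
      also have "\<dots> = g" using g assms(1) by simp
      finally show "g \<in> ?C"
        by (intro CollectI exI[of _ "\<lambda>h. if h = g then 1 else 0"]) auto
    qed
    show "convex_cone ?C"
      unfolding convex_cone_iff
    proof (intro conjI ballI allI impI)
      show "0 \<in> ?C" by (intro CollectI exI[of _ "\<lambda>_. 0"]) simp
      fix x assume "x \<in> ?C"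
      then obtain c where c: "x = (\<Sum>g\<in>G. c g *\<^sub>R g)" "\<forall>g\<in>G. 0 \<le> c g" by blast
      {
        fix y assume "y \<in> ?C"
        then obtain d where d: "y = (\<Sum>g\<in>G. d g *\<^sub>R g)" "\<forall>g\<in>G. 0 \<le> d g" by blast
        show "x + y \<in> ?C"
          using c d by (intro CollectI exI[of _ "\<lambda>g. c g + d g"]) (simp add: scaleR_add_left sum.distrib)
      next
        fix t :: real assume "0 \<le> t"
        then show "t *\<^sub>R x \<in> ?C"
          using c by (intro CollectI exI[of _ "\<lambda>g. t * c g"]) (simp add: scaleR_sum_right)
      }
    qed
  qed
  then show ?thesis using assms(2) that by blast
qed

lemma sum_mem_convex_cone_hull:
  assumes "\<And>g. g \<in> K \<Longrightarrow> 0 \<le> c g \<and> f g \<in> convex_cone hull G"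
  shows "(\<Sum>g\<in>K. c g *\<^sub>R f g) \<in> convex_cone hull G"
  using assms
  by (induction K rule: infinite_finite_induct)
    (auto intro!: convex_cone_hull_contains_0 convex_cone_hull_add convex_cone_hull_mul)

lemma convex_cone_hull_singleton: "convex_cone hull {v} = {t *\<^sub>R v | t. 0 \<le> t}"
proof
  show "convex_cone hull {v} \<subseteq> {t *\<^sub>R v | t. 0 \<le> t}"
  proof
    fix x assume "x \<in> convex_cone hull {v}"
    then show "x \<in> {t *\<^sub>R v | t. 0 \<le> t}"
      by (elim convex_cone_hull_finite_sum[of "{v}", rotated]) auto
  qed
  show "{t *\<^sub>R v | t. 0 \<le> t} \<subseteq> convex_cone hull {v}"
    by (auto intro: convex_cone_hull_mul hull_inc)
qed

lemma dim_ray: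
  fixes v :: "'a::euclidean_space"
  assumes v: "v \<noteq> 0"
  shows "dim (convex_cone hull {v}) = 1"
proof -
  have "convex_cone hull {v} \<subseteq> span {v}"
    unfolding convex_cone_hull_singleton by (auto intro: span_scale span_base)
  then have "dim (convex_cone hull {v}) \<le> dim (span {v})"
    by (rule dim_subset)
  moreover have "dim {v} \<le> dim (convex_cone hull {v})"
    by (intro dim_subset hull_subset)
  ultimately show ?thesis using v by simp
qed

text \<open>Let a point \<open>t *\<^sub>R g\<close> lie between \<open>a\<close> and
  \<open>b\<close>, and expand both in the generators. Irredundancy forces the combined coefficient
  \<open>e g\<close> to be at least \<open>t\<close>; then pointedness forces all other coefficients
  to vanish, so \<open>a\<close> and \<open>b\<close> lie on the ray.\<close>

lemma irredundant_generator_ray_face: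
  assumes fin: "finite G" and pointed: "pointed_cone (convex_cone hull G)"
    and irred: "g \<notin> convex_cone hull (G - {g})" and g: "g \<in> G" and nz: "\<And>h. h \<in> G \<Longrightarrow> h \<noteq> 0"
  shows "(convex_cone hull {g}) face_of (convex_cone hull G)"
  unfolding face_of_def
proof (intro conjI ballI impI)
  show "convex_cone hull {g} \<subseteq> convex_cone hull G"
    using g by (intro hull_mono) simp
  show "convex (convex_cone hull {g})" by (rule convex_convex_cone_hull)
  fix a b x
  assume ab: "a \<in> convex_cone hull G" "b \<in> convex_cone hull G" and x: "x \<in> convex_cone hull {g}" "x \<in> open_segment a b"
  obtain t where t: "0 \<le> t" "x = t *\<^sub>R g"
    using x(1) by (auto simp: convex_cone_hull_singleton)
  obtain r where r: "0 < r" "r < 1" "x = (1 - r) *\<^sub>R a + r *\<^sub>R b"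
    using x(2) by (auto simp: in_segment)
  obtain c where c: "\<And>h. h \<in> G \<Longrightarrow> 0 \<le> c h" "a = (\<Sum>h\<in>G. c h *\<^sub>R h)"
    using convex_cone_hull_finite_sum[OF fin ab(1)] by blast
  obtain d where d: "\<And>h. h \<in> G \<Longrightarrow> 0 \<le> d h" "b = (\<Sum>h\<in>G. d h *\<^sub>R h)"
    using convex_cone_hull_finite_sum[OF fin ab(2)] by blast
  define e where "e h = (1 - r) * c h + r * d h" for h
  have e: "0 \<le> e h" if "h \<in> G" for h
    using c(1)[OF that] d(1)[OF that] r by (simp add: e_def)
  have rest_mem: "(\<Sum>h\<in>K. e h *\<^sub>R h) \<in> convex_cone hull K'" if "K \<subseteq> G" "K \<subseteq> K'" for K K'
    using that e by (intro sum_mem_convex_cone_hull) (auto intro: hull_inc)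
  have "x = (\<Sum>h\<in>G. e h *\<^sub>R h)"
    unfolding r(3) c(2) d(2) e_def scaleR_sum_right sum.distrib[symmetric]
    by (intro sum.cong) (simp_all add: scaleR_add_left)
  also have "\<dots> = e g *\<^sub>R g + (\<Sum>h\<in>G - {g}. e h *\<^sub>R h)"
    using fin g by (rule sum.remove)
  finally have rest: "(t - e g) *\<^sub>R g = (\<Sum>h\<in>G - {g}. e h *\<^sub>R h)"
    using t(2) by (simp add: algebra_simps)
  have "t \<le> e g"
  proof (rule ccontr)
    assume "\<not> t \<le> e g"
    then have "g = inverse (t - e g) *\<^sub>R (\<Sum>h\<in>G - {g}. e h *\<^sub>R h)"
      unfolding rest[symmetric] by simp
    also have "\<dots> \<in> convex_cone hull (G - {g})"
      using \<open>\<not> t \<le> e g\<close> by (intro convex_cone_hull_mul rest_mem) auto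
    finally show False using irred by blast
  qed
  have zero: "e h = 0" if h: "h \<in> G - {g}" for h
  proof -
    let ?rest = "(e g - t) *\<^sub>R g + (\<Sum>h'\<in>G - {g} - {h}. e h' *\<^sub>R h')"
    have "(\<Sum>h\<in>G - {g}. e h *\<^sub>R h) = e h *\<^sub>R h + (\<Sum>h'\<in>G - {g} - {h}. e h' *\<^sub>R h')"
      using fin h by (intro sum.remove) auto
    then have "- (e h *\<^sub>R h) = ?rest"
      using rest by (simp add: algebra_simps)
    moreover have "?rest \<in> convex_cone hull G"
      using \<open>t \<le> e g\<close> g by (intro convex_cone_hull_add rest_mem convex_cone_hull_mul hull_inc) auto
    moreover have "e h *\<^sub>R h \<in> convex_cone hull G"
      using h e by (intro convex_cone_hull_mul hull_inc) auto
    ultimately have "e h *\<^sub>R h = 0"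
      using pointed unfolding pointed_cone_def by metis
    then show ?thesis using nz h by auto
  qed
  have "c h = 0" "d h = 0" if h: "h \<in> G - {g}" for h
  proof -
    have "0 \<le> (1 - r) * c h" "0 \<le> r * d h" "(1 - r) * c h + r * d h = 0"
      using c(1) d(1) h r zero[OF h] by (auto simp: e_def)
    then have "(1 - r) * c h = 0" "r * d h = 0" by linarith+
    then show "c h = 0" "d h = 0" using r by auto
  qed
  then have "(\<Sum>h\<in>G - {g}. c h *\<^sub>R h) = 0" "(\<Sum>h\<in>G - {g}. d h *\<^sub>R h) = 0"
    by simp_all
  then have "a = c g *\<^sub>R g" "b = d g *\<^sub>R g"
    unfolding c(2) d(2) using fin g by (simp_all add: sum.remove)
  then show "a \<in> convex_cone hull {g}" "b \<in> convex_cone hull {g}"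
    using c(1) d(1) g by (auto simp: convex_cone_hull_singleton)
qed

lemma primitive_multiple:
  assumes "g \<noteq> 0"
  obtains u d where "primitive_vec u" "0 < d" "g = d *s u"
proof -
  define d where "d = Gcd (range (($) g))"
  have "d \<noteq> 0"
    using assms by (auto simp: d_def vec_eq_iff)
  then have d: "0 < d"
    unfolding d_def by (metis Gcd_int_greater_eq_0 order_le_less)
  define u where "u = (\<chi> i. g $ i div d)"
  have gi: "g $ i = d * u $ i" for i
    unfolding u_def d_def by simp
  have "range (($) g) = (*) d ` range (($) u)"
    by (auto simp: gi image_image)
  then have "d = d * Gcd (range (($) u))"
    using d Gcd_mult[of d "range (($) u)"] d_def by simp
  then have "primitive_vec u"
    using d by (simp add: primitive_vec_def)
  moreover have "g = d *s u" by (simp add: vec_eq_iff gi)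
  ultimately show ?thesis using d that by blast
qed

lemma convex_cone_hull_scaled: "0 < t \<Longrightarrow> convex_cone hull {t *\<^sub>R v} = convex_cone hull {v}"
proof -
  assume t: "0 < t"
  have "\<exists>r'. r *\<^sub>R t *\<^sub>R v = r' *\<^sub>R v \<and> 0 \<le> r'" if "0 \<le> r" for r
    using that t by (intro exI[of _ "r * t"]) simp
  moreover have "\<exists>r'. r *\<^sub>R v = r' *\<^sub>R t *\<^sub>R v \<and> 0 \<le> r'" if "0 \<le> r" for r
    using that t by (intro exI[of _ "r / t"]) simp
  ultimately show ?thesis
    unfolding convex_cone_hull_singleton by auto
qed

text \<open>Both vectors become equal after scaling by the absolute value of a coordinate of the
  other one; comparing gcds shows that the two factors agree. Hence a finite fan has finitely many
  ray generators.\<close>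

lemma primitive_ray_inj:
  assumes "primitive_vec u" "primitive_vec w" "convex_cone hull {real_vec u} = convex_cone hull {real_vec w}"
  shows "u = w"
proof -
  have "real_vec w \<in> convex_cone hull {real_vec u}"
    unfolding assms(3) by (rule hull_inc) simp
  then obtain t where t: "0 \<le> t" "real_vec w = t *\<^sub>R real_vec u"
    by (auto simp: convex_cone_hull_singleton)
  have "u \<noteq> 0" using assms(1) by (auto simp: primitive_vec_def)
  then obtain k where k: "u $ k \<noteq> 0" by (auto simp: vec_eq_iff)
  have comp: "real_of_int (w $ i) = t * real_of_int (u $ i)" for i
    using t(2) by (simp add: real_vec_def vec_eq_iff)
  have "real_of_int (\<bar>u $ k\<bar> * w $ i) = real_of_int (\<bar>w $ k\<bar> * u $ i)" for i
    using t(1) by (simp add: comp abs_mult)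
  then have cross: "\<bar>u $ k\<bar> * w $ i = \<bar>w $ k\<bar> * u $ i" for i
    by (simp only: of_int_eq_iff)
  have "(*) \<bar>u $ k\<bar> ` range (($) w) = (*) \<bar>w $ k\<bar> ` range (($) u)"
    by (simp add: image_image cross)
  then have "\<bar>u $ k\<bar> = \<bar>w $ k\<bar>"
    using Gcd_mult[of "\<bar>u $ k\<bar>" "range (($) w)"] Gcd_mult[of "\<bar>w $ k\<bar>" "range (($) u)"] assms(1,2)
    by (simp add: primitive_vec_def)
  moreover from this have "w $ k \<noteq> 0" using k by auto
  ultimately show ?thesis using cross by (simp add: vec_eq_iff)
qed

lemma finite_ray_generators:
  assumes "rational_fan \<Sigma>"
  shows "finite (ray_generators \<Sigma>)"
proof (rule finite_imageD)
  have "(\<lambda>u. convex_cone hull {real_vec u}) ` ray_generators \<Sigma> \<subseteq> \<Sigma>"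
    by (auto simp: ray_generators_def fan_rays_def)
  then show "finite ((\<lambda>u. convex_cone hull {real_vec u}) ` ray_generators \<Sigma>)"
    using assms finite_subset by (auto simp: rational_fan_def)
  show "inj_on (\<lambda>u. convex_cone hull {real_vec u}) (ray_generators \<Sigma>)"
    by (auto simp: inj_on_def ray_generators_def intro: primitive_ray_inj)
qed

text \<open>A generating set of least cardinality is irredundant, so each of its members spans a
  face of \<open>\<tau>\<close>. Fans are closed under faces, which makes this face a ray of
  \<open>\<Sigma>\<close>.\<close>

lemma fan_cone_generated_by_rays:
  assumes fan: "rational_fan \<Sigma>" and \<tau>: "\<tau> \<in> \<Sigma>" and x: "x \<in> \<tau>"
  obtains K c where "finite K" "K \<subseteq> ray_generators \<Sigma>" "real_vec ` K \<subseteq> \<tau>"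
    "\<And>u. u \<in> K \<Longrightarrow> 0 \<le> c u" "x = (\<Sum>u\<in>K. c u *\<^sub>R real_vec u)"
proof -
  have cones: "\<forall>\<tau>\<in>\<Sigma>. rational_polyhedral_cone \<tau> \<and> pointed_cone \<tau>"
    and faces: "\<forall>\<tau>\<in>\<Sigma>. \<forall>F. F face_of \<tau> \<and> F \<noteq> {} \<longrightarrow> F \<in> \<Sigma>"
    using fan unfolding rational_fan_def by - (elim conjE, assumption)+
  have pointed: "pointed_cone \<tau>" using cones \<tau> by simp
  let ?P = "\<lambda>G. finite G \<and> \<tau> = convex_cone hull (real_vec ` G)"
  have "\<exists>G. ?P G"
    using bspec[OF cones \<tau>] unfolding rational_polyhedral_cone_def by (rule conjunct1)
  then obtain G0 where "?P G0" ..
  from ex_has_least_nat[of ?P, OF this, of card]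
  obtain G where "?P G \<and> (\<forall>G'. ?P G' \<longrightarrow> card G \<le> card G')" ..
  then have G: "finite G" "\<tau> = convex_cone hull (real_vec ` G)"
    and min: "\<forall>G'. ?P G' \<longrightarrow> card G \<le> card G'"
    by - (elim conjE, assumption)+
  have irred: "real_vec g \<notin> convex_cone hull (real_vec ` G - {real_vec g})" if g: "g \<in> G" for g
  proof
    assume *: "real_vec g \<in> convex_cone hull (real_vec ` G - {real_vec g})"
    have eq: "real_vec ` G - {real_vec g} = real_vec ` (G - {g})"
      by (auto simp: real_vec_eq_iff)
    have "convex_cone hull (real_vec ` G) = convex_cone hull (real_vec ` (G - {g}))"
    proof
      have "real_vec ` G \<subseteq> convex_cone hull (real_vec ` (G - {g}))"
      proof
        fix y assume "y \<in> real_vec ` G"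
        then show "y \<in> convex_cone hull (real_vec ` (G - {g}))"
          using * unfolding eq by (cases "y = real_vec g") (auto intro: hull_inc)
      qed
      then show "convex_cone hull (real_vec ` G) \<subseteq> convex_cone hull (real_vec ` (G - {g}))"
        by (intro hull_minimal convex_cone_convex_cone_hull)
    qed (intro hull_mono, blast)
    then have "card G \<le> card (G - {g})"
      using G min by simp
    then show False using card_Diff1_less[OF G(1) g] by simp
  qed
  have nz: "h \<noteq> 0" if "h \<in> real_vec ` G" for h
    using that irred convex_cone_hull_contains_0 by fastforce
  have "\<exists>u d. u \<in> ray_generators \<Sigma> \<and> 0 < d \<and> g = d *s u" if g: "g \<in> G" for g
  proof -
    have "g \<noteq> 0" using nz g by fastforce
    then obtain u d where u: "primitive_vec u" "0 < d" "g = d *s u"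
      by (rule primitive_multiple)
    have "(convex_cone hull {real_vec g}) face_of \<tau>"
      unfolding G(2) using G pointed irred[OF g] g nz
      by (intro irredundant_generator_ray_face) auto
    then have "convex_cone hull {real_vec g} \<in> \<Sigma>"
      by (intro faces[rule_format, OF \<tau>] conjI convex_cone_hull_nonempty)
    moreover have "dim (convex_cone hull {real_vec g}) = 1"
      using nz g by (intro dim_ray) auto
    moreover have "convex_cone hull {real_vec g} = convex_cone hull {real_vec u}"
      unfolding u(3) real_vec_smult using u(2) by (intro convex_cone_hull_scaled) simp
    ultimately show ?thesis
      using u by (auto simp: ray_generators_def fan_rays_def)
  qed
  then obtain w d where w: "\<And>g. g \<in> G \<Longrightarrow> w g \<in> ray_generators \<Sigma>" "\<And>g. g \<in> G \<Longrightarrow> 0 < d g"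
      "\<And>g. g \<in> G \<Longrightarrow> g = d g *s w g"
    by metis
  define K where "K = w ` G"
  have "convex_cone hull (real_vec ` G) \<subseteq> convex_cone hull (real_vec ` K)"
  proof (intro hull_minimal convex_cone_convex_cone_hull image_subsetI)
    fix g assume g: "g \<in> G"
    have "real_vec g = real_of_int (d g) *\<^sub>R real_vec (w g)"
      by (subst w(3)[OF g]) (rule real_vec_smult)
    also have "\<dots> \<in> convex_cone hull (real_vec ` K)"
      using g w(2) by (intro convex_cone_hull_mul hull_inc) (auto simp: K_def less_imp_le)
    finally show "real_vec g \<in> convex_cone hull (real_vec ` K)" .
  qed
  then have "x \<in> convex_cone hull (real_vec ` K)"
    using x G(2) by blast
  then obtain c where c: "\<And>y. y \<in> real_vec ` K \<Longrightarrow> 0 \<le> c y" "x = (\<Sum>y\<in>real_vec ` K. c y *\<^sub>R y)"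
    using convex_cone_hull_finite_sum[of "real_vec ` K"] G(1) unfolding K_def by blast
  show ?thesis
  proof (rule that)
    show "finite K" "K \<subseteq> ray_generators \<Sigma>" using G(1) w(1) by (auto simp: K_def)
    show "real_vec ` K \<subseteq> \<tau>"
    proof (clarsimp simp: K_def)
      fix g assume g: "g \<in> G"
      have "real_vec (w g) = inverse (real_of_int (d g)) *\<^sub>R real_vec g"
        by (subst (2) w(3)[OF g]) (use w(2)[OF g] in \<open>simp add: real_vec_smult\<close>)
      also have "\<dots> \<in> \<tau>"
        unfolding G(2) using g w(2)[OF g] by (intro convex_cone_hull_mul hull_inc) auto
      finally show "real_vec (w g) \<in> \<tau>" .
    qed
    show "0 \<le> c (real_vec u)" if "u \<in> K" for u using c(1) that by blast
    show "x = (\<Sum>u\<in>K. c (real_vec u) *\<^sub>R real_vec u)"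
      unfolding c(2) by (subst sum.reindex) (auto simp: inj_on_def real_vec_eq_iff)
  qed
qed

lemma ray_generators_subset: "u \<in> ray_generators \<Sigma> \<Longrightarrow> real_vec u \<in> \<Union>\<Sigma>"
  unfolding ray_generators_def fan_rays_def using hull_inc[of "real_vec u" "{real_vec u}" convex_cone] by blast

section \<open>The Lojasiewicz exponent\<close>

theorem theorem10p18:
  fixes S :: "(int ^ 'n) set"
    and R :: "('k::field, 'n) toric_elem ring"
    and \<sigma> :: "(real ^ 'n) set"
    and \<Sigma> :: "(real ^ 'n) set set"
    and a b :: "nat \<Rightarrow> ('k, 'n) toric_elem set"
    and q :: "('k, 'n) toric_elem set"
    and va vb :: "real ^ 'n \<Rightarrow> real"
  assumes "fg_semigroup S"
    and "pointed_cone (semigroup_cone S)"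
    and "rational_polyhedral_cone (semigroup_cone S)"
    and "dim (semigroup_cone S) = CARD('n)"
    and "\<sigma> = dual_cone (semigroup_cone S)"
    and "R = toric_local_ring S"
    and "ideal_filtration R a" and "\<forall>p\<ge>1. primary_monomial_ideal S (a p)"
    and "ideal_filtration R b" and "\<forall>p\<ge>1. primary_monomial_ideal S (b p)"
    and "noetherian_ring (rees_algebra R a)"
    and "primary_monomial_ideal S q"
    and "rational_fan \<Sigma>" and "\<Union>\<Sigma> = \<sigma>"
    and "linearly_bounded R q a" and "linearly_bounded R q b"
    and "fan_linear_extension \<sigma> \<Sigma> (\<lambda>u. toric_val_filtration u a) va"
    and "fan_linear_extension \<sigma> \<Sigma> (\<lambda>u. toric_val_filtration u b) vb"
  shows "finite {u \<in> ray_generators \<Sigma>. vb (real_vec u) > 0}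
       \<and> {u \<in> ray_generators \<Sigma>. vb (real_vec u) > 0} \<noteq> {}
       \<and> lojasiewicz_exponent R b a =
           (SUP u\<in>{u. real_vec u \<in> rel_interior \<sigma>}.
              toric_val_filtration u a / toric_val_filtration u b)
       \<and> (SUP u\<in>{u. real_vec u \<in> rel_interior \<sigma>}.
              toric_val_filtration u a / toric_val_filtration u b) =
           Max ((\<lambda>u. ereal (va (real_vec u) / vb (real_vec u))) `
                  {u \<in> ray_generators \<Sigma>. vb (real_vec u) > 0})"
proof -
  obtain H where H: "finite H" "H \<subseteq> S" "0 \<in> S" "\<And>x y. x \<in> S \<Longrightarrow> y \<in> S \<Longrightarrow> x + y \<in> S"
    and ind: "\<And>P s. P 0 \<Longrightarrow> (\<And>h. h \<in> H \<Longrightarrow> P h) \<Longrightarrow> (\<And>x y. P x \<Longrightarrow> P y \<Longrightarrow> P (x + y)) \<Longrightarrow> s \<in> S \<Longrightarrow> P s"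
    using fg_semigroupE[OF assms(1)] by blast
  have H_nonneg: "\<forall>s\<in>S. 0 \<le> lattice_pairing u s" if "\<And>h. h \<in> H \<Longrightarrow> 0 \<le> lattice_pairing u h" for u
    using that by (auto intro: ind[of "\<lambda>s. 0 \<le> lattice_pairing u s"] simp: lattice_pairing_add)
  obtain u0 where u0: "\<And>s. s \<in> S \<Longrightarrow> s \<noteq> 0 \<Longrightarrow> 0 < lattice_pairing u0 s"
    using pointed_cone_positive_functional[OF assms(1,2)] by blast
  \<comment> \<open>The locale \<open>ideal\<close> includes the ring axioms, so they are available
    for \<open>R\<close> through the filtration.\<close>
  have "ideal (a 1) R" using assms(7) by (auto simp: ideal_filtration_def)
  then have "ring R" by (rule ideal.axioms(2))
  interpret toric_ring S u0 R
    by (intro toric_ring.intro pointed_semigroup.intro toric_ring_axioms.intro \<open>ring R\<close> H(3,4) u0 assms(6))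
  have "S \<noteq> {0}"
  proof
    assume "S = {0}"
    then have "dim (semigroup_cone S) = 0"
      by (auto simp: semigroup_cone_def convex_cone_hull_singleton)
    then show False using assms(4) by simp
  qed
  have filt: "toric_filtration S u0 R a" "toric_filtration S u0 R b"
    using assms(7-10) \<open>S \<noteq> {0}\<close>
    by (auto intro!: toric_filtration.intro toric_filtration_axioms.intro toric_ring_axioms)
  interpret a: toric_filtration S u0 R a by (rule filt)
  interpret b: toric_filtration S u0 R b by (rule filt)
  have interior_iff: "real_vec u \<in> rel_interior \<sigma> \<longleftrightarrow> pos_on_S u" for u
    unfolding pos_on_S_def assms(5) by (rule rel_interior_dual_cone_iff[OF assms(1) u0])
  have \<sigma>_iff: "x \<in> \<sigma> \<longleftrightarrow> (\<forall>s\<in>S. 0 \<le> x \<bullet> real_vec s)" for x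
    unfolding assms(5) dual_semigroup_cone by simp
  note ext = assms(17,18)[unfolded fan_linear_extension_def]
  have va: "va (real_vec u) = a.val u" and vb: "vb (real_vec u) = b.val u" if "pos_on_S u" for u
    using ext that a.val_props(1)[OF that] b.val_props(1)[OF that] by (auto simp: interior_iff)

  obtain ca Ca where a_bounds: "0 < Ca"
    "\<And>u. pos_on_S u \<Longrightarrow> a.val u \<le> ca * min_pairing u (exps q)"
    "\<And>u. pos_on_S u \<Longrightarrow> Ca * min_pairing u (exps q) \<le> a.val u"
    using a.linearly_bounded_val[OF assms(12,15)] by metis
  obtain cb Cb where b_bounds: "0 < Cb"
    "\<And>u. pos_on_S u \<Longrightarrow> b.val u \<le> cb * min_pairing u (exps q)"
    "\<And>u. pos_on_S u \<Longrightarrow> Cb * min_pairing u (exps q) \<le> b.val u"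
    using b.linearly_bounded_val[OF assms(12,16)] by metis
  note Q = primary_monomial_ideal_exps[OF assms(12) \<open>S \<noteq> {0}\<close>]
  have Q_pos: "0 < min_pairing u (exps q)" if u: "pos_on_S u" for u
  proof -
    have "exps q \<subseteq> S" by (auto simp: exps_def)
    then obtain m where m: "m \<in> exps q" "min_pairing u (exps q) = real_of_int (lattice_pairing u m)"
      using min_pairing_attained[OF u _ Q(3)] by blast
    then have "m \<in> S" "m \<noteq> 0" using Q(4) by (auto simp: exps_def)
    then show ?thesis using u m(2) by (simp add: pos_on_S_def)
  qed
  have a_pos: "0 < a.val u" and b_pos: "0 < b.val u" if "pos_on_S u" for u
    using a_bounds(1,3) b_bounds(1,3) Q_pos that by (meson less_le_trans mult_pos_pos)+
  \<comment> \<open>Both filtrations are compared with \<open>q\<close>. Written without quotients,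
    the bound passes to boundary rays with \<open>vb = 0\<close>, where it forces
    \<open>va \<le> 0\<close>.\<close>
  have bounded: "Cb * a.val u \<le> ca * b.val u" if u: "pos_on_S u" for u
  proof -
    have "0 < ca * min_pairing u (exps q)"
      using a_pos[OF u] a_bounds(2)[OF u] by linarith
    then have "0 \<le> ca" using Q_pos[OF u] by (simp add: zero_less_mult_iff)
    have "Cb * a.val u \<le> Cb * (ca * min_pairing u (exps q))"
      using a_bounds(2)[OF u] b_bounds(1) by simp
    also have "\<dots> = ca * (Cb * min_pairing u (exps q))" by simp
    also have "\<dots> \<le> ca * b.val u"
      using b_bounds(3)[OF u] \<open>0 \<le> ca\<close> by (rule mult_left_mono)
    finally show ?thesis .
  qed

  \<comment> \<open>Inequalities between the values extend from the interior to lattice points \<open>u\<close> of the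
    boundary, as \<open>u\<close> is the limit of \<open>u + u0 / (k + 1)\<close>.\<close>
  have transfer: "x * va (real_vec u) \<le> y * vb (real_vec u)"
    if interior: "\<And>w. pos_on_S w \<Longrightarrow> x * a.val w \<le> y * b.val w" and u: "real_vec u \<in> \<sigma>" for x y u
  proof -
    define z where "z k = real_vec u + (1 / real (Suc k)) *\<^sub>R real_vec u0" for k
    have "0 \<le> real_vec u0 \<bullet> real_vec s" if "s \<in> S" for s
      using pairing_nonneg[OF pos_on_S_u0 that] by (simp add: inner_real_vec)
    then have z_mem: "z k \<in> \<sigma>" for k
      using u unfolding \<sigma>_iff z_def by (simp add: inner_add_left)
    have "(\<lambda>k. 1 / real (Suc k)) \<longlonglongrightarrow> 0"
      by (rule LIMSEQ_Suc[OF lim_const_over_n])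
    then have "z \<longlonglongrightarrow> real_vec u + 0 *\<^sub>R real_vec u0"
      unfolding z_def by (intro tendsto_intros)
    then have z_lim: "z \<longlonglongrightarrow> real_vec u" by simp
    have "(\<lambda>k. va (z k)) \<longlonglongrightarrow> va (real_vec u)" "(\<lambda>k. vb (z k)) \<longlonglongrightarrow> vb (real_vec u)"
      using ext z_mem by (auto intro!: continuous_on_tendsto_compose[OF _ z_lim u])
    then have "(\<lambda>k. x * va (z k)) \<longlonglongrightarrow> x * va (real_vec u)" "(\<lambda>k. y * vb (z k)) \<longlonglongrightarrow> y * vb (real_vec u)"
      by (auto intro: tendsto_mult_left)
    moreover have "x * va (z k) \<le> y * vb (z k)" for k
    proof -
      \<comment> \<open>Clearing the denominator of \<open>z k\<close> gives an interior lattice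
        point, where \<open>va\<close> and \<open>vb\<close> agree with the values of the
        filtrations; homogeneity leads back to \<open>z k\<close>.\<close>
      define w where "w = int (Suc k) *s u + u0"
      have w: "real_vec w = real (Suc k) *\<^sub>R z k"
        unfolding w_def z_def real_vec_add real_vec_smult by (simp add: scaleR_add_right del: of_nat_Suc)
      have "0 < lattice_pairing w s" if "s \<in> S" "s \<noteq> 0" for s
      proof -
        have "0 \<le> real_of_int (lattice_pairing u s)"
          using u that(1) by (simp add: \<sigma>_iff inner_real_vec)
        moreover have "lattice_pairing w s = int (Suc k) * lattice_pairing u s + lattice_pairing u0 s"
          by (simp add: w_def lattice_pairing_def algebra_simps sum.distrib sum_distrib_left)
        ultimately show ?thesis using pairing_pos[OF that] by (simp add: add_nonneg_pos)
      qed
      then have w_pos: "pos_on_S w" by (simp add: pos_on_S_def)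
      have "a.val w = real (Suc k) * va (z k)" "b.val w = real (Suc k) * vb (z k)"
        unfolding va[OF w_pos, symmetric] vb[OF w_pos, symmetric] w using ext z_mem by simp_all
      then have "real (Suc k) * (x * va (z k)) \<le> real (Suc k) * (y * vb (z k))"
        using interior[OF w_pos] by (simp add: mult.left_commute)
      then show ?thesis by (simp only: mult_le_cancel_left_pos of_nat_0_less_iff zero_less_Suc)
    qed
    ultimately show ?thesis
      by (intro LIMSEQ_le) auto
  qed

  define U where "U = {u \<in> ray_generators \<Sigma>. vb (real_vec u) > 0}"
  have ray_\<sigma>: "real_vec u \<in> \<sigma>" if "u \<in> ray_generators \<Sigma>" for u
    using ray_generators_subset[OF that] assms(14) by simp
  have U_fin: "finite U"
    using finite_ray_generators[OF assms(13)] by (simp add: U_def)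
  \<comment> \<open>Since both functions are linear on the same cone \<open>\<tau>\<close>, they
    share the coefficients \<open>c\<close>. This allows inequalities between them to be checked on
    rays.\<close>
  have decompose: "\<exists>K c. finite K \<and> K \<subseteq> ray_generators \<Sigma> \<and> (\<forall>u\<in>K. 0 \<le> c u) \<and>
      va x = (\<Sum>u\<in>K. c u * va (real_vec u)) \<and> vb x = (\<Sum>u\<in>K. c u * vb (real_vec u))" if "x \<in> \<sigma>" for x
  proof -
    obtain \<tau> where \<tau>: "\<tau> \<in> \<Sigma>" "x \<in> \<tau>" using \<open>x \<in> \<sigma>\<close> assms(14) by blast
    obtain K c where K: "finite K" "K \<subseteq> ray_generators \<Sigma>" "real_vec ` K \<subseteq> \<tau>"
      "\<And>u. u \<in> K \<Longrightarrow> 0 \<le> c u" "x = (\<Sum>u\<in>K. c u *\<^sub>R real_vec u)"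
      using fan_cone_generated_by_rays[OF assms(13) \<tau>] by blast
    have "f x = (\<Sum>u\<in>K. c u * f (real_vec u))" if f: "\<exists>l. linear l \<and> (\<forall>x\<in>\<tau>. f x = l x)" for f :: "real ^ 'n \<Rightarrow> real"
    proof -
      obtain l where l: "linear l" "\<forall>x\<in>\<tau>. f x = l x" using f by blast
      have "f x = l x" using l(2) \<tau>(2) by blast
      also have "\<dots> = (\<Sum>u\<in>K. c u *\<^sub>R l (real_vec u))"
        unfolding K(5) by (simp add: linear_sum[OF l(1)] linear_cmul[OF l(1)])
      also have "\<dots> = (\<Sum>u\<in>K. c u * f (real_vec u))"
        using K(3) l(2) by (intro sum.cong) auto
      finally show ?thesis .
    qed
    then show ?thesis
      using ext \<tau>(1) K by (intro exI[of _ K] exI[of _ c]) auto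
  qed
  have u0_\<sigma>: "real_vec u0 \<in> \<sigma>"
    using pos_on_S_u0 interior_iff rel_interior_subset by blast
  have U_nonempty: "U \<noteq> {}"
  proof
    assume "U = {}"
    obtain K c where K: "K \<subseteq> ray_generators \<Sigma>" "\<forall>u\<in>K. 0 \<le> c u"
      "vb (real_vec u0) = (\<Sum>u\<in>K. c u * vb (real_vec u))"
      using decompose[OF u0_\<sigma>] by blast
    have "c u * vb (real_vec u) \<le> 0" if "u \<in> K" for u
      using that K(1,2) \<open>U = {}\<close> by (auto simp: U_def not_less mult_nonneg_nonpos)
    then have "vb (real_vec u0) \<le> 0"
      unfolding K(3) by (rule sum_nonpos)
    then show False
      using b_pos[OF pos_on_S_u0] vb[OF pos_on_S_u0] by simp
  qed

  define M where "M = Max ((\<lambda>u. va (real_vec u) / vb (real_vec u)) ` U)"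
  have M_ge: "va (real_vec u) \<le> M * vb (real_vec u)" if u: "u \<in> ray_generators \<Sigma>" for u
  proof (cases "u \<in> U")
    case True
    then have "va (real_vec u) / vb (real_vec u) \<le> M"
      unfolding M_def using U_fin by (intro Max_ge) auto
    then show ?thesis using True by (simp add: U_def pos_divide_le_eq)
  next
    case False
    \<comment> \<open>With the coefficients \<open>0\<close> and \<open>1\<close>,
      \<open>transfer\<close> yields \<open>vb \<ge> 0\<close> on the ray, so outside
      \<open>U\<close> it vanishes.\<close>
    have "0 * va (real_vec u) \<le> 1 * vb (real_vec u)"
      using b_pos by (intro transfer ray_\<sigma> u) (simp add: less_imp_le)
    then have "vb (real_vec u) = 0"
      using False u by (simp add: U_def)
    moreover have "Cb * va (real_vec u) \<le> ca * vb (real_vec u)"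
      using bounded by (intro transfer ray_\<sigma> u)
    ultimately show ?thesis
      using b_bounds(1) by (simp add: mult_le_0_iff)
  qed
  have upper: "a.val u \<le> M * b.val u" if u: "pos_on_S u" for u
  proof -
    have u\<sigma>: "real_vec u \<in> \<sigma>" using u interior_iff rel_interior_subset by blast
    obtain K c where K: "K \<subseteq> ray_generators \<Sigma>" "\<forall>w\<in>K. 0 \<le> c w"
      "va (real_vec u) = (\<Sum>w\<in>K. c w * va (real_vec w))" "vb (real_vec u) = (\<Sum>w\<in>K. c w * vb (real_vec w))"
      using decompose[OF u\<sigma>] by blast
    have "va (real_vec u) \<le> (\<Sum>w\<in>K. c w * (M * vb (real_vec w)))"
      unfolding K(3) using K(1,2) by (intro sum_mono mult_left_mono M_ge) auto
    also have "\<dots> = M * vb (real_vec u)"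
      unfolding K(4) by (simp add: sum_distrib_left mult.left_commute)
    finally show ?thesis using va[OF u] vb[OF u] by simp
  qed
  \<comment> \<open>The maximum is attained at a ray, possibly on the boundary, to which the
    inequality transfers. Together with \<open>upper\<close> this makes \<open>M\<close> the least
    constant bounding \<open>a.val\<close> by \<open>b.val\<close> in the interior, and both
    equalities are derived from this characterization.\<close>
  have least: "M \<le> z" if "\<And>w. pos_on_S w \<Longrightarrow> a.val w \<le> z * b.val w" for z
  proof -
    have "M \<in> (\<lambda>u. va (real_vec u) / vb (real_vec u)) ` U"
      unfolding M_def using U_fin U_nonempty by (intro Max_in) auto
    then obtain u where u: "u \<in> U" "M = va (real_vec u) / vb (real_vec u)" by blast
    have "1 * va (real_vec u) \<le> z * vb (real_vec u)"
      using that u(1) by (intro transfer ray_\<sigma>) (auto simp: U_def)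
    then show ?thesis using u by (simp add: U_def pos_divide_le_eq)
  qed
  have M_pos: "0 < M"
    using a_pos[OF pos_on_S_u0] b_pos[OF pos_on_S_u0] upper[OF pos_on_S_u0]
    by (metis less_le_trans zero_less_mult_pos2)

  have ratio: "toric_val_filtration u a / toric_val_filtration u b = ereal (a.val u / b.val u)" if "pos_on_S u" for u
    using that b_pos[OF that] by (simp add: a.val_props(1) b.val_props(1))
  have Max_eq: "Max ((\<lambda>u. ereal (va (real_vec u) / vb (real_vec u))) ` U) = ereal M"
  proof (rule Max_eqI)
    show "ereal M \<in> (\<lambda>u. ereal (va (real_vec u) / vb (real_vec u))) ` U"
    proof -
      have "M \<in> (\<lambda>u. va (real_vec u) / vb (real_vec u)) ` U"
        unfolding M_def using U_fin U_nonempty by (intro Max_in) auto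
      then show ?thesis by blast
    qed
    show "y \<le> ereal M" if "y \<in> (\<lambda>u. ereal (va (real_vec u) / vb (real_vec u))) ` U" for y
      using that U_fin unfolding M_def by (auto intro: Max_ge)
  qed (use U_fin in simp)
  have SUP_eq: "(SUP u\<in>{u. real_vec u \<in> rel_interior \<sigma>}. toric_val_filtration u a / toric_val_filtration u b) = ereal M"
    (is "?sup = _")
  proof (rule antisym)
    show "?sup \<le> ereal M"
      using upper b_pos by (intro SUP_least) (simp add: interior_iff ratio pos_divide_le_eq)
    have ge: "ereal (a.val u / b.val u) \<le> ?sup" if "pos_on_S u" for u
      using that unfolding ratio[OF that, symmetric] by (intro SUP_upper) (simp add: interior_iff)
    show "ereal M \<le> ?sup"
    proof (cases ?sup)
      case (real z)
      have "M \<le> z"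
      proof (rule least)
        fix w assume w: "pos_on_S w"
        then have "a.val w / b.val w \<le> z" using ge[OF w] real by simp
        then show "a.val w \<le> z * b.val w" using b_pos[OF w] by (simp add: pos_divide_le_eq)
      qed
      then show ?thesis unfolding real by simp
    next
      case MInf
      then show ?thesis using ge[OF pos_on_S_u0] by simp
    qed simp
  qed
  have "lojasiewicz_exponent R b a = ereal M"
    unfolding lojasiewicz_exponent_def
  proof (rule antisym)
    let ?X = "{ereal (real q / real p) | p q. p \<ge> 1 \<and> q \<ge> 1 \<and>
            (\<forall>\<^sub>F t in sequentially. b (q * t) \<subseteq> integral_closure R (a (p * t)))}"
    show "Inf ?X \<le> ereal M"
    proof (rule dense_ge)
      \<comment> \<open>Containment is available for ratios strictly above \<open>M\<close>, so
        \<open>M\<close> is approached by rationals \<open>r\<close>. As \<open>M\<close> is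
        positive, \<open>r\<close> is a quotient of positive natural numbers.\<close>
      fix y assume "ereal M < y"
      then obtain z where z: "M < z" "ereal z < y" using ereal_dense2 by fastforce
      obtain r where r: "r \<in> \<rat>" "M < r" "r < z" using Rats_dense_in_real[OF z(1)] by blast
      obtain m n :: nat where mn: "n \<noteq> 0" "\<bar>r\<bar> = real m / real n"
        using Rats_abs_nat_div_natE[OF r(1)] by metis
      have r_eq: "r = real m / real n" using mn r(2) M_pos by simp
      have "M * real n < real m"
        using r(2) mn(1) unfolding r_eq by (simp add: pos_less_divide_eq)
      then have "\<forall>\<^sub>F t in sequentially. b (m * t) \<subseteq> integral_closure R (a (n * t))"
        using mn(1) M_pos upper b_pos
        by (intro containment_of_val_ratio_less[OF filt assms(11) H(1,2) H_nonneg, of M]) (auto simp: less_imp_le)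
      moreover have "1 \<le> m" using r(2) M_pos r_eq by (cases m) auto
      ultimately have "ereal r \<in> ?X"
        unfolding r_eq using mn(1) by (intro CollectI exI[of _ n] exI[of _ m]) auto
      then have "Inf ?X \<le> ereal r" by (rule Inf_lower)
      also have "ereal r \<le> y" using r(3) z(2) by (metis ereal_less_eq(3) less_imp_le order_trans)
      finally show "Inf ?X \<le> y" .
    qed
    show "ereal M \<le> Inf ?X"
    proof (rule Inf_greatest)
      fix y assume "y \<in> ?X"
      then obtain p m where y: "y = ereal (real m / real p)" "p \<ge> 1" "m \<ge> 1"
        "\<forall>\<^sub>F t in sequentially. b (m * t) \<subseteq> integral_closure R (a (p * t))" by blast
      have "M \<le> real m / real p"
      proof (rule least)
        fix w assume "pos_on_S w"
        then have "real p * a.val w \<le> real m * b.val w"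
          by (rule val_ratio_le_of_containment[OF filt _ y(3,4)])
        then show "a.val w \<le> real m / real p * b.val w"
          using y(2) by (simp add: field_simps)
      qed
      then show "ereal M \<le> y" by (simp add: y(1))
    qed
  qed
  then show ?thesis
    using U_fin U_nonempty Max_eq SUP_eq unfolding U_def by simp
qed

end
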